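(* Let $\alpha,\beta\in[0,2\pi)$ with $\beta\notin\{\alpha,\alpha\pm\pi\}$, and let $$u=\frac{1}{\sqrt2}\begin{bmatrix}1&1\\ e^{i\alpha}&-e^{i\alpha}\end{bmatrix},\qquad v=\frac{1}{\sqrt2}\begin{bmatrix}1&1\\ e^{i\beta}&-e^{i\beta}\end{bmatrix}.$$ Then the Sano-Watatani angle $\mathrm{Ang}_R(R_u,R_v)$ between the subfactors $R_u$ and $R_v$ of $R$ is the singleton set $\{\arccos|\cos(\alpha-\beta)|\}$.
   Context: Spin model subfactors (for $n=2$). $M_n$ is the algebra of complex $n\times n$ matrices, $\Delta_n\subset M_n$ the diagonal subalgebra, $E_{ij}$ the matrix units, $J_n=\frac1n\sum_{i,j}E_{ij}$. A complex Hadamard matrix means here a unitary $u\in M_n$ all of whose entries have modulus $1/\sqrt n$. Consider the tower $A_{-1}=\Delta_n\subset A_0=M_n\subset A_1=\Delta_n\otimes M_n\subset A_2=M_n\otimes M_n\subset\cdots$, i.e. $A_{2k}=M_n^{\otimes (k+1)}$, $A_{2k+1}=\Delta_n\otimes M_n^{\otimes(k+1)}$, where $A_{2k}\subset A_{2k+1}$ via $x\mapsto I_n\otimes x$ and $A_{2k+1}\subset A_{2k+2}$ is induced by $\Delta_n\subset M_n$. This is a tower of Jones basic constructions with Jones projections $e_{2k+1}=\sum_i E_{ii}\otimes E_{ii}\otimes I_n^{\otimes k}\in A_{2k+1}$ ($k\ge0$) and $e_{2k}=J_n\otimes I_n^{\otimes k}\in A_{2k}$ ($k\ge 1$). $R$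 is the hyperfinite $II_1$ factor obtained as the SOT-closure of $\bigcup_k A_k$ in the GNS representation of the normalized trace. The spin model subfactor $R_u\subset R$ is the von Neumann subalgebra generated by $u\Delta_nu^*\subset A_0$ and all $e_j$, $j\ge1$. The same $R$ and $e_j$ are used for $u$ and $v$. The condition $\beta\notin\{\alpha,\alpha\pm\pi\}$ is equivalent to $v\ne uPD$ for every permutation matrix $P$ and diagonal unitary $D$ (written $u\nsim v$), and to $R_u\ne R_v$. Sano-Watatani angle. For projections $p,q$ on a Hilbert space $\mathcal H$, let $\mathcal H_0$ be the orthogonal complement of the sum of the ranges of $p\wedge q$, $p\wedge q^\perp$, $p^\perp\wedge q$, $p^\perp\wedge q^\perp$. The angle operator $\Theta(p,q)$ is the positive operator on $p\mathcal H_0$ with spectrum in $[0,\pi/2]$ determined by $\cos^2\Theta(p,q)=pqp|_{p\mathcal H_0}$ ($0$ and $\pi/2$ are not eigenvalues). Set $\mathrm{Ang}(p,q)=\mathrm{sp}\,\Theta(p,q)$ if $pq\ne qp$, and $\mathrm{Ang}(p,q)=\{\pi/2\}$ otherwise. For von Neumann subalgebras $\mathcal P,\mathcal Q$ of a finite von Neumann algebra $\mathcal M$ with faithful normal tracial state, $\mathrm{Ang}_{\mathcal M}(\mathcal P,\mathcal Q)=\mathrm{Ang}(e_{\mathcal P},e_{\mathcal Q})$, where $e_{\mathcal P},e_{\mathcal Q}$ are the projections of $L^2(\mathcal M)$ onto $L^2(\mathcal P),L^2(\mathcal Q)$. *)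

theory Defs
  imports "HOL-Analysis.Analysis"
begin

section \<open>Complex inner product spaces and their completion\<close>

text \<open>The complex inner product is linear in its first argument. Norm and topology come from
  \<^class>\<open>real_inner\<close>, whose inner product is the real part of \<open>cinner\<close>.\<close>

class complex_inner = real_inner +
  fixes scaleC :: "complex \<Rightarrow> 'a \<Rightarrow> 'a"  (infixr "*\<^sub>C" 75)
    and cinner :: "'a \<Rightarrow> 'a \<Rightarrow> complex"
  assumes scaleC_add_right: "a *\<^sub>C (x + y) = a *\<^sub>C x + a *\<^sub>C y"
    and scaleC_add_left: "(a + b) *\<^sub>C x = a *\<^sub>C x + b *\<^sub>C x"
    and scaleC_scaleC: "a *\<^sub>C b *\<^sub>C x = (a * b) *\<^sub>C x"
    and scaleR_scaleC: "r *\<^sub>R x = complex_of_real r *\<^sub>C x"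
    and cinner_commute: "cinner x y = cnj (cinner y x)"
    and cinner_add_left: "cinner (x + y) z = cinner x z + cinner y z"
    and cinner_scaleC_left: "cinner (a *\<^sub>C x) y = a * cinner x y"
    and inner_eq_Re_cinner: "inner x y = Re (cinner x y)"

class complex_hilbert = complex_inner + complete_space

lemma cinner_add_right: "cinner x (y + z :: 'a::complex_inner) = cinner x y + cinner x z"
  by (metis cinner_add_left cinner_commute complex_cnj_add)

lemma cinner_scaleC_right: "cinner x (a *\<^sub>C (y::'a::complex_inner)) = cnj a * cinner x y"
  by (metis cinner_commute cinner_scaleC_left complex_cnj_mult)

lemma cinner_minus_left: "cinner (- x) (y::'a::complex_inner) = - cinner x y"
proof -
  have "cinner 0 y = 0" using cinner_add_left[of 0 0 y] by simp
  then show ?thesis using cinner_add_left[of x "- x" y] by (simp add: add_eq_0_iff)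
qed

lemma cinner_minus_right: "cinner x (- y :: 'a::complex_inner) = - cinner x y"
  by (metis cinner_commute cinner_minus_left complex_cnj_minus)

lemma cinner_diff_left: "cinner (x - y) (z::'a::complex_inner) = cinner x z - cinner y z"
  using cinner_add_left[of x "- y" z] by (simp add: cinner_minus_left)

lemma cinner_diff_right: "cinner x (y - z :: 'a::complex_inner) = cinner x y - cinner x z"
  using cinner_add_right[of x y "- z"] by (simp add: cinner_minus_right)

lemma norm_cinner_self: "cinner x x = complex_of_real ((norm (x::'a::complex_inner))\<^sup>2)"
  by (metis cinner_commute complex_cnj_cancel_iff complex_is_Real_iff inner_eq_Re_cinner
      of_real_Re power2_norm_eq_inner Reals_cnj_iff)

lemma norm_scaleC: "norm (a *\<^sub>C x) = cmod a * norm (x::'a::complex_inner)"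
proof -
  have "complex_of_real ((norm (a *\<^sub>C x))\<^sup>2) = (a * cnj a) * complex_of_real ((norm x)\<^sup>2)"
    unfolding norm_cinner_self[symmetric]
    by (simp add: cinner_scaleC_left cinner_scaleC_right mult.assoc)
  also have "\<dots> = complex_of_real ((cmod a * norm x)\<^sup>2)"
    by (simp add: complex_norm_square[symmetric] power_mult_distrib)
  finally have "(norm (a *\<^sub>C x))\<^sup>2 = (cmod a * norm x)\<^sup>2" using of_real_eq_iff by blast
  then show ?thesis by simp
qed

lemma scaleC_diff_right: "a *\<^sub>C (x - y) = a *\<^sub>C x - a *\<^sub>C (y::'a::complex_inner)"
  by (metis add_diff_cancel diff_add_cancel scaleC_add_right)

lemma cinner_Cauchy_Schwarz: "cmod (cinner x y) \<le> norm x * norm (y::'a::complex_inner)"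
proof (cases "cinner x y = 0")
  case False
  define a where "a = cnj (cinner x y) / cmod (cinner x y)"
  have a1: "cmod a = 1" using False by (simp add: a_def norm_divide)
  have "cinner (a *\<^sub>C x) y = complex_of_real (cmod (cinner x y))"
    using False unfolding cinner_scaleC_left a_def
    by (simp add: complex_norm_square[symmetric] mult.commute field_simps power2_eq_square)
  then have "cmod (cinner x y) = inner (a *\<^sub>C x) y" by (simp add: inner_eq_Re_cinner)
  also have "\<dots> \<le> norm (a *\<^sub>C x) * norm y" by (rule norm_cauchy_schwarz)
  finally show ?thesis by (simp add: norm_scaleC a1)
qed simp

lemma cinner_diff_bound:
  "cmod (cinner a b - cinner c d) \<le> norm (a - c) * norm b + norm c * norm (b - d :: 'a::complex_inner)"
proof -
  have "cinner a b - cinner c d = cinner (a - c) b + cinner c (b - d)"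
    by (simp add: cinner_diff_left cinner_diff_right)
  then have "cmod (cinner a b - cinner c d) \<le> cmod (cinner (a - c) b) + cmod (cinner c (b - d))"
    by (simp add: norm_triangle_ineq)
  also have "\<dots> \<le> norm (a - c) * norm b + norm c * norm (b - d)"
    by (intro add_mono cinner_Cauchy_Schwarz)
  finally show ?thesis .
qed

lemma Cauchy_add_seq:
  fixes X Y :: "nat \<Rightarrow> 'a::real_normed_vector"
  assumes "Cauchy X" "Cauchy Y" shows "Cauchy (\<lambda>n. X n + Y n)"
proof (rule CauchyI)
  fix e :: real assume "0 < e"
  then have e2: "0 < e/2" by simp
  obtain M where M: "\<forall>m\<ge>M. \<forall>n\<ge>M. norm (X m - X n) < e/2" using CauchyD[OF assms(1) e2] by blast
  obtain N where N: "\<forall>m\<ge>N. \<forall>n\<ge>N. norm (Y m - Y n) < e/2" using CauchyD[OF assms(2) e2] by blast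
  have "norm ((X m + Y m) - (X n + Y n)) < e" if "m \<ge> max M N" "n \<ge> max M N" for m n
  proof -
    have "norm ((X m + Y m) - (X n + Y n)) \<le> norm (X m - X n) + norm (Y m - Y n)"
      by (rule norm_diff_triangle_ineq)
    also have "\<dots> < e/2 + e/2" using M N that by (intro add_strict_mono) auto
    finally show ?thesis by simp
  qed
  then show "\<exists>M. \<forall>m\<ge>M. \<forall>n\<ge>M. norm ((X m + Y m) - (X n + Y n)) < e" by blast
qed

lemma Cauchy_Lipschitz:
  fixes X :: "nat \<Rightarrow> 'a::real_normed_vector" and f :: "'a \<Rightarrow> 'b::real_normed_vector"
  assumes "Cauchy X" "\<And>x y. norm (f x - f y) \<le> B * norm (x - y)" shows "Cauchy (\<lambda>n. f (X n))"
proof (rule CauchyI)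
  fix e :: real assume e: "0 < e"
  define C where "C = \<bar>B\<bar> + 1"
  have C: "C > 0" and BC: "B \<le> C" by (auto simp: C_def)
  obtain M where M: "\<forall>m\<ge>M. \<forall>n\<ge>M. norm (X m - X n) < e / C"
    using CauchyD[OF assms(1), of "e/C"] e C by auto
  have "norm (f (X m) - f (X n)) < e" if "m \<ge> M" "n \<ge> M" for m n
  proof -
    have "norm (f (X m) - f (X n)) \<le> B * norm (X m - X n)" by (rule assms(2))
    also have "\<dots> \<le> C * norm (X m - X n)" using BC by (intro mult_right_mono) auto
    also have "\<dots> < e" using M that C by (auto simp: field_simps)
    finally show ?thesis .
  qed
  then show "\<exists>M. \<forall>m\<ge>M. \<forall>n\<ge>M. norm (f (X m) - f (X n)) < e" by blast
qed

lemma Cauchy_uminus_seq: "Cauchy X \<Longrightarrow> Cauchy (\<lambda>n. - X n :: 'a::real_normed_vector)"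
proof (erule Cauchy_Lipschitz[where B=1])
  fix x y :: 'a
  show "norm (- x - - y) \<le> 1 * norm (x - y)"
    using norm_minus_commute[of x y] by simp
qed

lemma Cauchy_diff_seq: "Cauchy X \<Longrightarrow> Cauchy Y \<Longrightarrow> Cauchy (\<lambda>n. X n - Y n :: 'a::real_normed_vector)"
  using Cauchy_add_seq[of X "\<lambda>n. - Y n"] Cauchy_uminus_seq[of Y] by simp

lemma Cauchy_scaleC_seq: "Cauchy X \<Longrightarrow> Cauchy (\<lambda>n. a *\<^sub>C X n :: 'a::complex_inner)"
  by (erule Cauchy_Lipschitz[where B="cmod a"]) (simp add: scaleC_diff_right[symmetric] norm_scaleC)

lemma Cauchy_const_seq: "Cauchy (\<lambda>n. x :: 'a::real_normed_vector)"
  by (rule convergent_Cauchy) (rule convergent_const)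

lemma convergent_cinner:
  fixes X Y :: "nat \<Rightarrow> 'a::complex_inner"
  assumes X: "Cauchy X" and Y: "Cauchy Y" shows "convergent (\<lambda>n. cinner (X n) (Y n))"
proof (rule Cauchy_convergent, rule CauchyI)
  fix e :: real assume e: "0 < e"
  obtain K where K: "K > 0" "\<And>n. norm (X n) \<le> K" using Cauchy_Bseq[OF X] by (auto simp: Bseq_def)
  obtain L where L: "L > 0" "\<And>n. norm (Y n) \<le> L" using Cauchy_Bseq[OF Y] by (auto simp: Bseq_def)
  obtain M where M: "\<forall>m\<ge>M. \<forall>n\<ge>M. norm (X m - X n) < e/(2*L)"
    using CauchyD[OF X, of "e/(2*L)"] e L by auto
  obtain N where N: "\<forall>m\<ge>N. \<forall>n\<ge>N. norm (Y m - Y n) < e/(2*K)"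
    using CauchyD[OF Y, of "e/(2*K)"] e K by auto
  have "norm (cinner (X m) (Y m) - cinner (X n) (Y n)) < e" if mn: "m \<ge> max M N" "n \<ge> max M N" for m n
  proof -
    have "norm (cinner (X m) (Y m) - cinner (X n) (Y n)) \<le>
        norm (X m - X n) * norm (Y m) + norm (X n) * norm (Y m - Y n)"
      by (rule cinner_diff_bound)
    also have "\<dots> \<le> norm (X m - X n) * L + K * norm (Y m - Y n)"
      using K L by (intro add_mono mult_mono) (auto intro: less_imp_le)
    also have "\<dots> < e/(2*L) * L + K * (e/(2*K))"
      using M N mn K L by (intro add_strict_mono mult_strict_right_mono mult_strict_left_mono) auto
    also have "\<dots> = e" using K L by simp
    finally show ?thesis .
  qed
  then show "\<exists>M. \<forall>m\<ge>M. \<forall>n\<ge>M. norm (cinner (X m) (Y m) - cinner (X n) (Y n)) < e" by blast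
qed

definition completion_rel :: "(nat \<Rightarrow> 'a::complex_inner) \<Rightarrow> (nat \<Rightarrow> 'a) \<Rightarrow> bool" where
  "completion_rel X Y \<longleftrightarrow> Cauchy X \<and> Cauchy Y \<and> (\<lambda>n. X n - Y n) \<longlonglongrightarrow> 0"

lemma completion_rel_lin:
  assumes "completion_rel X X'" "completion_rel Y Y'"
  shows "completion_rel (\<lambda>n. X n + Y n) (\<lambda>n. X' n + Y' n)"
  using assms tendsto_add[of "\<lambda>n. X n - X' n" 0 sequentially "\<lambda>n. Y n - Y' n" 0]
  by (auto simp: completion_rel_def Cauchy_add_seq algebra_simps)

lemma completion_rel_scaleC:
  assumes "completion_rel X X'" shows "completion_rel (\<lambda>n. a *\<^sub>C X n) (\<lambda>n. a *\<^sub>C X' n)"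
proof -
  have "(\<lambda>n. a *\<^sub>C (X n - X' n)) \<longlonglongrightarrow> 0"
    using assms tendsto_mult_right_zero[of "\<lambda>n. norm (X n - X' n)" sequentially "cmod a"]
    by (auto simp: completion_rel_def intro!: tendsto_norm_zero_cancel[of "\<lambda>n. a *\<^sub>C (X n - X' n)"]
        simp: norm_scaleC tendsto_norm_zero)
  then show ?thesis using assms by (auto simp: completion_rel_def Cauchy_scaleC_seq scaleC_diff_right)
qed

lemma scaleC_m1: "(- 1) *\<^sub>C x = - (x::'a::complex_inner)"
  by (metis of_real_1 of_real_minus scaleR_minus1_left scaleR_scaleC)

lemma scaleC_1: "1 *\<^sub>C x = (x::'a::complex_inner)"
  by (metis of_real_1 scaleR_one scaleR_scaleC)

lemma completion_rel_cinner:
  assumes "completion_rel X X'" "completion_rel Y Y'"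
  shows "lim (\<lambda>n. cinner (X n) (Y n)) = lim (\<lambda>n. cinner (X' n) (Y' n))"
proof -
  have C: "Cauchy X" "Cauchy X'" "Cauchy Y" "Cauchy Y'"
    using assms by (auto simp: completion_rel_def)
  obtain L where L: "L > 0" "\<And>n. norm (Y n) \<le> L" using Cauchy_Bseq[OF C(3)] by (auto simp: Bseq_def)
  obtain K where K: "K > 0" "\<And>n. norm (X' n) \<le> K" using Cauchy_Bseq[OF C(2)] by (auto simp: Bseq_def)
  have "(\<lambda>n. norm (X n - X' n) * L + K * norm (Y n - Y' n)) \<longlonglongrightarrow> 0 * L + K * 0"
    using assms by (intro tendsto_intros) (auto simp: completion_rel_def tendsto_norm_zero)
  then have lim0: "(\<lambda>n. norm (X n - X' n) * L + K * norm (Y n - Y' n)) \<longlonglongrightarrow> 0" by simp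
  have "(\<lambda>n. cinner (X n) (Y n) - cinner (X' n) (Y' n)) \<longlonglongrightarrow> 0"
  proof (rule Lim_null_comparison[OF always_eventually lim0], rule allI)
    fix n
    have "norm (cinner (X n) (Y n) - cinner (X' n) (Y' n)) \<le>
        norm (X n - X' n) * norm (Y n) + norm (X' n) * norm (Y n - Y' n)"
      by (rule cinner_diff_bound)
    also have "\<dots> \<le> norm (X n - X' n) * L + K * norm (Y n - Y' n)"
      using K L by (intro add_mono mult_mono) (auto intro: less_imp_le)
    finally show "norm (cinner (X n) (Y n) - cinner (X' n) (Y' n)) \<le>
      norm (X n - X' n) * L + K * norm (Y n - Y' n)" .
  qed
  moreover have "(\<lambda>n. cinner (X n) (Y n) - cinner (X' n) (Y' n)) \<longlonglongrightarrow>
      lim (\<lambda>n. cinner (X n) (Y n)) - lim (\<lambda>n. cinner (X' n) (Y' n))"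
    using convergent_cinner C by (intro tendsto_diff) (auto simp: convergent_LIMSEQ_iff)
  ultimately show ?thesis using LIMSEQ_unique by fastforce
qed

quotient_type (overloaded) 'a completion = "nat \<Rightarrow> 'a::complex_inner" / partial: completion_rel
proof (rule part_equivpI)
  show "\<exists>X. completion_rel X (X :: nat \<Rightarrow> 'a)"
    by (rule exI[of _ "\<lambda>_. 0"]) (simp add: completion_rel_def Cauchy_const_seq)
  show "symp (completion_rel :: _ \<Rightarrow> (nat \<Rightarrow> 'a) \<Rightarrow> _)"
  proof (rule sympI)
    fix X Y :: "nat \<Rightarrow> 'a" assume "completion_rel X Y"
    then show "completion_rel Y X"
      using tendsto_minus[of "\<lambda>n. X n - Y n" 0 sequentially] by (auto simp: completion_rel_def)
  qed
  show "transp (completion_rel :: _ \<Rightarrow> (nat \<Rightarrow> 'a) \<Rightarrow> _)"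
  proof (rule transpI)
    fix X Y Z :: "nat \<Rightarrow> 'a" assume "completion_rel X Y" "completion_rel Y Z"
    then show "completion_rel X Z"
      using tendsto_add[of "\<lambda>n. X n - Y n" 0 sequentially "\<lambda>n. Y n - Z n" 0]
      by (auto simp: completion_rel_def)
  qed
qed

lemma completion_exhaust:
  obtains X where "x = abs_completion X" "Cauchy X"
  by (metis Quotient_completion Quotient_def completion_rel_def)

lemma completion_rel_refl: "Cauchy X \<Longrightarrow> completion_rel X X"
  by (simp add: completion_rel_def)

instantiation completion :: (complex_inner) complex_inner
begin

lift_definition zero_completion :: "'a completion" is "\<lambda>_. 0"
  by (simp add: completion_rel_def Cauchy_const_seq)
lift_definition plus_completion :: "'a completion \<Rightarrow> 'a completion \<Rightarrow> 'a completion"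
  is "\<lambda>X Y n. X n + Y n" by (rule completion_rel_lin)
lift_definition scaleC_completion :: "complex \<Rightarrow> 'a completion \<Rightarrow> 'a completion"
  is "\<lambda>a X n. a *\<^sub>C X n" by (rule completion_rel_scaleC)
lift_definition cinner_completion :: "'a completion \<Rightarrow> 'a completion \<Rightarrow> complex"
  is "\<lambda>X Y. lim (\<lambda>n. cinner (X n) (Y n))" by (rule completion_rel_cinner)

definition uminus_completion_def: "- (x :: 'a completion) = (- 1) *\<^sub>C x"
definition minus_completion_def: "(x :: 'a completion) - y = x + (- y)"
definition scaleR_completion_def: "r *\<^sub>R (x :: 'a completion) = complex_of_real r *\<^sub>C x"
definition inner_completion_def: "inner (x :: 'a completion) y = Re (cinner x y)"
definition norm_completion_def: "norm (x :: 'a completion) = sqrt (inner x x)"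
definition sgn_completion_def: "sgn (x :: 'a completion) = inverse (norm x) *\<^sub>R x"
definition dist_completion_def: "dist (x :: 'a completion) y = norm (x - y)"
definition uniformity_completion_def:
  "(uniformity :: ('a completion \<times> 'a completion) filter) =
    (INF e\<in>{0<..}. principal {(x, y). dist x y < e})"
definition open_completion_def:
  "open (U :: 'a completion set) = (\<forall>x\<in>U. \<forall>\<^sub>F (x', y) in uniformity. x' = x \<longrightarrow> y \<in> U)"

lemma cinner_completion_tendsto:
  assumes "Cauchy X" "Cauchy Y"
  shows "(\<lambda>n. cinner (X n) (Y n)) \<longlonglongrightarrow> cinner (abs_completion X) (abs_completion Y)"
  using convergent_cinner[OF assms] assms
  by (simp add: cinner_completion.abs_eq completion_rel_refl convergent_LIMSEQ_iff)

lemmas completion_abs_eqs = zero_completion_def plus_completion.abs_eq scaleC_completion.abs_eq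
  completion_rel_refl

instance
proof
  fix x y z :: "'a completion" and a b :: complex and r s :: real
  obtain X where X: "x = abs_completion X" "Cauchy X" by (rule completion_exhaust)
  obtain Y where Y: "y = abs_completion Y" "Cauchy Y" by (rule completion_exhaust)
  obtain Z where Z: "z = abs_completion Z" "Cauchy Z" by (rule completion_exhaust)
  note C = X(2) Y(2) Z(2) Cauchy_add_seq Cauchy_scaleC_seq Cauchy_const_seq
  note S = X(1) Y(1) Z(1) completion_abs_eqs C
  show addA: "x + y + z = x + (y + z)" by (simp add: S add.assoc)
  show addC: "x + y = y + x" by (simp add: S add.commute)
  show z1: "0 + x = x" by (simp add: S)
  have z0: "0 *\<^sub>C w = 0" for w :: 'a
    by (metis of_real_0 scaleR_scaleC scaleR_zero_left)
  show "- x + x = 0"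
    unfolding uminus_completion_def by (simp add: S scaleC_m1 Cauchy_uminus_seq)
  show "x - y = x + - y" by (rule minus_completion_def)
  have scl: "(a + b) *\<^sub>C x = a *\<^sub>C x + b *\<^sub>C x" for a b by (simp add: S scaleC_add_left)
  have scr: "a *\<^sub>C (x + y) = a *\<^sub>C x + a *\<^sub>C y" for a by (simp add: S scaleC_add_right)
  have scs: "a *\<^sub>C b *\<^sub>C x = (a * b) *\<^sub>C x" for a b by (simp add: S scaleC_scaleC)
  show "(a + b) *\<^sub>C x = a *\<^sub>C x + b *\<^sub>C x" "a *\<^sub>C (x + y) = a *\<^sub>C x + a *\<^sub>C y"
    "a *\<^sub>C b *\<^sub>C x = (a * b) *\<^sub>C x" "r *\<^sub>R x = complex_of_real r *\<^sub>C x"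
    by (fact scl scr scs scaleR_completion_def)+
  show "r *\<^sub>R (x + y) = r *\<^sub>R x + r *\<^sub>R y" "(r + s) *\<^sub>R x = r *\<^sub>R x + s *\<^sub>R x"
    "r *\<^sub>R s *\<^sub>R x = (r * s) *\<^sub>R x"
    by (simp_all add: scaleR_completion_def scl scr scs)
  show "1 *\<^sub>R x = x"
    by (simp add: scaleR_completion_def S scaleC_1)
  show "sgn x = inverse (norm x) *\<^sub>R x" by (rule sgn_completion_def)
  show "dist x y = norm (x - y)" by (rule dist_completion_def)
  show "(uniformity :: ('a completion \<times> 'a completion) filter) =
      (INF e\<in>{0<..}. principal {(x, y). dist x y < e})" by (rule uniformity_completion_def)
  show "\<And>U :: 'a completion set. open U = (\<forall>x\<in>U. \<forall>\<^sub>F (x', y) in uniformity. x' = x \<longrightarrow> y \<in> U)"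
    by (rule open_completion_def)
  have xy: "(\<lambda>n. cinner (X n) (Y n)) \<longlonglongrightarrow> cinner x y" using cinner_completion_tendsto X Y by blast
  have yx: "(\<lambda>n. cinner (Y n) (X n)) \<longlonglongrightarrow> cinner y x" using cinner_completion_tendsto X Y by blast
  have xz: "(\<lambda>n. cinner (X n) (Z n)) \<longlonglongrightarrow> cinner x z" using cinner_completion_tendsto X Z by blast
  have yz: "(\<lambda>n. cinner (Y n) (Z n)) \<longlonglongrightarrow> cinner y z" using cinner_completion_tendsto Y Z by blast
  have xx: "(\<lambda>n. cinner (X n) (X n)) \<longlonglongrightarrow> cinner x x" using cinner_completion_tendsto X by blast
  show com: "cinner x y = cnj (cinner y x)"
  proof -
    have "(\<lambda>n. cinner (X n) (Y n)) \<longlonglongrightarrow> cnj (cinner y x)"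
      using tendsto_cnj[OF yx] by (simp add: cinner_commute[symmetric])
    then show ?thesis using xy LIMSEQ_unique by blast
  qed
  show add: "cinner (x + y) z = cinner x z + cinner y z"
  proof -
    have "(\<lambda>n. cinner (X n + Y n) (Z n)) \<longlonglongrightarrow> cinner (x + y) z"
      using cinner_completion_tendsto[of "\<lambda>n. X n + Y n" Z] by (simp add: S)
    moreover have "(\<lambda>n. cinner (X n + Y n) (Z n)) \<longlonglongrightarrow> cinner x z + cinner y z"
      using tendsto_add[OF xz yz] by (simp add: cinner_add_left)
    ultimately show ?thesis using LIMSEQ_unique by blast
  qed
  have sc: "cinner (a *\<^sub>C x) y = a * cinner x y" for a
  proof -
    have "(\<lambda>n. cinner (a *\<^sub>C X n) (Y n)) \<longlonglongrightarrow> cinner (a *\<^sub>C x) y"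
      using cinner_completion_tendsto[of "\<lambda>n. a *\<^sub>C X n" Y] by (simp add: S)
    moreover have "(\<lambda>n. cinner (a *\<^sub>C X n) (Y n)) \<longlonglongrightarrow> a * cinner x y"
      using tendsto_mult_left[OF xy] by (simp add: cinner_scaleC_left)
    ultimately show ?thesis using LIMSEQ_unique by blast
  qed
  show "cinner (a *\<^sub>C x) y = a * cinner x y" by (rule sc)
  have sc1: "cinner (a *\<^sub>C x) x = a * cinner x x" for a
  proof -
    have "(\<lambda>n. cinner (a *\<^sub>C X n) (X n)) \<longlonglongrightarrow> cinner (a *\<^sub>C x) x"
      using cinner_completion_tendsto[of "\<lambda>n. a *\<^sub>C X n" X] by (simp add: S)
    moreover have "(\<lambda>n. cinner (a *\<^sub>C X n) (X n)) \<longlonglongrightarrow> a * cinner x x"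
      using tendsto_mult_left[OF xx] by (simp add: cinner_scaleC_left)
    ultimately show ?thesis using LIMSEQ_unique by blast
  qed
  show "inner x y = Re (cinner x y)" by (rule inner_completion_def)
  show "inner x y = inner y x" unfolding inner_completion_def com by simp
  show "inner (x + y) z = inner x z + inner y z" unfolding inner_completion_def add by simp
  show "inner (r *\<^sub>R x) y = r * inner x y" by (simp add: inner_completion_def scaleR_completion_def sc)
  have nn: "(\<lambda>n. (norm (X n))\<^sup>2) \<longlonglongrightarrow> inner x x"
    using tendsto_Re[OF xx] unfolding inner_completion_def norm_cinner_self by simp
  show "0 \<le> inner x x" by (rule LIMSEQ_le_const[OF nn]) auto
  show "(inner x x = 0) = (x = 0)"
  proof
    assume "inner x x = 0"
    then have "(\<lambda>n. sqrt ((norm (X n))\<^sup>2)) \<longlonglongrightarrow> sqrt 0" using nn tendsto_real_sqrt by metis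
    then have "X \<longlonglongrightarrow> 0" by (simp add: tendsto_norm_zero_iff)
    then have "completion_rel X (\<lambda>_. 0)" using X by (simp add: completion_rel_def Cauchy_const_seq)
    then show "x = 0" unfolding X zero_completion_def
      using Quotient_completion Quotient_rel_abs by fast
  next
    assume "x = 0"
    then have "0 *\<^sub>C x = x" by (simp add: zero_completion_def completion_abs_eqs Cauchy_const_seq z0)
    then show "inner x x = 0" using sc1[of 0] by (simp only: inner_completion_def) simp
  qed
  show "norm x = sqrt (inner x x)" by (rule norm_completion_def)
qed

end

definition emb :: "'a::complex_inner \<Rightarrow> 'a completion" where
  "emb x = abs_completion (\<lambda>_. x)"

lemma cinner_emb: "cinner (emb x) (emb y) = cinner x y"
  using cinner_completion_tendsto[of "\<lambda>_. x" "\<lambda>_. y"]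
  by (simp add: emb_def Cauchy_const_seq LIMSEQ_const_iff)

lemma emb_add: "emb (x + y) = emb x + emb y"
  by (simp add: emb_def completion_abs_eqs Cauchy_const_seq)

lemma emb_scaleC: "emb (a *\<^sub>C x) = a *\<^sub>C emb x"
  by (simp add: emb_def completion_abs_eqs Cauchy_const_seq)

lemma emb_diff: "emb (x - y) = emb x - emb y"
  using emb_add[of x "(- 1) *\<^sub>C y"] emb_scaleC[of "- 1" y] by (simp add: scaleC_m1)

lemma norm_emb: "norm (emb x) = norm x"
  by (simp add: norm_eq_sqrt_inner inner_eq_Re_cinner cinner_emb)

lemma norm_completion_tendsto:
  assumes "Cauchy X" shows "(\<lambda>n. norm (X n)) \<longlonglongrightarrow> norm (abs_completion X)"
proof -
  have "(\<lambda>n. sqrt (Re (cinner (X n) (X n)))) \<longlonglongrightarrow> sqrt (Re (cinner (abs_completion X) (abs_completion X)))"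
    using cinner_completion_tendsto[OF assms assms] by (intro tendsto_intros)
  then show ?thesis by (simp add: norm_eq_sqrt_inner inner_eq_Re_cinner)
qed

lemma abs_completion_diff:
  assumes "Cauchy X" "Cauchy Y"
  shows "abs_completion X - abs_completion Y = abs_completion (\<lambda>n. X n - Y n)"
proof -
  have "abs_completion Y + abs_completion (\<lambda>n. X n - Y n) = abs_completion X"
    using assms by (simp add: plus_completion.abs_eq completion_rel_refl Cauchy_diff_seq)
  then show ?thesis by (metis add_diff_cancel_left')
qed

lemma emb_tendsto:
  assumes X: "Cauchy X" shows "(\<lambda>n. emb (X n)) \<longlonglongrightarrow> abs_completion X"
proof (rule LIMSEQ_I)
  fix e :: real assume "0 < e"
  then obtain M where M: "\<forall>m\<ge>M. \<forall>n\<ge>M. norm (X m - X n) < e/2" using CauchyD[OF X, of "e/2"] by auto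
  have "norm (emb (X m) - abs_completion X) < e" if m: "m \<ge> M" for m
  proof -
    have eq: "emb (X m) - abs_completion X = abs_completion (\<lambda>n. X m - X n)"
      unfolding emb_def by (rule abs_completion_diff[OF Cauchy_const_seq X])
    have "(\<lambda>n. norm (X m - X n)) \<longlonglongrightarrow> norm (emb (X m) - abs_completion X)"
      unfolding eq by (intro norm_completion_tendsto Cauchy_diff_seq Cauchy_const_seq X)
    then have "norm (emb (X m) - abs_completion X) \<le> e/2"
      by (rule LIMSEQ_le_const2) (use M m in \<open>auto intro!: exI[of _ M] less_imp_le\<close>)
    then show ?thesis using \<open>0 < e\<close> by simp
  qed
  then show "\<exists>no. \<forall>n\<ge>no. norm (emb (X n) - abs_completion X) < e" by blast
qed

lemma closure_range_emb: "closure (range emb) = UNIV"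
proof -
  have "x \<in> closure (range emb)" for x :: "'a completion"
  proof -
    obtain X where "x = abs_completion X" "Cauchy X" by (rule completion_exhaust)
    then show ?thesis using emb_tendsto[of X]
      by (auto simp: closure_sequential intro!: exI[of _ "\<lambda>n. emb (X n)"])
  qed
  then show ?thesis by blast
qed

instance completion :: (complex_inner) complex_hilbert
proof
  fix F :: "nat \<Rightarrow> 'a completion" assume F: "Cauchy F"
  have "\<exists>x. dist (emb x) (F k) < inverse (real (Suc k))" for k
  proof -
    have "F k \<in> closure (range emb)" by (simp add: closure_range_emb)
    then have "\<exists>y\<in>range emb. dist y (F k) < inverse (real (Suc k))"
      unfolding closure_approachable by simp
    then show ?thesis by blast
  qed
  then obtain X where X: "\<And>k. dist (emb (X k)) (F k) < inverse (real (Suc k))" by metis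
  have "(\<lambda>k. norm (emb (X k) - F k)) \<longlonglongrightarrow> 0"
    by (rule Lim_null_comparison[OF always_eventually LIMSEQ_inverse_real_of_nat])
      (use X in \<open>auto simp: dist_norm intro: less_imp_le\<close>)
  then have d0: "(\<lambda>k. emb (X k) - F k) \<longlonglongrightarrow> 0" by (rule tendsto_norm_zero_cancel)
  have "Cauchy (\<lambda>k. (emb (X k) - F k) + F k)"
    by (rule Cauchy_add_seq[OF LIMSEQ_imp_Cauchy[OF d0] F])
  then have "Cauchy (\<lambda>k. emb (X k))" by simp
  then have CX: "Cauchy X" unfolding Cauchy_def dist_norm emb_diff[symmetric] norm_emb .
  have "(\<lambda>k. emb (X k) - (emb (X k) - F k)) \<longlonglongrightarrow> abs_completion X - 0"
    by (intro tendsto_diff emb_tendsto CX d0)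
  then have "F \<longlonglongrightarrow> abs_completion X" by simp
  then show "convergent F" by (rule convergentI)
qed


section \<open>The tower of matrix algebras\<close>

text \<open>Tensor factors are numbered from the right, starting with 0. The entry of a matrix at
  position \<open>s, t\<close> is indexed by words \<open>s, t\<close> whose \<open>j\<close>-th letter belongs to the \<open>j\<close>-th factor.
  A matrix of \<open>m\<close> tensor factors is represented by its amplification, with identity factors
  in all positions from \<open>m\<close> on, so that the embedding of \<open>x\<close> as \<open>I \<otimes> x\<close> is an inclusion.\<close>

type_synonym 'n kernel = "(nat \<Rightarrow> 'n) \<Rightarrow> (nat \<Rightarrow> 'n) \<Rightarrow> complex"

definition words :: "nat \<Rightarrow> (nat \<Rightarrow> 'n) set" where
  "words m = {..<m} \<rightarrow>\<^sub>E UNIV"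

definition amplify :: "nat \<Rightarrow> 'n kernel \<Rightarrow> 'n kernel" where
  "amplify m f = (\<lambda>s t. if \<forall>j\<ge>m. s j = t j then f (restrict s {..<m}) (restrict t {..<m}) else 0)"

definition tensor_mats :: "nat \<Rightarrow> 'n kernel set" where
  "tensor_mats m = range (amplify m)"

text \<open>\<open>tower (2k)\<close> has \<open>k + 1\<close> full factors; \<open>tower (2k + 1)\<close> has an additional diagonal
  factor in position \<open>k + 1\<close>.\<close>

definition tower :: "nat \<Rightarrow> 'n kernel set" where
  "tower j = (let k = j div 2 in
    if even j then tensor_mats (k + 1)
    else {x \<in> tensor_mats (k + 2). \<forall>s t. s (k + 1) \<noteq> t (k + 1) \<longrightarrow> x s t = 0})"

lemma finite_words: "finite (words m :: (nat \<Rightarrow> 'n::finite) set)"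
  by (simp add: words_def finite_PiE)

lemma card_words: "card (words m :: (nat \<Rightarrow> 'n::finite) set) = CARD('n) ^ m"
  by (simp add: words_def card_PiE)

lemma restrict_in_words: "restrict s {..<m} \<in> words m"
  by (simp add: words_def)

lemma restrict_words: "w \<in> words m \<Longrightarrow> restrict w {..<m} = w"
  by (auto simp: words_def PiE_restrict)

lemma words_agree: "v \<in> words m \<Longrightarrow> w \<in> words m \<Longrightarrow> m \<le> j \<Longrightarrow> v j = w j"
  by (auto simp: words_def PiE_def extensional_def)

lemma tensor_mats_iff: "x \<in> tensor_mats m \<longleftrightarrow>
  (\<forall>s t. x s t = (if \<forall>j\<ge>m. s j = t j then x (restrict s {..<m}) (restrict t {..<m}) else 0))"
proof
  assume "x \<in> tensor_mats m"
  then obtain f where "x = amplify m f" by (auto simp: tensor_mats_def)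
  then show "\<forall>s t. x s t = (if \<forall>j\<ge>m. s j = t j then x (restrict s {..<m}) (restrict t {..<m}) else 0)"
    by (auto simp: amplify_def)
next
  assume *: "\<forall>s t. x s t = (if \<forall>j\<ge>m. s j = t j then x (restrict s {..<m}) (restrict t {..<m}) else 0)"
  have "x = amplify m x" unfolding amplify_def by (intro ext) (use * in blast)
  then show "x \<in> tensor_mats m" by (auto simp: tensor_mats_def)
qed

lemma tensor_mats_eq: "x \<in> tensor_mats m \<Longrightarrow> \<forall>j\<ge>m. s j = t j \<Longrightarrow>
    x s t = x (restrict s {..<m}) (restrict t {..<m})"
  unfolding tensor_mats_iff by metis

lemma tensor_mats_zero: "x \<in> tensor_mats m \<Longrightarrow> \<not> (\<forall>j\<ge>m. s j = t j) \<Longrightarrow> x s t = 0"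
  unfolding tensor_mats_iff by metis

lemma tensor_matsI:
  assumes "\<And>s t. \<not> (\<forall>j\<ge>m. s j = t j) \<Longrightarrow> x s t = 0"
    and "\<And>s t. \<forall>j\<ge>m. s j = t j \<Longrightarrow> x s t = x (restrict s {..<m}) (restrict t {..<m})"
  shows "x \<in> tensor_mats m"
  unfolding tensor_mats_iff using assms by (intro allI) (simp only: split: if_split, blast)

lemma tensor_mats_mono: assumes x: "x \<in> tensor_mats m" and le: "m \<le> m'" shows "x \<in> tensor_mats m'"
proof (rule tensor_matsI)
  fix s t :: "nat \<Rightarrow> 'a"
  assume "\<not> (\<forall>j\<ge>m'. s j = t j)"
  then have "\<not> (\<forall>j\<ge>m. s j = t j)" using le order_trans by blast
  then show "x s t = 0" using tensor_mats_zero[OF x] by blast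
next
  fix s t :: "nat \<Rightarrow> 'a"
  assume a: "\<forall>j\<ge>m'. s j = t j"
  let ?s = "restrict s {..<m'}" and ?t = "restrict t {..<m'}"
  have r: "restrict ?s {..<m} = restrict s {..<m}" "restrict ?t {..<m} = restrict t {..<m}"
    using le by (auto simp: restrict_def)
  show "x s t = x ?s ?t"
  proof (cases "\<forall>j\<ge>m. s j = t j")
    case True
    then have "\<forall>j\<ge>m. ?s j = ?t j" by (simp add: restrict_def)
    then show ?thesis using tensor_mats_eq[OF x True] tensor_mats_eq[OF x, of ?s ?t] r by metis
  next
    case False
    then obtain j where j: "j \<ge> m" "s j \<noteq> t j" by blast
    then have "j < m'" using a by (meson not_le)
    then have "\<not> (\<forall>j\<ge>m. ?s j = ?t j)" using j by (auto intro!: exI[of _ j])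
    then show ?thesis using tensor_mats_zero[OF x] False by metis
  qed
qed

lemma Union_tower: "(\<Union>j. tower j) = (\<Union>m. tensor_mats m)"
proof
  show "(\<Union>j. tower j) \<subseteq> (\<Union>m. tensor_mats m)"
    by (auto simp: tower_def Let_def split: if_splits)
  have "x \<in> tower (2 * m)" if "x \<in> tensor_mats m" for x :: "'n kernel" and m
    using tensor_mats_mono[OF that, of "m + 1"] by (simp add: tower_def)
  then show "(\<Union>m. tensor_mats m) \<subseteq> (\<Union>j. tower j :: 'n kernel set)" by blast
qed

lemma tensor_mats_map2:
  assumes "x \<in> tensor_mats m" "y \<in> tensor_mats m" "F 0 0 = 0"
  shows "(\<lambda>s t. F (x s t) (y s t)) \<in> tensor_mats m"
proof (rule tensor_matsI)
  fix s t :: "nat \<Rightarrow> 'a"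
  assume "\<not> (\<forall>j\<ge>m. s j = t j)"
  then show "F (x s t) (y s t) = 0" using assms tensor_mats_zero by metis
next
  fix s t :: "nat \<Rightarrow> 'a"
  assume "\<forall>j\<ge>m. s j = t j"
  then show "F (x s t) (y s t) =
      F (x (restrict s {..<m}) (restrict t {..<m})) (y (restrict s {..<m}) (restrict t {..<m}))"
    using assms tensor_mats_eq by metis
qed

lemma tower_map2:
  assumes "x \<in> (\<Union>j. tower j)" "y \<in> (\<Union>j. tower j)" "F 0 0 = 0"
  shows "(\<lambda>s t. F (x s t) (y s t)) \<in> (\<Union>j. tower j)"
proof -
  obtain m m' where "x \<in> tensor_mats m" "y \<in> tensor_mats m'" using assms unfolding Union_tower by blast
  then have "x \<in> tensor_mats (max m m')" "y \<in> tensor_mats (max m m')"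
    using tensor_mats_mono by (metis max.cobounded1, metis max.cobounded2)
  then show ?thesis using tensor_mats_map2 assms(3) unfolding Union_tower by blast
qed

lemma tower_map: "x \<in> (\<Union>j. tower j) \<Longrightarrow> F 0 = 0 \<Longrightarrow> (\<lambda>s t. F (x s t)) \<in> (\<Union>j. tower j)"
  using tower_map2[of x x "\<lambda>a b. F a"] by simp

text \<open>Row \<open>s\<close> of a matrix in the tower has only finitely many nonzero entries.\<close>

definition kernel_mult :: "'n kernel \<Rightarrow> 'n kernel \<Rightarrow> 'n kernel" where
  "kernel_mult x y = (\<lambda>s t. \<Sum>r | x s r \<noteq> 0. x s r * y r t)"

definition glue :: "nat \<Rightarrow> (nat \<Rightarrow> 'n) \<Rightarrow> (nat \<Rightarrow> 'n) \<Rightarrow> nat \<Rightarrow> 'n" where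
  "glue m r s = (\<lambda>j. if j < m then r j else s j)"

lemma restrict_glue: "r \<in> words m \<Longrightarrow> restrict (glue m r s) {..<m} = r"
  by (auto simp: glue_def words_def PiE_def extensional_def)

lemma glue_restrict: "\<forall>j\<ge>m. s j = r j \<Longrightarrow> glue m (restrict r {..<m}) s = r"
  by (auto simp: glue_def)

lemma kernel_mult_glue:
  fixes x :: "'n::finite kernel"
  assumes x: "x \<in> tensor_mats m"
  shows "kernel_mult x y s t = (\<Sum>r\<in>words m. x s (glue m r s) * y (glue m r s) t)"
proof -
  let ?G = "(\<lambda>r. glue m r s) ` words m"
  have sub: "{r. x s r \<noteq> 0} \<subseteq> ?G"
  proof
    fix r assume "r \<in> {r. x s r \<noteq> 0}"
    then have "\<forall>j\<ge>m. s j = r j" using tensor_mats_zero[OF x, of s r] by blast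
    then have "r = glue m (restrict r {..<m}) s" using glue_restrict by metis
    then show "r \<in> ?G" using restrict_in_words by blast
  qed
  have "kernel_mult x y s t = (\<Sum>r\<in>?G. x s r * y r t)"
    unfolding kernel_mult_def
    by (rule sum.mono_neutral_left) (use sub finite_words in auto)
  also have "\<dots> = (\<Sum>r\<in>words m. x s (glue m r s) * y (glue m r s) t)"
    by (rule sum.reindex_cong[OF _ refl refl]) (rule inj_onI, metis restrict_glue)
  finally show ?thesis .
qed

lemma kernel_mult_words:
  fixes x :: "'n::finite kernel"
  assumes x: "x \<in> tensor_mats m" and y: "y \<in> tensor_mats m"
  shows "kernel_mult x y s t = (if \<forall>j\<ge>m. s j = t j
    then \<Sum>r\<in>words m. x (restrict s {..<m}) r * y r (restrict t {..<m}) else 0)"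
proof -
  have 1: "x s (glue m r s) = x (restrict s {..<m}) r" if "r \<in> words m" for r
    using tensor_mats_eq[OF x, of s "glue m r s"] restrict_glue[OF that] by (simp add: glue_def)
  show ?thesis
  proof (cases "\<forall>j\<ge>m. s j = t j")
    case True
    have "y (glue m r s) t = y r (restrict t {..<m})" if "r \<in> words m" for r
      using tensor_mats_eq[OF y, of "glue m r s" t] restrict_glue[OF that] True by (simp add: glue_def)
    then show ?thesis unfolding kernel_mult_glue[OF x] using True 1 by simp
  next
    case False
    then have "\<not> (\<forall>j\<ge>m. glue m r s j = t j)" for r by (simp add: glue_def)
    then have "y (glue m r s) t = 0" for r using tensor_mats_zero[OF y] by blast
    then show ?thesis unfolding kernel_mult_glue[OF x] using False by auto
  qed
qed

lemma kernel_mult_tensor_mats: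
  fixes x :: "'n::finite kernel"
  assumes x: "x \<in> tensor_mats m" and y: "y \<in> tensor_mats m"
  shows "kernel_mult x y \<in> tensor_mats m"
  by (rule tensor_matsI) (auto simp: kernel_mult_words[OF x y])

lemma kernel_mult_tower:
  fixes x :: "'n::finite kernel"
  assumes "x \<in> (\<Union>j. tower j)" "y \<in> (\<Union>j. tower j)"
  shows "kernel_mult x y \<in> (\<Union>j. tower j)"
proof -
  obtain m m' where "x \<in> tensor_mats m" "y \<in> tensor_mats m'" using assms unfolding Union_tower by blast
  then have "x \<in> tensor_mats (max m m')" "y \<in> tensor_mats (max m m')"
    using tensor_mats_mono by (metis max.cobounded1, metis max.cobounded2)
  then show ?thesis using kernel_mult_tensor_mats unfolding Union_tower by blast
qed

typedef (overloaded) ('n::finite) tower_alg = "\<Union>j. tower j :: 'n kernel set"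
  morphisms entry Tower_Alg
proof -
  have "(\<lambda>s t. 0) \<in> (tower 0 :: 'n kernel set)"
    by (auto simp: tower_def intro!: tensor_matsI)
  then show ?thesis by blast
qed

setup_lifting type_definition_tower_alg

instantiation tower_alg :: (finite) "{one, times}"
begin

lift_definition one_tower_alg :: "'a tower_alg" is "\<lambda>s t. if s = t then 1 else 0"
proof -
  have "(\<lambda>s t. if s = t then 1 else 0) \<in> (tensor_mats 0 :: 'a kernel set)"
    by (rule tensor_matsI) (auto simp: fun_eq_iff)
  then show "(\<lambda>s t. if s = t then 1 else 0) \<in> (\<Union>j. tower j :: 'a kernel set)"
    unfolding Union_tower by blast
qed

lift_definition times_tower_alg :: "'a tower_alg \<Rightarrow> 'a tower_alg \<Rightarrow> 'a tower_alg" is kernel_mult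
  by (rule kernel_mult_tower)

instance ..

end

lift_definition star :: "'n::finite tower_alg \<Rightarrow> 'n tower_alg" is "\<lambda>x s t. cnj (x t s)"
proof -
  fix x :: "'n kernel" assume "x \<in> (\<Union>j. tower j)"
  then obtain m where x: "x \<in> tensor_mats m" unfolding Union_tower by blast
  have "(\<lambda>s t. cnj (x t s)) \<in> tensor_mats m"
  proof (rule tensor_matsI)
    fix s t :: "nat \<Rightarrow> 'n" assume "\<not> (\<forall>j\<ge>m. s j = t j)"
    then have "\<not> (\<forall>j\<ge>m. t j = s j)" by metis
    then show "cnj (x t s) = 0" using tensor_mats_zero[OF x] by simp
  next
    fix s t :: "nat \<Rightarrow> 'n" assume "\<forall>j\<ge>m. s j = t j"
    then have "\<forall>j\<ge>m. t j = s j" by metis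
    then show "cnj (x t s) = cnj (x (restrict t {..<m}) (restrict s {..<m}))"
      using tensor_mats_eq[OF x] by metis
  qed
  then show "(\<lambda>s t. cnj (x t s)) \<in> (\<Union>j. tower j)" unfolding Union_tower by blast
qed

text \<open>The normalized trace on \<open>m\<close> tensor factors; its value does not depend on the choice of \<open>m\<close>
  (see \<open>tower_trace_eq\<close>).\<close>

definition trace_words :: "nat \<Rightarrow> 'n::finite kernel \<Rightarrow> complex" where
  "trace_words m x = (\<Sum>w\<in>words m. x w w) / of_nat (CARD('n) ^ m)"

definition tower_trace :: "'n::finite tower_alg \<Rightarrow> complex" where
  "tower_trace x = trace_words (LEAST m. entry x \<in> tensor_mats m) (entry x)"

lemma trace_words_Suc:
  fixes x :: "'n::finite kernel"
  assumes x: "x \<in> tensor_mats m" shows "trace_words (Suc m) x = trace_words m x"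
proof -
  have W: "(words (Suc m) :: (nat \<Rightarrow> 'n) set) = (\<lambda>(i, w). w(m := i)) ` (UNIV \<times> words m)"
    unfolding words_def lessThan_Suc by (simp add: PiE_insert_eq)
  have inj: "inj_on (\<lambda>(i, w). w(m := i)) (UNIV \<times> words m :: ('n \<times> (nat \<Rightarrow> 'n)) set)"
    unfolding words_def by (rule inj_combinator) simp
  have eq: "x (w(m := i)) (w(m := i)) = x w w" if w: "w \<in> words m" for w i
  proof -
    have "restrict (w(m := i)) {..<m} = w"
      by (subst restrict_words[OF w, symmetric]) (auto simp: restrict_def)
    then show ?thesis using tensor_mats_eq[OF x, of "w(m := i)" "w(m := i)"] by simp
  qed
  have "(\<Sum>w\<in>words (Suc m). x w w) = (\<Sum>(i, w)\<in>(UNIV :: 'n set) \<times> words m. x w w)"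
    unfolding W by (subst sum.reindex[OF inj]) (auto intro!: sum.cong simp: eq)
  also have "\<dots> = of_nat (CARD('n)) * (\<Sum>w\<in>words m. x w w)"
    by (simp add: sum.cartesian_product[symmetric])
  finally show ?thesis by (simp add: trace_words_def)
qed

lemma trace_words_mono:
  assumes x: "x \<in> tensor_mats m" and "m \<le> m'" shows "trace_words m' x = trace_words m x"
  using assms(2)
proof (induction rule: dec_induct)
  case (step k)
  then show ?case using trace_words_Suc[OF tensor_mats_mono[OF x]] by simp
qed simp

lemma tower_trace_eq:
  assumes "entry x \<in> tensor_mats m" shows "tower_trace x = trace_words m (entry x)"
  unfolding tower_trace_def
  using trace_words_mono[OF LeastI[of "\<lambda>m. entry x \<in> tensor_mats m", OF assms] Least_le[of "\<lambda>m. entry x \<in> tensor_mats m", OF assms]]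
  by simp

lemma entry_tensor_mats: obtains m where "entry x \<in> tensor_mats m" "k \<le> m"
proof -
  obtain m where "entry x \<in> tensor_mats m" using entry[of x] unfolding Union_tower by blast
  then show ?thesis using that[of "max m k"] tensor_mats_mono[of "entry x" m "max m k"] by simp
qed

instantiation tower_alg :: (finite) complex_inner
begin

lift_definition zero_tower_alg :: "'a tower_alg" is "\<lambda>s t. 0"
proof -
  have "(\<lambda>s t. 0) \<in> (tensor_mats 0 :: 'a kernel set)" by (rule tensor_matsI) simp_all
  then show "(\<lambda>s t. 0) \<in> (\<Union>j. tower j :: 'a kernel set)" unfolding Union_tower by blast
qed
lift_definition plus_tower_alg :: "'a tower_alg \<Rightarrow> 'a tower_alg \<Rightarrow> 'a tower_alg"
  is "\<lambda>x y s t. x s t + y s t" by (rule tower_map2) simp_all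
lift_definition minus_tower_alg :: "'a tower_alg \<Rightarrow> 'a tower_alg \<Rightarrow> 'a tower_alg"
  is "\<lambda>x y s t. x s t - y s t" by (rule tower_map2) simp_all
lift_definition uminus_tower_alg :: "'a tower_alg \<Rightarrow> 'a tower_alg"
  is "\<lambda>x s t. - x s t" by (rule tower_map) simp_all
lift_definition scaleC_tower_alg :: "complex \<Rightarrow> 'a tower_alg \<Rightarrow> 'a tower_alg"
  is "\<lambda>a x s t. a * x s t" by (rule tower_map) simp_all

definition scaleR_tower_alg_def: "r *\<^sub>R (x :: 'a tower_alg) = complex_of_real r *\<^sub>C x"
definition cinner_tower_alg_def: "cinner (x :: 'a tower_alg) y = tower_trace (star y * x)"
definition inner_tower_alg_def: "inner (x :: 'a tower_alg) y = Re (cinner x y)"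
definition norm_tower_alg_def: "norm (x :: 'a tower_alg) = sqrt (inner x x)"
definition sgn_tower_alg_def: "sgn (x :: 'a tower_alg) = inverse (norm x) *\<^sub>R x"
definition dist_tower_alg_def: "dist (x :: 'a tower_alg) y = norm (x - y)"
definition uniformity_tower_alg_def:
  "(uniformity :: ('a tower_alg \<times> 'a tower_alg) filter) =
    (INF e\<in>{0<..}. principal {(x, y). dist x y < e})"
definition open_tower_alg_def:
  "open (U :: 'a tower_alg set) = (\<forall>x\<in>U. \<forall>\<^sub>F (x', y) in uniformity. x' = x \<longrightarrow> y \<in> U)"

lemma cinner_tower_words:
  fixes x y :: "'a tower_alg"
  assumes x: "entry x \<in> tensor_mats m" and y: "entry y \<in> tensor_mats m"
  shows "cinner x y = (\<Sum>s\<in>words m. \<Sum>t\<in>words m. entry x s t * cnj (entry y s t)) / of_nat (CARD('a) ^ m)"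
proof -
  have y': "entry (star y) \<in> tensor_mats m"
  proof (rule tensor_matsI)
    fix s t :: "nat \<Rightarrow> 'a" assume "\<not> (\<forall>j\<ge>m. s j = t j)"
    then have "\<not> (\<forall>j\<ge>m. t j = s j)" by metis
    then show "entry (star y) s t = 0" using tensor_mats_zero[OF y] by (simp add: star.rep_eq)
  next
    fix s t :: "nat \<Rightarrow> 'a" assume "\<forall>j\<ge>m. s j = t j"
    then have "\<forall>j\<ge>m. t j = s j" by metis
    then show "entry (star y) s t = entry (star y) (restrict s {..<m}) (restrict t {..<m})"
      unfolding star.rep_eq using tensor_mats_eq[OF y] by metis
  qed
  have "cinner x y = trace_words m (kernel_mult (entry (star y)) (entry x))"
    unfolding cinner_tower_alg_def
    using tower_trace_eq[of "star y * x" m] kernel_mult_tensor_mats[OF y' x] by (simp add: times_tower_alg.rep_eq)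
  also have "\<dots> = (\<Sum>w\<in>words m. \<Sum>r\<in>words m. cnj (entry y r w) * entry x r w) / of_nat (CARD('a) ^ m)"
    unfolding trace_words_def kernel_mult_words[OF y' x] by (simp add: restrict_words star.rep_eq)
  also have "(\<Sum>w\<in>words m. \<Sum>r\<in>words m. cnj (entry y r w) * entry x r w) =
      (\<Sum>s\<in>words m. \<Sum>t\<in>words m. entry x s t * cnj (entry y s t))"
    by (subst sum.swap) (simp add: mult.commute)
  finally show ?thesis .
qed

lemma entry_eq_iff: "x = y \<longleftrightarrow> (\<forall>s t. entry x s t = entry y s t)"
  by (metis entry_inject ext)

instance
proof
  fix x y z :: "'a tower_alg" and a b :: complex and r s :: real
  note E = entry_eq_iff zero_tower_alg.rep_eq plus_tower_alg.rep_eq minus_tower_alg.rep_eq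
    uminus_tower_alg.rep_eq scaleC_tower_alg.rep_eq scaleR_tower_alg_def
  show "x + y + z = x + (y + z)" "x + y = y + x" "0 + x = x" "- x + x = 0" "x - y = x + - y"
    "r *\<^sub>R (x + y) = r *\<^sub>R x + r *\<^sub>R y" "(r + s) *\<^sub>R x = r *\<^sub>R x + s *\<^sub>R x"
    "r *\<^sub>R s *\<^sub>R x = (r * s) *\<^sub>R x" "1 *\<^sub>R x = x"
    "a *\<^sub>C (x + y) = a *\<^sub>C x + a *\<^sub>C y" "(a + b) *\<^sub>C x = a *\<^sub>C x + b *\<^sub>C x"
    "a *\<^sub>C b *\<^sub>C x = (a * b) *\<^sub>C x" "r *\<^sub>R x = complex_of_real r *\<^sub>C x"
    by (simp_all add: E algebra_simps)
  show "sgn x = inverse (norm x) *\<^sub>R x" by (rule sgn_tower_alg_def)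
  show "dist x y = norm (x - y)" by (rule dist_tower_alg_def)
  show "(uniformity :: ('a tower_alg \<times> 'a tower_alg) filter) =
      (INF e\<in>{0<..}. principal {(x, y). dist x y < e})" by (rule uniformity_tower_alg_def)
  show "\<And>U :: 'a tower_alg set. open U = (\<forall>x\<in>U. \<forall>\<^sub>F (x', y) in uniformity. x' = x \<longrightarrow> y \<in> U)"
    by (rule open_tower_alg_def)
  obtain m1 where m1: "entry x \<in> tensor_mats m1" "0 \<le> m1" by (rule entry_tensor_mats)
  obtain m2 where m2: "entry y \<in> tensor_mats m2" "m1 \<le> m2" by (rule entry_tensor_mats)
  obtain m where z: "entry z \<in> tensor_mats m" "m2 \<le> m" by (rule entry_tensor_mats)
  have x: "entry x \<in> tensor_mats m" and y: "entry y \<in> tensor_mats m"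
    using tensor_mats_mono m1 m2 z order_trans by metis+
  have xy: "entry (x + y) \<in> tensor_mats m"
    unfolding plus_tower_alg.rep_eq by (rule tensor_mats_map2[OF x y]) simp
  have ax: "entry (a *\<^sub>C x) \<in> tensor_mats m" for a
    unfolding scaleC_tower_alg.rep_eq by (rule tensor_mats_map2[OF x x]) simp
  note CI = cinner_tower_words[of _ m, OF _ y] cinner_tower_words[of _ m, OF _ z(1)]
    cinner_tower_words[of _ m, OF _ x]
  show com: "cinner x y = cnj (cinner y x)"
    using x y by (simp add: CI mult.commute)
  show add: "cinner (x + y) z = cinner x z + cinner y z"
    using x y xy by (simp add: CI plus_tower_alg.rep_eq algebra_simps sum.distrib add_divide_distrib)
  show sc: "cinner (a *\<^sub>C x) y = a * cinner x y" for a
    using x ax by (simp add: CI scaleC_tower_alg.rep_eq sum_distrib_left mult.assoc)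
  show "inner x y = Re (cinner x y)" by (rule inner_tower_alg_def)
  show "inner x y = inner y x" unfolding inner_tower_alg_def com by simp
  show "inner (x + y) z = inner x z + inner y z" unfolding inner_tower_alg_def add by simp
  show "inner (r *\<^sub>R x) y = r * inner x y" by (simp add: inner_tower_alg_def scaleR_tower_alg_def sc)
  have "cinner x x = complex_of_real
      ((\<Sum>s\<in>words m. \<Sum>t\<in>words m. (cmod (entry x s t))\<^sup>2) / real (CARD('a) ^ m))"
    using x by (simp add: CI complex_norm_square[symmetric])
  then have n: "inner x x = (\<Sum>s\<in>words m. \<Sum>t\<in>words m. (cmod (entry x s t))\<^sup>2) / real (CARD('a) ^ m)"
    by (simp only: inner_tower_alg_def Re_complex_of_real)
  show "0 \<le> inner x x" unfolding n by (intro divide_nonneg_nonneg sum_nonneg) auto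
  show "(inner x x = 0) = (x = 0)"
  proof
    assume "inner x x = 0"
    then have "(\<Sum>s\<in>words m. \<Sum>t\<in>words m. (cmod (entry x s t))\<^sup>2) = 0" unfolding n by simp
    then have 0: "entry x s t = 0" if "s \<in> words m" "t \<in> words m" for s t
      using that finite_words[where 'n='a]
      by (subst (asm) sum_nonneg_eq_0_iff) (auto intro!: sum_nonneg simp: sum_nonneg_eq_0_iff)
    show "x = 0" unfolding entry_eq_iff zero_tower_alg.rep_eq
    proof (intro allI)
      fix s t
      show "entry x s t = 0"
        using 0[OF restrict_in_words restrict_in_words] tensor_mats_eq[OF x, of s t] tensor_mats_zero[OF x, of s t]
        by metis
    qed
  next
    assume "x = 0"
    then show "inner x x = 0" unfolding n by (simp add: zero_tower_alg.rep_eq)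
  qed
  show "norm x = sqrt (inner x x)" by (rule norm_tower_alg_def)
qed

end


lemma times_tower_diff_right: "x * (y - z) = x * y - x * (z :: 'n::finite tower_alg)"
  by (simp add: entry_eq_iff times_tower_alg.rep_eq minus_tower_alg.rep_eq kernel_mult_def
      right_diff_distrib sum_subtractf)

lemma times_tower_add_right: "x * (y + z) = x * y + x * (z :: 'n::finite tower_alg)"
  by (simp add: entry_eq_iff times_tower_alg.rep_eq plus_tower_alg.rep_eq kernel_mult_def
      distrib_left sum.distrib)

lemma times_tower_scaleC_right: "x * (a *\<^sub>C y) = a *\<^sub>C (x * (y :: 'n::finite tower_alg))"
  by (simp add: entry_eq_iff times_tower_alg.rep_eq scaleC_tower_alg.rep_eq kernel_mult_def
      sum_distrib_left mult.left_commute)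

lemma times_tower_one_right: "x * 1 = (x :: 'n::finite tower_alg)"
proof -
  have "entry (x * 1) s t = entry x s t" for s t
  proof -
    obtain m where m: "entry x \<in> tensor_mats m" "0 \<le> m" by (rule entry_tensor_mats)
    have "{r. entry x s r \<noteq> 0} \<subseteq> (\<lambda>r. glue m r s) ` words m"
    proof
      fix r assume "r \<in> {r. entry x s r \<noteq> 0}"
      then have "\<forall>j\<ge>m. s j = r j" using tensor_mats_zero[OF m(1), of s r] by blast
      then have "r = glue m (restrict r {..<m}) s" using glue_restrict by metis
      then show "r \<in> (\<lambda>r. glue m r s) ` words m" using restrict_in_words by blast
    qed
    then have fin: "finite {r. entry x s r \<noteq> 0}" using finite_words finite_subset by blast
    have "entry (x * 1) s t = (\<Sum>r | entry x s r \<noteq> 0. if r = t then entry x s t else 0)"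
      by (auto simp: times_tower_alg.rep_eq one_tower_alg.rep_eq kernel_mult_def intro!: sum.cong)
    also have "\<dots> = entry x s t" using fin by (simp add: sum.delta)
    finally show ?thesis .
  qed
  then show ?thesis by (simp add: entry_eq_iff)
qed

lemma norm_tower_words:
  fixes x :: "'n::finite tower_alg"
  assumes "entry x \<in> tensor_mats m"
  shows "(norm x)\<^sup>2 = (\<Sum>s\<in>words m. \<Sum>t\<in>words m. (cmod (entry x s t))\<^sup>2) / real (CARD('n) ^ m)"
proof -
  have "cinner x x = complex_of_real
      ((\<Sum>s\<in>words m. \<Sum>t\<in>words m. (cmod (entry x s t))\<^sup>2) / real (CARD('n) ^ m))"
    by (simp add: cinner_tower_words[OF assms assms] complex_norm_square[symmetric])
  then show ?thesis unfolding norm_cinner_self by (simp only: of_real_eq_iff)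
qed

lemma sum_glue_le:
  fixes g :: "(nat \<Rightarrow> 'n::finite) \<Rightarrow> real"
  assumes le: "k \<le> m" and g: "\<And>v. 0 \<le> g v"
  shows "(\<Sum>s\<in>words m. \<Sum>r\<in>words k. g (glue k r s)) \<le> real (CARD('n) ^ k) * (\<Sum>v\<in>words m. g v)"
proof -
  define F :: "(nat \<Rightarrow> 'n) \<times> (nat \<Rightarrow> 'n) \<Rightarrow> (nat \<Rightarrow> 'n) \<times> (nat \<Rightarrow> 'n)"
    where "F = (\<lambda>(s, r). (restrict s {..<k}, glue k r s))"
  have inj: "inj_on F (words m \<times> words k)"
  proof (rule inj_onI, clarify)
    fix s r s' r' :: "nat \<Rightarrow> 'n"
    assume w: "r \<in> words k" "r' \<in> words k" and "F (s, r) = F (s', r')"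
    then have 1: "restrict s {..<k} = restrict s' {..<k}" and 2: "glue k r s = glue k r' s'"
      by (auto simp: F_def)
    have "s j = s' j" for j
      using fun_cong[OF 1, of j] fun_cong[OF 2, of j] by (cases "j < k") (simp_all add: glue_def)
    then show "s = s' \<and> r = r'" using restrict_glue[OF w(1)] restrict_glue[OF w(2)] 2 by (metis ext)
  qed
  have sub: "F ` (words m \<times> words k) \<subseteq> words k \<times> words m"
    using le by (auto simp: F_def restrict_in_words) (auto simp: words_def glue_def PiE_def extensional_def)
  have "(\<Sum>s\<in>words m. \<Sum>r\<in>words k. g (glue k r s)) = (\<Sum>p\<in>words m \<times> words k. g (snd (F p)))"
    by (simp add: sum.cartesian_product F_def case_prod_beta)
  also have "\<dots> = (\<Sum>p\<in>F ` (words m \<times> words k). g (snd p))"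
    by (simp add: sum.reindex[OF inj])
  also have "\<dots> \<le> (\<Sum>p\<in>(words k :: (nat \<Rightarrow> 'n) set) \<times> words m. g (snd p))"
    by (rule sum_mono2) (use sub finite_words g in auto)
  also have "\<dots> = (\<Sum>a\<in>(words k :: (nat \<Rightarrow> 'n) set). \<Sum>v\<in>words m. g v)"
    unfolding sum.cartesian_product by (rule sum.cong) auto
  also have "\<dots> = real (CARD('n) ^ k) * (\<Sum>v\<in>words m. g v)"
    by (simp add: card_words)
  finally show ?thesis .
qed

lemma norm_times_tower_bound: "\<exists>B. \<forall>y. norm (x * y) \<le> B * norm (y :: 'n::finite tower_alg)"
proof -
  obtain k where k: "entry x \<in> tensor_mats k" "0 \<le> k" by (rule entry_tensor_mats)
  define K where "K = (\<Sum>a\<in>words k. \<Sum>r\<in>words k. (cmod (entry x a r))\<^sup>2)"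
  have K0: "0 \<le> K" unfolding K_def by (intro sum_nonneg) auto
  define C where "C = K * real (CARD('n) ^ k)"
  have C0: "0 \<le> C" using K0 by (simp add: C_def)
  have "norm (x * y) \<le> sqrt C * norm y" for y
  proof -
    obtain m where m: "entry y \<in> tensor_mats m" "k \<le> m" by (rule entry_tensor_mats)
    have xm: "entry x \<in> tensor_mats m" using tensor_mats_mono[OF k(1) m(2)] .
    have xym: "entry (x * y) \<in> tensor_mats m"
      unfolding times_tower_alg.rep_eq by (rule kernel_mult_tensor_mats[OF xm m(1)])
    have pt: "(cmod (entry (x * y) s t))\<^sup>2 \<le> K * (\<Sum>r\<in>words k. (cmod (entry y (glue k r s) t))\<^sup>2)" for s t
    proof -
      have x1: "entry x s (glue k r s) = entry x (restrict s {..<k}) r" if "r \<in> words k" for r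
        using tensor_mats_eq[OF k(1), of s "glue k r s"] restrict_glue[OF that] by (simp add: glue_def)
      have "entry (x * y) s t = (\<Sum>r\<in>words k. entry x (restrict s {..<k}) r * entry y (glue k r s) t)"
        unfolding times_tower_alg.rep_eq kernel_mult_glue[OF k(1)] by (simp add: x1)
      then have "cmod (entry (x * y) s t) \<le>
          (\<Sum>r\<in>words k. cmod (entry x (restrict s {..<k}) r) * cmod (entry y (glue k r s) t))"
        by (simp add: norm_mult[symmetric] norm_sum)
      then have "(cmod (entry (x * y) s t))\<^sup>2 \<le>
          (\<Sum>r\<in>words k. cmod (entry x (restrict s {..<k}) r) * cmod (entry y (glue k r s) t))\<^sup>2"
        by (rule power_mono) simp
      also have "\<dots> \<le> (\<Sum>r\<in>words k. (cmod (entry x (restrict s {..<k}) r))\<^sup>2) *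
          (\<Sum>r\<in>words k. (cmod (entry y (glue k r s) t))\<^sup>2)"
        by (rule Cauchy_Schwarz_ineq_sum)
      also have "\<dots> \<le> K * (\<Sum>r\<in>words k. (cmod (entry y (glue k r s) t))\<^sup>2)"
      proof (rule mult_right_mono)
        show "(\<Sum>r\<in>words k. (cmod (entry x (restrict s {..<k}) r))\<^sup>2) \<le> K"
          unfolding K_def
          by (rule member_le_sum[of "restrict s {..<k}" "words k" "\<lambda>a. \<Sum>r\<in>words k. (cmod (entry x a r))\<^sup>2"])
            (auto simp: restrict_in_words finite_words intro: sum_nonneg)
      qed (auto intro: sum_nonneg)
      finally show ?thesis .
    qed
    have "(\<Sum>s\<in>words m. \<Sum>t\<in>words m. (cmod (entry (x * y) s t))\<^sup>2) \<le>
        (\<Sum>s\<in>words m. \<Sum>t\<in>words m. K * (\<Sum>r\<in>words k. (cmod (entry y (glue k r s) t))\<^sup>2))"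
      by (intro sum_mono pt)
    also have "\<dots> = K * (\<Sum>s\<in>words m. \<Sum>r\<in>words k. \<Sum>t\<in>words m. (cmod (entry y (glue k r s) t))\<^sup>2)"
      by (simp add: sum_distrib_left, intro sum.cong refl sum.swap)
    also have "\<dots> \<le> K * (real (CARD('n) ^ k) * (\<Sum>v\<in>words m. \<Sum>t\<in>words m. (cmod (entry y v t))\<^sup>2))"
      by (intro mult_left_mono K0 sum_glue_le[OF m(2)] sum_nonneg) auto
    finally have "(norm (x * y))\<^sup>2 \<le> C * (norm y)\<^sup>2"
      unfolding norm_tower_words[OF xym] norm_tower_words[OF m(1)] C_def
      by (simp add: divide_right_mono mult.assoc)
    then have "(norm (x * y))\<^sup>2 \<le> (sqrt C * norm y)\<^sup>2" by (simp add: power_mult_distrib C0)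
    then show ?thesis by (rule power2_le_imp_le) (simp add: C0)
  qed
  then show ?thesis by blast
qed

text \<open>The matrix \<open>a\<close> in tensor factor \<open>p\<close>, with identity factors elsewhere.\<close>

lift_definition site :: "nat \<Rightarrow> complex^'n^'n \<Rightarrow> 'n::finite tower_alg"
  is "\<lambda>p a s t. if \<forall>j. j \<noteq> p \<longrightarrow> s j = t j then a $ s p $ t p else 0"
proof -
  fix p and a :: "complex^'n^'n"
  have "(\<lambda>s t. if \<forall>j. j \<noteq> p \<longrightarrow> s j = t j then a $ s p $ t p else 0) \<in> (tensor_mats (Suc p) :: 'n kernel set)"
  proof (rule tensor_matsI)
    fix s t :: "nat \<Rightarrow> 'n"
    assume "\<forall>j\<ge>Suc p. s j = t j"
    then have "(\<forall>j. j \<noteq> p \<longrightarrow> s j = t j) \<longleftrightarrow> (\<forall>j<p. s j = t j)"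
      by (metis Suc_leI linorder_neqE_nat nat_neq_iff)
    then show "(if \<forall>j. j \<noteq> p \<longrightarrow> s j = t j then a $ s p $ t p else 0) =
      (if \<forall>j. j \<noteq> p \<longrightarrow> restrict s {..<Suc p} j = restrict t {..<Suc p} j
       then a $ restrict s {..<Suc p} p $ restrict t {..<Suc p} p else 0)"
      by (auto simp: restrict_def)
  qed (auto simp: Suc_le_eq)
  then show "(\<lambda>s t. if \<forall>j. j \<noteq> p \<longrightarrow> s j = t j then a $ s p $ t p else 0) \<in> (\<Union>j. tower j :: 'n kernel set)"
    unfolding Union_tower by blast
qed

section \<open>Operators, von Neumann algebras and angles\<close>

definition bounded_op_on :: "'h::complex_inner set \<Rightarrow> ('h \<Rightarrow> 'h) \<Rightarrow> bool" where
  "bounded_op_on K T \<longleftrightarrow> (\<forall>x\<in>K. T x \<in> K) \<and> (\<forall>x\<in>K. \<forall>y\<in>K. T (x + y) = T x + T y) \<and>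
    (\<forall>a. \<forall>x\<in>K. T (a *\<^sub>C x) = a *\<^sub>C T x) \<and> (\<exists>B. \<forall>x\<in>K. norm (T x) \<le> B * norm x)"

text \<open>On the function type, \<^const>\<open>closure\<close> refers to the topology of pointwise convergence,
  whose restriction to bounded operators is the strong operator topology.\<close>

definition sot_closure :: "('h::complex_hilbert \<Rightarrow> 'h) set \<Rightarrow> ('h \<Rightarrow> 'h) set" where
  "sot_closure S = {T \<in> closure S. bounded_op_on UNIV T}"

definition hilbert_adjoint :: "('h::complex_hilbert \<Rightarrow> 'h) \<Rightarrow> 'h \<Rightarrow> 'h" where
  "hilbert_adjoint T = (THE S. \<forall>x y. cinner (T x) y = cinner x (S y))"

definition von_neumann_algebra :: "('h::complex_hilbert \<Rightarrow> 'h) set \<Rightarrow> bool" where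
  "von_neumann_algebra M \<longleftrightarrow> (\<forall>T\<in>M. bounded_op_on UNIV T) \<and> id \<in> M \<and>
    (\<forall>S\<in>M. \<forall>T\<in>M. (\<lambda>x. S x + T x) \<in> M \<and> S \<circ> T \<in> M) \<and>
    (\<forall>a. \<forall>T\<in>M. (\<lambda>x. a *\<^sub>C T x) \<in> M) \<and> (\<forall>T\<in>M. hilbert_adjoint T \<in> M) \<and>
    sot_closure M = M"

definition vn_generated :: "('h::complex_hilbert \<Rightarrow> 'h) set \<Rightarrow> ('h \<Rightarrow> 'h) set" where
  "vn_generated S = \<Inter>{M. von_neumann_algebra M \<and> S \<subseteq> M}"

definition op_spectrum :: "'h::complex_hilbert set \<Rightarrow> ('h \<Rightarrow> 'h) \<Rightarrow> complex set" where
  "op_spectrum K T = {z. \<not> (\<exists>S. bounded_op_on K S \<and>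
    (\<forall>x\<in>K. S (z *\<^sub>C x - T x) = x \<and> z *\<^sub>C S x - T (S x) = x))}"

definition op_cos :: "('h::complex_hilbert \<Rightarrow> 'h) \<Rightarrow> 'h \<Rightarrow> 'h" where
  "op_cos T x = (\<Sum>k. cos_coeff k *\<^sub>R (T ^^ k) x)"

definition orth_proj :: "'h::complex_hilbert set \<Rightarrow> 'h \<Rightarrow> 'h" where
  "orth_proj K x = (THE y. y \<in> K \<and> (\<forall>z\<in>K. cinner (x - y) z = 0))"

text \<open>In the following, \<open>p\<close> and \<open>q\<close> are projections of the Hilbert space \<open>H\<close>, a closed subspace of
  the ambient type. The range of \<open>p \<and> q\<close> is the intersection of the ranges of \<open>p\<close> and \<open>q\<close>.\<close>

definition generic_part :: "'h::complex_hilbert set \<Rightarrow> ('h \<Rightarrow> 'h) \<Rightarrow> ('h \<Rightarrow> 'h) \<Rightarrow> 'h set" where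
  "generic_part H p q = (let p' = (\<lambda>x. x - p x); q' = (\<lambda>x. x - q x) in
    {x \<in> H. \<forall>a \<in> p ` H \<inter> q ` H. \<forall>b \<in> p ` H \<inter> q' ` H. \<forall>c \<in> p' ` H \<inter> q ` H. \<forall>d \<in> p' ` H \<inter> q' ` H.
      cinner x (a + b + c + d) = 0})"

definition is_angle_operator ::
    "'h::complex_hilbert set \<Rightarrow> ('h \<Rightarrow> 'h) \<Rightarrow> ('h \<Rightarrow> 'h) \<Rightarrow> ('h \<Rightarrow> 'h) \<Rightarrow> bool" where
  "is_angle_operator H p q \<Theta> \<longleftrightarrow> (let K = p ` generic_part H p q in
    bounded_op_on K \<Theta> \<and> (\<forall>x\<in>K. cinner (\<Theta> x) x \<in> \<real>\<^sub>\<ge>\<^sub>0) \<and>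
    op_spectrum K \<Theta> \<subseteq> complex_of_real ` {0..pi/2} \<and>
    (\<forall>x\<in>K. op_cos \<Theta> (op_cos \<Theta> x) = p (q (p x))))"

text \<open>The angle operator is determined only on \<open>p ` generic_part H p q\<close>, and so is its spectrum.\<close>

definition projection_angle ::
    "'h::complex_hilbert set \<Rightarrow> ('h \<Rightarrow> 'h) \<Rightarrow> ('h \<Rightarrow> 'h) \<Rightarrow> complex set" where
  "projection_angle H p q =
    (if \<forall>x\<in>H. p (q x) = q (p x) then {complex_of_real (pi/2)}
     else op_spectrum (p ` generic_part H p q) (SOME \<Theta>. is_angle_operator H p q \<Theta>))"

text \<open>For a finite von Neumann algebra whose trace is the vector state of \<open>\<Omega>\<close>,
  its \<open>L\<^sup>2\<close> space is the closure of the orbit of \<open>\<Omega>\<close>.\<close>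

definition L2_space :: "'h::complex_hilbert \<Rightarrow> ('h \<Rightarrow> 'h) set \<Rightarrow> 'h set" where
  "L2_space \<Omega> M = closure ((\<lambda>T. T \<Omega>) ` M)"

definition vn_angle ::
    "'h::complex_hilbert \<Rightarrow> ('h \<Rightarrow> 'h) set \<Rightarrow> ('h \<Rightarrow> 'h) set \<Rightarrow> ('h \<Rightarrow> 'h) set \<Rightarrow> complex set" where
  "vn_angle \<Omega> M P Q =
    projection_angle (L2_space \<Omega> M) (orth_proj (L2_space \<Omega> P)) (orth_proj (L2_space \<Omega> Q))"

section \<open>The hyperfinite factor and the spin model subfactors\<close>

text \<open>The GNS Hilbert space of the normalized trace, and left multiplication on it.\<close>

type_synonym 'n gns = "'n tower_alg completion"

(* the lift must stop at tower_alg and not descend to its kernels *)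
lifting_forget tower_alg.lifting

lift_definition lmult :: "'n::finite tower_alg \<Rightarrow> 'n gns \<Rightarrow> 'n gns" is "\<lambda>x Y n. x * Y n"
proof -
  fix x :: "'n tower_alg" and Y Z :: "nat \<Rightarrow> 'n tower_alg"
  assume YZ: "completion_rel Y Z"
  obtain B where B: "\<And>y. norm (x * y) \<le> B * norm y" using norm_times_tower_bound by metis
  have B': "norm (x * y - x * z) \<le> B * norm (y - z)" for y z
    using B[of "y - z"] by (simp add: times_tower_diff_right)
  have "(\<lambda>n. B * norm (Y n - Z n)) \<longlonglongrightarrow> 0"
    using YZ by (intro tendsto_mult_right_zero tendsto_norm_zero) (simp add: completion_rel_def)
  then have "(\<lambda>n. x * Y n - x * Z n) \<longlonglongrightarrow> 0"
    by (rule Lim_null_comparison[OF always_eventually, rotated]) (use B' in auto)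
  then show "completion_rel (\<lambda>n. x * Y n) (\<lambda>n. x * Z n)"
    using YZ Cauchy_Lipschitz[OF _ B', of Y] Cauchy_Lipschitz[OF _ B', of Z]
    by (simp add: completion_rel_def)
qed

definition vacuum :: "'n::finite gns" where
  "vacuum = emb 1"

definition hyperfinite_factor :: "('n::finite gns \<Rightarrow> 'n gns) set" where
  "hyperfinite_factor = sot_closure (range lmult)"

definition matrix_unit :: "'n \<Rightarrow> 'n \<Rightarrow> complex^'n^'n" where
  "matrix_unit i j = (\<chi> a b. if a = i \<and> b = j then 1 else 0)"

definition J_matrix :: "complex^'n^'n::finite" where
  "J_matrix = (1 / real CARD('n)) *\<^sub>R (\<Sum>i\<in>UNIV. \<Sum>j\<in>UNIV. matrix_unit i j)"

definition diagonal_matrices :: "(complex^'n^'n) set" where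
  "diagonal_matrices = {d. \<forall>i j. i \<noteq> j \<longrightarrow> d $ i $ j = 0}"

definition conj_transpose :: "complex^'n^'n \<Rightarrow> complex^'n^'n" where
  "conj_transpose a = (\<chi> i j. cnj (a $ j $ i))"

text \<open>The Jones projections \<open>J \<otimes> I\<^sup>k\<close> for \<open>j = 2k\<close> and \<open>(\<Sum>i. E i i \<otimes> E i i) \<otimes> I\<^sup>k\<close> for
  \<open>j = 2k + 1\<close>; used only for \<open>j \<ge> 1\<close>.\<close>

definition jones_proj :: "nat \<Rightarrow> 'n::finite tower_alg" where
  "jones_proj j = (let k = j div 2 in
    if even j then site k J_matrix
    else \<Sum>i\<in>UNIV. site (k + 1) (matrix_unit i i) * site k (matrix_unit i i))"

definition spin_subfactor :: "complex^'n^'n \<Rightarrow> ('n::finite gns \<Rightarrow> 'n gns) set" where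
  "spin_subfactor u = vn_generated
    (lmult ` ({site 0 (u ** d ** conj_transpose u) |d. d \<in> diagonal_matrices} \<union> {jones_proj j |j. 1 \<le> j}))"

lemma lmult_emb: "lmult x (emb y) = emb (x * y)"
  by (simp add: emb_def lmult.abs_eq completion_rel_refl Cauchy_const_seq)

lemma bounded_op_lmult: "bounded_op_on UNIV (lmult x)"
proof -
  obtain B where B: "\<And>y. norm (x * y) \<le> B * norm y" using norm_times_tower_bound by metis
  have B': "norm (x * y - x * z) \<le> B * norm (y - z)" for y z
    using B[of "y - z"] by (simp add: times_tower_diff_right)
  have C: "Cauchy (\<lambda>n. x * Y n)" if "Cauchy Y" for Y
    using Cauchy_Lipschitz[OF that B'] .
  note S = completion_abs_eqs lmult.abs_eq C Cauchy_add_seq Cauchy_scaleC_seq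
    times_tower_add_right times_tower_scaleC_right
  have "lmult x (\<phi> + \<psi>) = lmult x \<phi> + lmult x \<psi>" for \<phi> \<psi>
    by (rule completion_exhaust[of \<phi>], rule completion_exhaust[of \<psi>]) (simp add: S)
  moreover have "lmult x (a *\<^sub>C \<phi>) = a *\<^sub>C lmult x \<phi>" for a \<phi>
    by (rule completion_exhaust[of \<phi>]) (simp add: S)
  moreover have "norm (lmult x \<phi>) \<le> B * norm \<phi>" for \<phi>
  proof -
    obtain Y where Y: "\<phi> = abs_completion Y" "Cauchy Y" by (rule completion_exhaust)
    have "(\<lambda>n. norm (x * Y n)) \<longlonglongrightarrow> norm (lmult x \<phi>)"
      using norm_completion_tendsto[OF C[OF Y(2)]] Y by (simp add: lmult.abs_eq completion_rel_refl)
    moreover have "(\<lambda>n. B * norm (Y n)) \<longlonglongrightarrow> B * norm \<phi>"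
      using norm_completion_tendsto[OF Y(2)] Y by (intro tendsto_intros) simp
    ultimately show ?thesis by (rule LIMSEQ_le) (use B in auto)
  qed
  ultimately show ?thesis unfolding bounded_op_on_def by blast
qed

lemma L2_space_hyperfinite_factor: "L2_space vacuum (hyperfinite_factor :: ('n::finite gns \<Rightarrow> 'n gns) set) = UNIV"
proof -
  have "lmult x \<in> hyperfinite_factor" for x :: "'n tower_alg"
    unfolding hyperfinite_factor_def sot_closure_def mem_Collect_eq
    by (intro conjI bounded_op_lmult subsetD[OF closure_subset] rangeI)
  then have "emb x \<in> (\<lambda>T. T vacuum) ` hyperfinite_factor" for x :: "'n tower_alg"
    by (rule image_eqI[rotated]) (simp add: vacuum_def lmult_emb times_tower_one_right)
  then have "range emb \<subseteq> (\<lambda>T. T vacuum) ` (hyperfinite_factor :: ('n gns \<Rightarrow> 'n gns) set)" by blast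
  then have "closure (range emb) \<subseteq> closure ((\<lambda>T. T vacuum) ` (hyperfinite_factor :: ('n gns \<Rightarrow> 'n gns) set))"
    by (rule closure_mono)
  then show ?thesis by (simp add: L2_space_def closure_range_emb top.extremum_unique)
qed

end

theory Submission
  imports Defs
begin

text \<open>Write \<open>X \<alpha>\<close> for the matrix with rows \<open>(0, cis (-\<alpha>))\<close> and \<open>(cis \<alpha>, 0)\<close>. Conjugating the
  diagonal algebra by \<open>u\<close> gives the span of \<open>1\<close> and \<open>X \<alpha>\<close>, so the subfactor of \<open>u\<close> is
  generated by \<open>X \<alpha>\<close> at site \<open>0\<close> and the Jones projections, and that of \<open>v\<close> by
  \<open>X \<beta>\<close> and the same projections. The spin \<open>X \<alpha>\<close> commutes with the Jones projections for
  \<open>j \<ge> 2\<close> and exchanges the first one with its complement. Therefore, if \<open>C\<close> is the closure of the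
  algebra \<open>N\<close> generated by the Jones projections in the GNS space, and \<open>U \<alpha>\<close> is left
  multiplication by \<open>X \<alpha>\<close>, the \<open>L\<^sup>2\<close> space of the subfactor is \<open>C + U \<alpha> C\<close>
  (\<open>L2_space_spin_subfactor\<close>). The upper bound uses that the operators which leave a closed
  subspace and its orthogonal complement invariant form a von Neumann algebra.

  Two symmetries of \<open>N\<close> determine all inner products. Its elements are diagonal at site \<open>0\<close>,
  whereas \<open>X \<beta>\<close> is off-diagonal, so \<open>U \<beta> C\<close> is orthogonal to \<open>C\<close>. Moreover, they are
  invariant under flipping the letters of all sites at once. The product \<open>X \<beta> X \<alpha>\<close> is diagonal
  with entries \<open>cis (\<alpha> - \<beta>)\<close> and \<open>cis (\<beta> - \<alpha>)\<close>, and invariance weights both equally;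
  hence the inner product of \<open>U \<alpha> c\<close> and \<open>U \<beta> d\<close> is \<open>cos (\<alpha> - \<beta>)\<close> times that of
  \<open>c\<close> and \<open>d\<close> (\<open>cinner_spin_spin\<close>).

  So the two \<open>L\<^sup>2\<close> spaces are \<open>C\<close> plus two copies of \<open>C\<close> which enclose a constant angle,
  like two lines in a plane. The generic part lives on these copies, where \<open>p q p\<close> is the scalar
  \<open>cos\<^sup>2 (\<alpha> - \<beta>)\<close>. It remains that an operator with spectrum in \<open>[0, pi/2]\<close>, nonnegative form
  and scalar squared cosine is itself a scalar: both ends of its numerical range are approximate
  eigenvalues, so both are determined by their cosine (\<open>angle_operator_scalar\<close>). If
  \<open>cos (\<alpha> - \<beta>) = 0\<close>, the projections commute and the angle is \<open>pi/2\<close> by definition. The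
  hypothesis on \<open>\<beta>\<close> says that \<open>sin (\<alpha> - \<beta>) \<noteq> 0\<close>, so the two copies are different.\<close>

section \<open>Closed subspaces of a complex Hilbert space\<close>

subclass (in complex_hilbert) banach ..

lemma bounded_bilinear_cinner: "bounded_bilinear (cinner :: 'a::complex_inner \<Rightarrow> 'a \<Rightarrow> complex)"
proof
  fix a b c :: 'a and r :: real
  show "cinner (a + b) c = cinner a c + cinner b c" by (rule cinner_add_left)
  show "cinner a (b + c) = cinner a b + cinner a c" by (rule cinner_add_right)
  show "cinner (r *\<^sub>R a) b = r *\<^sub>R cinner a b"
    by (simp add: scaleR_scaleC cinner_scaleC_left scaleR_conv_of_real)
  show "cinner a (r *\<^sub>R b) = r *\<^sub>R cinner a b"
    by (simp add: scaleR_scaleC cinner_scaleC_right scaleR_conv_of_real)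
  show "\<exists>K. \<forall>a b :: 'a. norm (cinner a b) \<le> norm a * norm b * K"
    by (rule exI[of _ 1]) (simp add: cinner_Cauchy_Schwarz)
qed

interpretation cinner: bounded_bilinear "cinner :: 'a::complex_inner \<Rightarrow> 'a \<Rightarrow> complex"
  by (rule bounded_bilinear_cinner)

lemma cinner_eq_0_commute: "cinner x y = 0 \<longleftrightarrow> cinner y (x::'a::complex_inner) = 0"
  by (metis cinner_commute complex_cnj_zero_iff)

lemma cinner_self_eq_0: "cinner x x = 0 \<longleftrightarrow> (x::'a::complex_inner) = 0"
  by (simp add: norm_cinner_self)

lemma bounded_linear_scaleC: "bounded_linear (\<lambda>x :: 'a::complex_inner. a *\<^sub>C x)"
  by (rule bounded_linear_intro[of _ "cmod a"])
    (simp_all add: scaleC_add_right scaleR_scaleC scaleC_scaleC norm_scaleC mult.commute)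

definition csubspace :: "'h::complex_inner set \<Rightarrow> bool" where
  "csubspace K \<longleftrightarrow> 0 \<in> K \<and> (\<forall>x\<in>K. \<forall>y\<in>K. x + y \<in> K) \<and> (\<forall>a. \<forall>x\<in>K. a *\<^sub>C x \<in> K)"

definition orth_complement :: "'h::complex_inner set \<Rightarrow> 'h set" where
  "orth_complement K = {x. \<forall>k\<in>K. cinner x k = 0}"

lemma
  assumes "csubspace K"
  shows csubspace_0: "0 \<in> K"
    and csubspace_add: "x \<in> K \<Longrightarrow> y \<in> K \<Longrightarrow> x + y \<in> K"
    and csubspace_scaleC: "x \<in> K \<Longrightarrow> a *\<^sub>C x \<in> K"
    and csubspace_scaleR: "x \<in> K \<Longrightarrow> r *\<^sub>R x \<in> K"
    and csubspace_minus: "x \<in> K \<Longrightarrow> - x \<in> K"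
    and csubspace_diff: "x \<in> K \<Longrightarrow> y \<in> K \<Longrightarrow> x - y \<in> K"
proof -
  show "0 \<in> K" "x \<in> K \<Longrightarrow> y \<in> K \<Longrightarrow> x + y \<in> K"
    using assms by (auto simp: csubspace_def)
  have sc: "a *\<^sub>C x \<in> K" if "x \<in> K" for a x
    using assms that by (auto simp: csubspace_def)
  then show "x \<in> K \<Longrightarrow> r *\<^sub>R x \<in> K" "x \<in> K \<Longrightarrow> - x \<in> K" "x \<in> K \<Longrightarrow> a *\<^sub>C x \<in> K"
    by (simp_all add: scaleR_scaleC scaleC_m1[symmetric])
  show "x \<in> K \<Longrightarrow> y \<in> K \<Longrightarrow> x - y \<in> K"
    using assms sc[of y "- 1"] unfolding csubspace_def
    by (metis scaleC_m1 diff_conv_add_uminus)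
qed

lemma csubspace_imp_subspace: "csubspace K \<Longrightarrow> subspace K"
  by (simp add: subspace_def csubspace_0 csubspace_add csubspace_scaleR)

lemma csubspace_orth_complement: "csubspace (orth_complement K)"
  by (auto simp: csubspace_def orth_complement_def cinner.zero_left cinner_add_left cinner_scaleC_left)

lemma closed_orth_complement: "closed (orth_complement K)"
proof -
  have "orth_complement K = (\<Inter>k\<in>K. {x. cinner x k = 0})" by (auto simp: orth_complement_def)
  moreover have "closed {x. cinner x k = 0}" for k :: 'a
    by (intro closed_Collect_eq linear_continuous_on cinner.bounded_linear_left continuous_on_const)
  ultimately show ?thesis by auto
qed

lemma csubspace_closure: assumes "csubspace K" shows "csubspace (closure K)"
proof -
  have "(\<lambda>(x, y). x + y) ` closure (K \<times> K) \<subseteq> closure K"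
    by (rule image_closure_subset)
      (auto intro!: continuous_intros subsetD[OF closure_subset] csubspace_add[OF assms]
        simp: case_prod_beta)
  moreover have "(\<lambda>x. a *\<^sub>C x) ` closure K \<subseteq> closure K" for a
    by (rule image_closure_subset)
      (auto intro!: linear_continuous_on bounded_linear_scaleC subsetD[OF closure_subset]
        csubspace_scaleC[OF assms])
  ultimately show ?thesis
    using csubspace_0[OF assms] closure_subset[of K] by (auto simp: csubspace_def closure_Times)
qed

text \<open>By the parallelogram law a sequence in \<open>K\<close> whose distances to \<open>x\<close> approach the infimum is
  Cauchy; its limit is a nearest point, and the nearest point is the foot of the perpendicular.\<close>

lemma nearest_point_exists:
  fixes K :: "'h::complex_hilbert set"
  assumes K: "csubspace K" "closed K"
  shows "\<exists>y\<in>K. \<forall>z\<in>K. norm (x - y) \<le> norm (x - z)"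
proof -
  define d where "d = infdist x K"
  have d0: "0 \<le> d" by (simp add: d_def infdist_nonneg)
  have ne: "K \<noteq> {}" using csubspace_0[OF K(1)] by auto
  have d: "d \<le> norm (x - z)" if "z \<in> K" for z
    using infdist_le[OF that, of x] by (simp add: d_def dist_norm)
  have "\<exists>k\<in>K. (norm (x - k))\<^sup>2 < d\<^sup>2 + inverse (real (Suc n))" for n
  proof -
    have "d < sqrt (d\<^sup>2 + inverse (real (Suc n)))"
      by (rule real_less_rsqrt) simp
    then obtain k where "k \<in> K" "dist x k < sqrt (d\<^sup>2 + inverse (real (Suc n)))"
      unfolding d_def infdist_notempty[OF ne] cInf_less_iff using ne
      by (subst (asm) cINF_less_iff) (auto intro!: bdd_belowI[of _ 0])
    moreover from this have "(norm (x - k))\<^sup>2 < (sqrt (d\<^sup>2 + inverse (real (Suc n))))\<^sup>2"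
      by (intro power_strict_mono) (auto simp: dist_norm)
    ultimately show ?thesis by (auto intro!: bexI[of _ k] simp del: of_nat_Suc)
  qed
  then obtain k where kK: "\<And>n. k n \<in> K"
    and k: "\<And>n. (norm (x - k n))\<^sup>2 < d\<^sup>2 + inverse (real (Suc n))" by metis
  have par: "(norm (k m - k n))\<^sup>2 \<le> 2 * inverse (real (Suc m)) + 2 * inverse (real (Suc n))" for m n
  proof -
    have eq: "(norm (k m - k n))\<^sup>2 + 4 * (norm (x - (1/2) *\<^sub>R (k m + k n)))\<^sup>2 =
        2 * (norm (x - k m))\<^sup>2 + 2 * (norm (x - k n))\<^sup>2"
    proof -
      have law: "(norm (a - b))\<^sup>2 + (norm (a + b))\<^sup>2 = 2 * (norm a)\<^sup>2 + 2 * (norm b)\<^sup>2" for a b :: 'h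
        by (simp add: power2_norm_eq_inner inner_diff_left inner_diff_right inner_add_left inner_add_right)
      have "(x - k m) + (x - k n) = 2 *\<^sub>R (x - (1/2) *\<^sub>R (k m + k n))"
        by (simp add: scaleR_diff_right scaleR_2)
      then show ?thesis using law[of "x - k m" "x - k n"]
        by (simp add: norm_minus_commute power_mult_distrib)
    qed
    have "d \<le> norm (x - (1/2) *\<^sub>R (k m + k n))"
      by (intro d csubspace_scaleR csubspace_add K kK)
    then have "d\<^sup>2 \<le> (norm (x - (1/2) *\<^sub>R (k m + k n)))\<^sup>2" using d0 by (intro power_mono)
    then show ?thesis using eq k[of m] k[of n] by linarith
  qed
  have "Cauchy k"
  proof (rule CauchyI)
    fix e :: real assume e: "0 < e"
    obtain N where N: "inverse (real (Suc N)) < e\<^sup>2 / 4"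
      using reals_Archimedean[of "e\<^sup>2 / 4"] e by auto
    have "norm (k m - k n) < e" if "m \<ge> N" "n \<ge> N" for m n
    proof -
      have "inverse (real (Suc m)) \<le> inverse (real (Suc N))"
        "inverse (real (Suc n)) \<le> inverse (real (Suc N))"
        using that by (auto intro!: le_imp_inverse_le)
      then have "(norm (k m - k n))\<^sup>2 < e\<^sup>2" using par[of m n] N by linarith
      then show ?thesis using e by (meson less_imp_le power2_less_imp_less)
    qed
    then show "\<exists>N. \<forall>m\<ge>N. \<forall>n\<ge>N. norm (k m - k n) < e" by blast
  qed
  then obtain y where y: "k \<longlonglongrightarrow> y" by (auto simp: Cauchy_convergent_iff convergent_def)
  have yK: "y \<in> K" by (rule closed_sequentially[OF K(2) kK y])
  have "(norm (x - y))\<^sup>2 \<le> d\<^sup>2"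
  proof (rule LIMSEQ_le)
    show "(\<lambda>n. (norm (x - k n))\<^sup>2) \<longlonglongrightarrow> (norm (x - y))\<^sup>2" by (intro tendsto_intros y)
    show "(\<lambda>n. d\<^sup>2 + inverse (real (Suc n))) \<longlonglongrightarrow> d\<^sup>2"
      using tendsto_add[OF tendsto_const LIMSEQ_inverse_real_of_nat, of "d\<^sup>2"] by simp
  qed (use k in \<open>auto intro: less_imp_le\<close>)
  then have "norm (x - y) \<le> d" using d0 by (rule power2_le_imp_le)
  then show ?thesis using yK d by force
qed

lemma orthogonal_decomposition:
  fixes K :: "'h::complex_hilbert set"
  assumes K: "csubspace K" "closed K"
  shows "\<exists>y\<in>K. x - y \<in> orth_complement K"
proof -
  obtain y where y: "y \<in> K" and min: "\<And>z. z \<in> K \<Longrightarrow> norm (x - y) \<le> norm (x - z)"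
    using nearest_point_exists[OF K, of x] by blast
  have "cinner (x - y) z = 0" if z: "z \<in> K" for z
  proof (rule ccontr)
    assume c0: "cinner (x - y) z \<noteq> 0"
    \<comment> \<open>Subtracting from \<open>x - y\<close> its component along \<open>z\<close> would shorten it.\<close>
    define a where "a = cinner (x - y) z / cinner z z"
    have z0: "z \<noteq> 0" using c0 by (auto simp: cinner.zero_right)
    have "cinner (x - y - a *\<^sub>C z) z = 0"
      using z0 by (simp add: cinner_diff_left[of "x - y"] cinner_scaleC_left a_def norm_cinner_self)
    then have "cinner (x - y - a *\<^sub>C z) (x - y - a *\<^sub>C z) = cinner (x - y - a *\<^sub>C z) (x - y)"
      by (simp add: cinner_diff_right[of _ "x - y"] cinner_scaleC_right)
    also have "\<dots> = cinner (x - y) (x - y) - cinner (x - y) z * cnj a"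
      using z0 cinner_commute[of z "x - y"]
      by (simp add: cinner_diff_left[of "x - y"] cinner_scaleC_left a_def norm_cinner_self)
    also have "cinner (x - y) z * cnj a = of_real ((cmod (cinner (x - y) z))\<^sup>2 / (norm z)\<^sup>2)"
      by (simp add: a_def norm_cinner_self complex_norm_square[symmetric])
    finally have "(norm (x - y - a *\<^sub>C z))\<^sup>2 = (norm (x - y))\<^sup>2 - (cmod (cinner (x - y) z))\<^sup>2 / (norm z)\<^sup>2"
      unfolding norm_cinner_self of_real_diff[symmetric] of_real_eq_iff .
    moreover have "(cmod (cinner (x - y) z))\<^sup>2 / (norm z)\<^sup>2 > 0" using c0 z0 by simp
    moreover have "(norm (x - y))\<^sup>2 \<le> (norm (x - (y + a *\<^sub>C z)))\<^sup>2"
      by (intro power_mono min csubspace_add csubspace_scaleC K y z) simp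
    ultimately show False by (simp add: diff_diff_eq)
  qed
  then show ?thesis using y by (auto simp: orth_complement_def)
qed

lemma orth_projI:
  fixes K :: "'h::complex_hilbert set"
  assumes K: "csubspace K" and y: "y \<in> K" "x - y \<in> orth_complement K"
  shows "orth_proj K x = y"
  unfolding orth_proj_def
proof (rule the_equality)
  show "y \<in> K \<and> (\<forall>z\<in>K. cinner (x - y) z = 0)" using y by (simp add: orth_complement_def)
  fix y' assume y': "y' \<in> K \<and> (\<forall>z\<in>K. cinner (x - y') z = 0)"
  have d: "y' - y \<in> K" using y y' by (intro csubspace_diff K) auto
  have "cinner (y' - y) (y' - y) = cinner (x - y) (y' - y) - cinner (x - y') (y' - y)"
    by (simp add: cinner_diff_left)
  then show "y' = y" using y y' d by (simp add: orth_complement_def cinner_self_eq_0)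
qed

lemma
  fixes K :: "'h::complex_hilbert set"
  assumes K: "csubspace K" "closed K"
  shows orth_proj_in: "orth_proj K x \<in> K"
    and orth_proj_diff: "x - orth_proj K x \<in> orth_complement K"
  using orthogonal_decomposition[OF K, of x] orth_projI[OF K(1)] by auto

text \<open>This inclusion of the double complement theorem recovers the invariance of \<open>K\<close> under an
  adjoint from the invariance of its complement.\<close>

lemma orth_complement_twice:
  fixes K :: "'h::complex_hilbert set"
  assumes K: "csubspace K" "closed K" and x: "\<And>z. z \<in> orth_complement K \<Longrightarrow> cinner x z = 0"
  shows "x \<in> K"
proof -
  obtain y where y: "y \<in> K" "x - y \<in> orth_complement K"
    using orthogonal_decomposition[OF K, of x] by blast
  have "cinner y (x - y) = 0"
    using y by (auto simp: orth_complement_def cinner_eq_0_commute)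
  then have "cinner (x - y) (x - y) = 0" using x[OF y(2)] by (simp add: cinner_diff_left)
  then show ?thesis using y by (simp add: cinner_self_eq_0)
qed

section \<open>Adjoints and the von Neumann algebra of a reducing subspace\<close>

text \<open>Riesz representation: \<open>f\<close> vanishes on a hyperplane, and a suitable multiple of a vector
  orthogonal to that hyperplane represents it.\<close>

lemma riesz_representation:
  fixes f :: "'h::complex_hilbert \<Rightarrow> complex"
  assumes add: "\<And>x y. f (x + y) = f x + f y" and sc: "\<And>a x. f (a *\<^sub>C x) = a * f x"
    and bound: "\<And>x. cmod (f x) \<le> B * norm x"
  shows "\<exists>w. \<forall>x. f x = cinner x w"
proof -
  define N where "N = {x. f x = 0}"
  have "bounded_linear f"
  proof (rule bounded_linear_intro[of _ B])
    show "f (r *\<^sub>R x) = r *\<^sub>R f x" for r x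
      by (simp add: scaleR_scaleC sc scaleR_conv_of_real)
    show "norm (f x) \<le> norm x * B" for x using bound[of x] by (simp add: mult.commute)
  qed (rule add)
  then have cl: "closed N"
    unfolding N_def by (intro closed_Collect_eq linear_continuous_on continuous_on_const)
  have f0: "f 0 = 0" using add[of 0 0] by simp
  have N: "csubspace N" using f0 by (simp add: csubspace_def N_def add sc)
  have fd: "f (x - y) = f x - f y" for x y using add[of "x - y" y] by simp
  show ?thesis
  proof (cases "\<exists>x. f x \<noteq> 0")
    case False
    then show ?thesis by (intro exI[of _ 0]) (simp add: cinner.zero_right)
  next
    case True
    then obtain x where x: "f x \<noteq> 0" by blast
    obtain y where y: "y \<in> N" "x - y \<in> orth_complement N"
      using orthogonal_decomposition[OF N cl, of x] by blast
    define z where "z = x - y"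
    have fz: "f z \<noteq> 0" using x y by (simp add: z_def fd N_def)
    then have z0: "cinner z z \<noteq> 0" using f0 by (auto simp: cinner_self_eq_0)
    have "f v = cinner v (cnj (f z / cinner z z) *\<^sub>C z)" for v
    proof -
      have "v - (f v / f z) *\<^sub>C z \<in> N" using fz by (simp add: N_def fd sc)
      then have "cinner (v - (f v / f z) *\<^sub>C z) z = 0"
        using y(2) by (simp add: orth_complement_def z_def cinner_eq_0_commute[of _ "x - y"])
      then have "cinner v z = f v / f z * cinner z z"
        by (simp add: cinner_diff_left cinner_scaleC_left)
      then show ?thesis using fz z0 by (simp add: cinner_scaleC_right)
    qed
    then show ?thesis by blast
  qed
qed

lemma bounded_op_on_UNIV_linear:
  fixes T :: "'h::complex_inner \<Rightarrow> 'h"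
  assumes "bounded_op_on UNIV T" shows "bounded_linear T"
proof -
  obtain B where B: "\<And>x. norm (T x) \<le> B * norm x"
    using assms unfolding bounded_op_on_def by blast
  show ?thesis
  proof (rule bounded_linear_intro[of _ B])
  show "T (x + y) = T x + T y" for x y using assms by (simp add: bounded_op_on_def)
  show "T (r *\<^sub>R x) = r *\<^sub>R T x" for r x
    using assms by (simp add: scaleR_scaleC bounded_op_on_def)
  show "norm (T x) \<le> norm x * B" for x using B[of x] by (simp add: mult.commute)
  qed
qed
lemma
  assumes T: "bounded_op_on UNIV (T :: 'h::complex_hilbert \<Rightarrow> 'h)"
  shows hilbert_adjoint: "cinner (T x) y = cinner x (hilbert_adjoint T y)"
    and bounded_op_hilbert_adjoint: "bounded_op_on UNIV (hilbert_adjoint T)"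
proof -
  obtain B where B: "\<And>x. norm (T x) \<le> B * norm x" using T unfolding bounded_op_on_def by blast
  have add: "T (x + y) = T x + T y" and sc: "T (a *\<^sub>C x) = a *\<^sub>C T x" for x y a
    using T by (simp_all add: bounded_op_on_def)
  have "\<exists>w. \<forall>x. cinner (T x) y = cinner x w" for y
  proof (rule riesz_representation)
    show "cmod (cinner (T x) y) \<le> (B * norm y) * norm x" for x
      using order_trans[OF cinner_Cauchy_Schwarz mult_right_mono[OF B[of x] norm_ge_zero[of y]]]
      by (simp add: ac_simps)
  qed (simp_all add: add sc cinner_add_left cinner_scaleC_left)
  then have "\<forall>y. \<exists>w. \<forall>x. cinner (T x) y = cinner x w" by blast
  from choice[OF this] obtain S where "\<forall>y x. cinner (T x) y = cinner x (S y)" by blast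
  then have S: "cinner (T x) y = cinner x (S y)" for x y by blast
  have uniq: "y = z" if "\<And>x. cinner x y = cinner x z" for y z :: 'h
  proof -
    have "cinner (y - z) (y - z) = 0" using that[of "y - z"] by (simp add: cinner_diff_right)
    then show ?thesis by (simp add: cinner_self_eq_0)
  qed
  have "hilbert_adjoint T = S"
    unfolding hilbert_adjoint_def
  proof (rule the_equality)
    fix S' assume S': "\<forall>x y. cinner (T x) y = cinner x (S' y)"
    show "S' = S"
    proof
      show "S' y = S y" for y by (rule uniq) (simp add: S[symmetric] S')
    qed
  qed (simp add: S)
  then show "cinner (T x) y = cinner x (hilbert_adjoint T y)" using S by simp
  have "S (x + y) = S x + S y" for x y by (rule uniq) (simp add: S[symmetric] cinner_add_right)
  moreover have "S (a *\<^sub>C x) = a *\<^sub>C S x" for a x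
    by (rule uniq) (simp add: S[symmetric] cinner_scaleC_right)
  moreover have "norm (S y) \<le> B * norm y" for y
  proof (cases "S y = 0")
    case True
    have "0 \<le> B * norm y"
    proof (cases "y = 0")
      case False
      then have "0 \<le> B" using order_trans[OF norm_ge_zero B[of y]] by (simp add: zero_le_mult_iff)
      then show ?thesis by simp
    qed simp
    then show ?thesis using True by simp
  next
    case False
    have "norm (S y) * norm (S y) = cmod (cinner (T (S y)) y)"
      unfolding S norm_cinner_self by (simp add: norm_mult power2_eq_square)
    also have "\<dots> \<le> norm (T (S y)) * norm y" by (rule cinner_Cauchy_Schwarz)
    also have "\<dots> \<le> B * norm (S y) * norm y" by (intro mult_right_mono B) simp
    finally show ?thesis using False by (simp add: mult_ac)
  qed
  ultimately show "bounded_op_on UNIV (hilbert_adjoint T)"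
    using \<open>hilbert_adjoint T = S\<close> unfolding bounded_op_on_def by auto
qed

text \<open>A von Neumann algebra that contains given operators bounds the one they generate from above.
  The operators reduced by a subspace \<open>K\<close> serve this purpose: if \<open>\<Omega> \<in> K\<close>,
  they map \<open>\<Omega>\<close> into \<open>K\<close>.\<close>

definition reducing_operators :: "'h::complex_hilbert set \<Rightarrow> ('h \<Rightarrow> 'h) set" where
  "reducing_operators K = {T. bounded_op_on UNIV T \<and> T ` K \<subseteq> K \<and>
    T ` orth_complement K \<subseteq> orth_complement K}"

lemma closed_maps_into:
  fixes A :: "'a set" and C :: "'b::topological_space set"
  assumes "closed C" shows "closed {T. T ` A \<subseteq> C}"
proof -
  have "{T. T ` A \<subseteq> C} = (\<Inter>x\<in>A. (\<lambda>T. T x) -` C)" by auto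
  moreover have "closed ((\<lambda>T. T x) -` C)" for x :: 'a
    using assms by (intro closed_vimage continuous_on_product_coordinates)
  ultimately show ?thesis by (metis (no_types, lifting) closed_INT)
qed

text \<open>These operators are the commutant of the projection onto \<open>K\<close>. Closedness is immediate
  from the pointwise description, and adjoints exchange the two invariance conditions.\<close>

lemma von_neumann_algebra_reducing_operators:
  fixes K :: "'h::complex_hilbert set"
  assumes K: "csubspace K" "closed K"
  shows "von_neumann_algebra (reducing_operators K)"
  unfolding von_neumann_algebra_def
proof (intro conjI ballI allI)
  note O = csubspace_orth_complement[of K]
  show "bounded_op_on UNIV T" if "T \<in> reducing_operators K" for T
    using that by (simp add: reducing_operators_def)
  show "id \<in> reducing_operators K"
    by (auto simp: reducing_operators_def bounded_op_on_def intro!: exI[of _ 1])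
  fix S T assume ST: "S \<in> reducing_operators K" "T \<in> reducing_operators K"
  have bl: "bounded_linear S" "bounded_linear T"
    using ST by (auto intro: bounded_op_on_UNIV_linear simp: reducing_operators_def)
  have bdd: "\<exists>B. \<forall>x. norm (S x + T x) \<le> B * norm x" "\<exists>B. \<forall>x. norm (S (T x)) \<le> B * norm x"
    using bounded_linear.bounded[OF bounded_linear_add[OF bl]]
      bounded_linear.bounded[OF bounded_linear_compose[OF bl]] by (simp_all add: mult.commute)
  show "(\<lambda>x. S x + T x) \<in> reducing_operators K"
    using ST bdd csubspace_add[OF K(1)] csubspace_add[OF O]
    by (auto simp: reducing_operators_def bounded_op_on_def scaleC_add_right image_subset_iff algebra_simps)
  show "S \<circ> T \<in> reducing_operators K"
    using ST bdd by (auto simp: reducing_operators_def bounded_op_on_def image_subset_iff)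
next
  note O = csubspace_orth_complement[of K]
  fix T assume T: "T \<in> reducing_operators K"
  then have bT: "bounded_op_on UNIV T" by (simp add: reducing_operators_def)
  fix a
  have "\<exists>B. \<forall>x. norm (a *\<^sub>C T x) \<le> B * norm x"
    using bounded_linear.bounded[OF bounded_linear_compose[OF bounded_linear_scaleC
          bounded_op_on_UNIV_linear[OF bT]]]
    by (simp add: mult.commute)
  then show "(\<lambda>x. a *\<^sub>C T x) \<in> reducing_operators K"
    using T csubspace_scaleC[OF K(1)] csubspace_scaleC[OF O]
    by (auto simp: reducing_operators_def bounded_op_on_def scaleC_add_right image_subset_iff
        scaleC_scaleC mult.commute)
next
  fix T assume T: "T \<in> reducing_operators K"
  then have bT: "bounded_op_on UNIV T" by (simp add: reducing_operators_def)
  note adj = hilbert_adjoint[OF bT]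
  have "hilbert_adjoint T k \<in> K" if "k \<in> K" for k
  proof (rule orth_complement_twice[OF K])
    fix z assume "z \<in> orth_complement K"
    then have "cinner (T z) k = 0" using T that by (auto simp: reducing_operators_def orth_complement_def)
    then show "cinner (hilbert_adjoint T k) z = 0"
      by (simp add: adj cinner_eq_0_commute[of _ z])
  qed
  moreover have "hilbert_adjoint T z \<in> orth_complement K" if z: "z \<in> orth_complement K" for z
    unfolding orth_complement_def
  proof (intro CollectI ballI)
    fix k assume "k \<in> K"
    then have "cinner z (T k) = 0" using T z by (auto simp: reducing_operators_def orth_complement_def)
    then show "cinner (hilbert_adjoint T z) k = 0"
      by (simp add: cinner_eq_0_commute[of _ k] adj[symmetric] cinner_eq_0_commute[of z])
  qed
  ultimately show "hilbert_adjoint T \<in> reducing_operators K"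
    using bounded_op_hilbert_adjoint[OF bT] by (auto simp: reducing_operators_def)
next
  define C where "C = {T. T ` K \<subseteq> K} \<inter> {T. T ` orth_complement K \<subseteq> orth_complement K}"
  have R: "T \<in> reducing_operators K \<longleftrightarrow> bounded_op_on UNIV T \<and> T \<in> C" for T
    by (simp add: reducing_operators_def C_def)
  have "closed C" unfolding C_def by (intro closed_Int closed_maps_into K closed_orth_complement)
  then have "closure (reducing_operators K) \<subseteq> C"
    using R by (intro closure_minimal) blast
  moreover have "reducing_operators K \<subseteq> closure (reducing_operators K)" by (rule closure_subset)
  ultimately show "sot_closure (reducing_operators K) = reducing_operators K"
    using R unfolding sot_closure_def by blast
qed

section \<open>Spectra of angle operators\<close>

text \<open>The quadratic form of \<open>A\<close> is nonnegative at \<open>x - A x / B\<close>; expanding it and estimating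
  the term of second order by the norm bound gives the inequality. In particular \<open>A x\<close> is small as soon as \<open>cinner (A x) x\<close> is.\<close>

lemma positive_operator_bound:
  assumes K: "csubspace K" and A: "bounded_op_on K A"
    and B: "0 < B" "\<And>x. x \<in> K \<Longrightarrow> norm (A x) \<le> B * norm x"
    and pos: "\<And>x. x \<in> K \<Longrightarrow> cinner (A x) x \<in> \<real>\<^sub>\<ge>\<^sub>0" and x: "x \<in> K"
  shows "(norm (A x))\<^sup>2 \<le> B * Re (cinner (A x) x)"
proof -
  have add: "\<And>x y. x \<in> K \<Longrightarrow> y \<in> K \<Longrightarrow> A (x + y) = A x + A y"
    and sc: "\<And>a x. x \<in> K \<Longrightarrow> A (a *\<^sub>C x) = a *\<^sub>C A x"
    and inK: "\<And>x. x \<in> K \<Longrightarrow> A x \<in> K"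
    using A by (simp_all add: bounded_op_on_def)
  define y where "y = A x"
  have y: "y \<in> K" using inK x by (simp add: y_def)
  have form: "cinner (A (x + a *\<^sub>C y)) (x + a *\<^sub>C y) =
      cinner (A x) x + cnj a * cinner y y + a * cinner (A y) x + a * cnj a * cinner (A y) y" for a
    using x y by (simp add: add sc csubspace_scaleC[OF K] cinner_add_left cinner_add_right
        cinner_scaleC_left cinner_scaleC_right y_def[symmetric] algebra_simps)
  have real: "Im (cinner (A z) z) = 0" "0 \<le> Re (cinner (A z) z)" if "z \<in> K" for z
    using pos[OF that] by (auto simp: complex_nonneg_Reals_iff)
  have z: "x + a *\<^sub>C y \<in> K" for a using x y K by (simp add: csubspace_add csubspace_scaleC)
  have sym: "Re (cinner (A y) x) = (norm y)\<^sup>2"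
    using real(1)[OF z[of \<i>]] real(1)[OF x] real(1)[OF y] unfolding form
    by (simp add: norm_cinner_self)
  have "Re (cinner (A y) y) \<le> norm (A y) * norm y"
    using cinner_Cauchy_Schwarz[of "A y" y] complex_Re_le_cmod order_trans by blast
  also have "\<dots> \<le> B * norm y * norm y" by (intro mult_right_mono B(2) y) simp
  finally have "Re (cinner (A y) y) / B\<^sup>2 \<le> (norm y)\<^sup>2 / B"
    using B(1) by (simp add: field_simps power2_eq_square)
  moreover have "0 \<le> Re (cinner (A x) x) - 2 * ((norm y)\<^sup>2 / B) + Re (cinner (A y) y) / B\<^sup>2"
    using real(2)[OF z[of "- of_real (1 / B)"]] sym unfolding form norm_cinner_self
    by (simp add: power2_eq_square)
  ultimately have "(norm y)\<^sup>2 / B \<le> Re (cinner (A x) x)" by linarith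
  then show ?thesis using B(1) by (simp add: y_def field_simps)
qed

lemma bounded_op_on_bound:
  assumes "bounded_op_on K T"
  obtains B where "1 \<le> B" "\<And>x. x \<in> K \<Longrightarrow> norm (T x) \<le> B * norm x"
proof -
  obtain D where D: "\<And>x. x \<in> K \<Longrightarrow> norm (T x) \<le> D * norm x"
    using assms unfolding bounded_op_on_def by blast
  show thesis
  proof (rule that[of "max 1 D"])
    show "norm (T x) \<le> max 1 D * norm x" if "x \<in> K" for x
      using order_trans[OF D[OF that] mult_right_mono[of D "max 1 D" "norm x"]] by simp
  qed simp
qed

text \<open>Shifts by real scalars move an end of the numerical range to \<open>0\<close>.\<close>

lemma bounded_op_on_shift:
  assumes K: "csubspace K" and T: "bounded_op_on K T"
  shows "bounded_op_on K (\<lambda>x. T x - m *\<^sub>R x)"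
proof -
  obtain B where B: "\<And>x. x \<in> K \<Longrightarrow> norm (T x) \<le> B * norm x" using bounded_op_on_bound[OF T] by metis
  have "norm (T x - m *\<^sub>R x) \<le> (B + \<bar>m\<bar>) * norm x" if "x \<in> K" for x
    using norm_triangle_ineq4[of "T x" "m *\<^sub>R x"] B[OF that] by (simp add: algebra_simps)
  then have "\<exists>B. \<forall>x\<in>K. norm (T x - m *\<^sub>R x) \<le> B * norm x" by blast
  then show ?thesis using T K
    by (simp add: bounded_op_on_def csubspace_diff csubspace_scaleC scaleC_add_right
        scaleC_diff_right scaleR_scaleC scaleC_scaleC mult.commute)
qed

text \<open>The infimum of the numerical range of a self-adjoint operator is an approximate
  eigenvalue, by the preceding inequality for the operator shifted by this infimum.\<close>

lemma approximate_eigenvalue_exists: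
  assumes K: "csubspace K" "K \<noteq> {0}" and T: "bounded_op_on K T"
    and real: "\<And>x. x \<in> K \<Longrightarrow> cinner (T x) x \<in> \<real>"
  obtains m where "\<And>x. x \<in> K \<Longrightarrow> m * (norm x)\<^sup>2 \<le> Re (cinner (T x) x)"
    and "\<And>e. 0 < e \<Longrightarrow> \<exists>x\<in>K. norm x = 1 \<and> norm (T x - m *\<^sub>R x) < e"
proof -
  obtain B where B: "1 \<le> B" "\<And>x. x \<in> K \<Longrightarrow> norm (T x) \<le> B * norm x" using bounded_op_on_bound[OF T] by blast
  define S where "S = (\<lambda>x. Re (cinner (T x) x)) ` {x \<in> K. norm x = 1}"
  define m where "m = Inf S"
  have unit: "(1 / norm x) *\<^sub>R x \<in> K" "norm ((1 / norm x) *\<^sub>R x) = 1" if "x \<in> K" "x \<noteq> 0" for x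
    using that K by (auto intro: csubspace_scaleR)
  have ne: "S \<noteq> {}"
  proof -
    obtain x where "x \<in> K" "x \<noteq> 0" using K csubspace_0[OF K(1)] by blast
    then show ?thesis using unit[of x] unfolding S_def by blast
  qed
  have bdd: "bdd_below S"
  proof (rule bdd_belowI)
    fix r assume "r \<in> S"
    then obtain x where x: "x \<in> K" "norm x = 1" "r = Re (cinner (T x) x)" by (auto simp: S_def)
    have "\<bar>r\<bar> \<le> norm (T x) * norm x"
      unfolding x(3) using abs_Re_le_cmod cinner_Cauchy_Schwarz order_trans by blast
    also have "\<dots> \<le> B" using B(2)[OF x(1)] x(2) by simp
    finally show "- B \<le> r" by linarith
  qed
  have low: "m * (norm x)\<^sup>2 \<le> Re (cinner (T x) x)" if x: "x \<in> K" for x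
  proof (cases "x = 0")
    case False
    let ?u = "(1 / norm x) *\<^sub>R x"
    have "Re (cinner (T ?u) ?u) \<in> S" using unit[OF x False] unfolding S_def by blast
    then have "m \<le> Re (cinner (T ?u) ?u)" unfolding m_def by (rule cInf_lower[OF _ bdd])
    also have "T ?u = (1 / norm x) *\<^sub>R T x" using T x by (simp add: bounded_op_on_def scaleR_scaleC)
    finally show ?thesis
      using False by (simp add: cinner.scaleR_left cinner.scaleR_right field_simps power2_eq_square)
  next
    case True
    then show ?thesis using T x by (simp add: cinner.zero_right)
  qed
  define A where "A = (\<lambda>x. T x - m *\<^sub>R x)"
  have A: "bounded_op_on K A" unfolding A_def by (rule bounded_op_on_shift[OF K(1) T])
  obtain D where D: "1 \<le> D" "\<And>x. x \<in> K \<Longrightarrow> norm (A x) \<le> D * norm x" using bounded_op_on_bound[OF A] by blast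
  have Aq: "cinner (A x) x = cinner (T x) x - of_real (m * (norm x)\<^sup>2)" for x
    by (simp add: A_def cinner_diff_left cinner.scaleR_left norm_cinner_self scaleR_conv_of_real)
  have pos: "cinner (A x) x \<in> \<real>\<^sub>\<ge>\<^sub>0" if "x \<in> K" for x
    using low[OF that] real[OF that] unfolding Aq
    by (simp add: complex_nonneg_Reals_iff complex_is_Real_iff)
  have "\<exists>x\<in>K. norm x = 1 \<and> norm (T x - m *\<^sub>R x) < e" if e: "0 < e" for e
  proof -
    have "Inf S < m + e\<^sup>2 / D" using e D(1) by (simp add: m_def)
    then obtain r where "r \<in> S" "r < m + e\<^sup>2 / D" using cInf_lessD[OF ne] by blast
    then obtain x where x: "x \<in> K" "norm x = 1" "Re (cinner (T x) x) < m + e\<^sup>2 / D"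
      by (auto simp: S_def)
    have D0: "0 < D" using D(1) by simp
    have "(norm (A x))\<^sup>2 \<le> D * Re (cinner (A x) x)"
      by (rule positive_operator_bound[OF K(1) A D0 D(2) pos x(1)])
    also have "\<dots> < e\<^sup>2" using x(2,3) D0 by (simp add: Aq field_simps)
    finally have "norm (A x) < e" using e by (meson less_imp_le power2_less_imp_less)
    then show ?thesis using x unfolding A_def by blast
  qed
  then show thesis using that low by blast
qed

lemma approximate_eigenvalue_in_spectrum:
  assumes K: "csubspace K" and T: "bounded_op_on K T"
    and approx: "\<And>e. 0 < e \<Longrightarrow> \<exists>x\<in>K. norm x = 1 \<and> norm (T x - m *\<^sub>R x) < e"
  shows "complex_of_real m \<in> op_spectrum K T"
  unfolding op_spectrum_def
proof (intro CollectI notI, elim exE conjE)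
  fix S
  assume S: "bounded_op_on K S" and inv: "\<forall>x\<in>K. S (complex_of_real m *\<^sub>C x - T x) = x \<and>
    complex_of_real m *\<^sub>C S x - T (S x) = x"
  obtain D where D: "1 \<le> D" "\<And>x. x \<in> K \<Longrightarrow> norm (S x) \<le> D * norm x" using bounded_op_on_bound[OF S] by blast
  obtain x where x: "x \<in> K" "norm x = 1" "norm (T x - m *\<^sub>R x) < 1 / D"
    using approx[of "1 / D"] D(1) by auto
  have "m *\<^sub>R x - T x \<in> K"
    using T x by (intro csubspace_diff csubspace_scaleR K) (simp_all add: bounded_op_on_def)
  then have "norm (S (m *\<^sub>R x - T x)) \<le> D * norm (m *\<^sub>R x - T x)" by (rule D(2))
  moreover have "S (m *\<^sub>R x - T x) = x" using inv x(1) by (simp add: scaleR_scaleC)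
  ultimately show False using x D(1) by (simp add: norm_minus_commute field_simps)
qed

text \<open>Expanding the cosine into its power series transports approximate eigenvectors of \<open>T\<close>
  to approximate eigenvectors of \<open>cos T\<close>.\<close>

context
  fixes K :: "'h::complex_hilbert set" and T :: "'h \<Rightarrow> 'h" and B :: real
  assumes K: "csubspace K" "closed K" and T: "bounded_op_on K T"
    and B: "1 \<le> B" "\<And>x. x \<in> K \<Longrightarrow> norm (T x) \<le> B * norm x"
begin

lemma funpow_in: "x \<in> K \<Longrightarrow> (T ^^ k) x \<in> K"
  using T by (induction k) (auto simp: bounded_op_on_def)

lemma norm_funpow_le: "x \<in> K \<Longrightarrow> norm ((T ^^ k) x) \<le> (2 * B) ^ k * norm x"
proof (induction k)
  case (Suc k)
  have "norm ((T ^^ Suc k) x) \<le> B * norm ((T ^^ k) x)" using B(2)[OF funpow_in[OF Suc.prems]] by simp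
  also have "\<dots> \<le> (2 * B) * ((2 * B) ^ k * norm x)"
    using B(1) Suc by (intro mult_mono) auto
  finally show ?case by (simp add: mult.assoc)
qed simp

lemma op_diff: assumes "x \<in> K" "y \<in> K" shows "T (x - y) = T x - T y"
proof -
  have "T (x + (- 1) *\<^sub>C y) = T x + (- 1) *\<^sub>C T y"
    using T assms csubspace_scaleC[OF K(1) assms(2)] by (simp add: bounded_op_on_def)
  then show ?thesis by (simp add: scaleC_m1)
qed

lemma funpow_diff: "x \<in> K \<Longrightarrow> y \<in> K \<Longrightarrow> (T ^^ k) (x - y) = (T ^^ k) x - (T ^^ k) y"
  by (induction k) (simp_all add: op_diff funpow_in)

text \<open>The factor comes from \<open>k * B ^ (k - 1) \<le> (2 * B) ^ k\<close>, which is the same majorant as for the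
  powers themselves, so that a single series controls everything below.\<close>

lemma norm_funpow_eigen_le:
  assumes x: "x \<in> K" and m: "\<bar>m\<bar> \<le> B"
  shows "norm ((T ^^ k) x - m ^ k *\<^sub>R x) \<le> (2 * B) ^ k * norm (T x - m *\<^sub>R x)"
proof (induction k)
  case (Suc k)
  let ?e = "norm (T x - m *\<^sub>R x)"
  have Tx: "T x \<in> K" and Ts: "T (m ^ k *\<^sub>R x) = m ^ k *\<^sub>R T x"
    using T x by (auto simp: bounded_op_on_def scaleR_scaleC)
  have mx: "m ^ k *\<^sub>R x \<in> K" by (rule csubspace_scaleR[OF K(1) x])
  have "(T ^^ Suc k) x - m ^ Suc k *\<^sub>R x =
      T ((T ^^ k) x - m ^ k *\<^sub>R x) + m ^ k *\<^sub>R (T x - m *\<^sub>R x)"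
    by (simp add: op_diff[OF funpow_in[OF x] mx] Ts scaleR_diff_right mult.commute)
  then have "norm ((T ^^ Suc k) x - m ^ Suc k *\<^sub>R x) \<le>
      norm (T ((T ^^ k) x - m ^ k *\<^sub>R x)) + norm (m ^ k *\<^sub>R (T x - m *\<^sub>R x))"
    using norm_triangle_ineq by metis
  also have "\<dots> \<le> B * ((2 * B) ^ k * ?e) + B * (2 * B) ^ k * ?e"
  proof (intro add_mono)
    have "norm (T ((T ^^ k) x - m ^ k *\<^sub>R x)) \<le> B * norm ((T ^^ k) x - m ^ k *\<^sub>R x)"
      by (intro B csubspace_diff K funpow_in x mx)
    also have "\<dots> \<le> B * ((2 * B) ^ k * ?e)" using B Suc by (intro mult_left_mono) auto
    finally show "norm (T ((T ^^ k) x - m ^ k *\<^sub>R x)) \<le> B * ((2 * B) ^ k * ?e)" .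
    have "\<bar>m\<bar> ^ k \<le> (2 * B) ^ k" using m B by (intro power_mono) auto
    also have "\<dots> \<le> B * (2 * B) ^ k" using B mult_right_mono[of 1 B "(2 * B) ^ k"] by simp
    finally show "norm (m ^ k *\<^sub>R (T x - m *\<^sub>R x)) \<le> B * (2 * B) ^ k * ?e"
      by (simp add: power_abs mult_right_mono)
  qed
  finally show ?case by (simp add: algebra_simps)
qed simp

text \<open>An upper bound for the operator norm of \<open>cos T\<close> on \<open>K\<close>, and at the same time for the
  factor by which passing to the cosine can enlarge the defect of an approximate eigenvector.\<close>

definition cos_majorant :: real where
  "cos_majorant = (\<Sum>k. norm (cos_coeff k *\<^sub>R (2 * B) ^ k))"

lemma
  assumes f: "\<And>k. norm (f k) \<le> (2 * B) ^ k * c"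
  shows summable_cos_majorant: "summable (\<lambda>k. cos_coeff k *\<^sub>R (f k :: 'h))"
    and norm_suminf_cos_majorant: "norm (\<Sum>k. cos_coeff k *\<^sub>R f k) \<le> cos_majorant * c"
proof -
  have s: "summable (\<lambda>k. norm (cos_coeff k *\<^sub>R (2 * B) ^ k) * c)"
    by (intro summable_mult2 summable_norm_cos)
  have le: "norm (cos_coeff k *\<^sub>R f k) \<le> norm (cos_coeff k *\<^sub>R (2 * B) ^ k) * c" for k
    using mult_left_mono[OF f[of k], of "\<bar>cos_coeff k\<bar>"] B(1) by (simp add: abs_mult mult.assoc)
  show "summable (\<lambda>k. cos_coeff k *\<^sub>R f k)"
    by (rule summable_comparison_test'[OF s]) (rule le)
  have "norm (\<Sum>k. cos_coeff k *\<^sub>R f k) \<le> (\<Sum>k. norm (cos_coeff k *\<^sub>R (2 * B) ^ k) * c)"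
    by (rule norm_suminf_le[OF le s])
  also have "\<dots> = cos_majorant * c"
    unfolding cos_majorant_def by (rule suminf_mult2[symmetric]) (rule summable_norm_cos)
  finally show "norm (\<Sum>k. cos_coeff k *\<^sub>R f k) \<le> cos_majorant * c" .
qed

lemma op_cos_in: assumes x: "x \<in> K" shows "op_cos T x \<in> K"
  unfolding op_cos_def
proof (rule closed_sequentially[OF K(2)])
  show "(\<Sum>k<n. cos_coeff k *\<^sub>R (T ^^ k) x) \<in> K" for n
    by (induction n) (auto intro!: csubspace_add csubspace_scaleR K funpow_in x csubspace_0)
  show "(\<lambda>n. \<Sum>k<n. cos_coeff k *\<^sub>R (T ^^ k) x) \<longlonglongrightarrow> (\<Sum>k. cos_coeff k *\<^sub>R (T ^^ k) x)"
    by (intro summable_LIMSEQ summable_cos_majorant[OF norm_funpow_le] x)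
qed

lemma op_cos_diff:
  assumes "x \<in> K" "y \<in> K" shows "op_cos T (x - y) = op_cos T x - op_cos T y"
  unfolding op_cos_def funpow_diff[OF assms] scaleR_diff_right
  by (intro suminf_diff[symmetric] summable_cos_majorant[OF norm_funpow_le] assms)

lemma norm_op_cos_le: "x \<in> K \<Longrightarrow> norm (op_cos T x) \<le> cos_majorant * norm x"
  unfolding op_cos_def by (rule norm_suminf_cos_majorant[OF norm_funpow_le])

lemma op_cos_eigen:
  assumes x: "x \<in> K" and m: "\<bar>m\<bar> \<le> B"
  shows "norm (op_cos T x - cos m *\<^sub>R x) \<le> cos_majorant * norm (T x - m *\<^sub>R x)"
proof -
  have c: "(\<lambda>k. (cos_coeff k *\<^sub>R m ^ k) *\<^sub>R x) sums (cos m *\<^sub>R x)"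
    by (rule bounded_linear.sums[OF bounded_linear_scaleR_left cos_converges])
  have "op_cos T x - cos m *\<^sub>R x = (\<Sum>k. cos_coeff k *\<^sub>R (T ^^ k) x - (cos_coeff k *\<^sub>R m ^ k) *\<^sub>R x)"
    unfolding op_cos_def sums_unique[OF c]
    by (intro suminf_diff summable_cos_majorant[OF norm_funpow_le] x sums_summable[OF c])
  also have "\<dots> = (\<Sum>k. cos_coeff k *\<^sub>R ((T ^^ k) x - m ^ k *\<^sub>R x))"
    by (simp add: scaleR_diff_right)
  finally show ?thesis
    using norm_suminf_cos_majorant[OF norm_funpow_eigen_le[OF x m]] by simp
qed

lemma cos_majorant_nonneg: "0 \<le> cos_majorant"
  unfolding cos_majorant_def by (intro suminf_nonneg summable_norm_cos) simp

lemma op_cos_twice_eigen: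
  assumes x: "x \<in> K" and m: "\<bar>m\<bar> \<le> B"
  shows "norm (op_cos T (op_cos T x) - (cos m)\<^sup>2 *\<^sub>R x) \<le>
    (cos_majorant\<^sup>2 + cos_majorant) * norm (T x - m *\<^sub>R x)"
proof -
  let ?y = "op_cos T x - cos m *\<^sub>R x"
  have mx: "cos m *\<^sub>R x \<in> K" by (rule csubspace_scaleR[OF K(1) x])
  have lin: "op_cos T (cos m *\<^sub>R x) = cos m *\<^sub>R op_cos T x"
  proof -
    have p: "(T ^^ k) (cos m *\<^sub>R x) = cos m *\<^sub>R (T ^^ k) x" for k
    proof (induction k)
      case (Suc k)
      then show ?case using T funpow_in[OF x, of k] by (simp add: bounded_op_on_def scaleR_scaleC)
    qed simp
    have "(\<lambda>k. cos_coeff k *\<^sub>R (T ^^ k) x) sums op_cos T x"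
      unfolding op_cos_def by (intro summable_sums summable_cos_majorant[OF norm_funpow_le] x)
    then have "(\<lambda>k. cos m *\<^sub>R (cos_coeff k *\<^sub>R (T ^^ k) x)) sums (cos m *\<^sub>R op_cos T x)"
      by (rule bounded_linear.sums[OF bounded_linear_scaleR_right])
    then show ?thesis unfolding op_cos_def[of T "cos m *\<^sub>R x"] p
      by (simp add: sums_iff mult.commute)
  qed
  have "op_cos T (op_cos T x) - (cos m)\<^sup>2 *\<^sub>R x = op_cos T ?y + cos m *\<^sub>R ?y"
    by (simp add: op_cos_diff[OF op_cos_in[OF x] mx] lin scaleR_diff_right power2_eq_square)
  then have "norm (op_cos T (op_cos T x) - (cos m)\<^sup>2 *\<^sub>R x) \<le> norm (op_cos T ?y) + norm (cos m *\<^sub>R ?y)"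
    using norm_triangle_ineq by metis
  also have "\<dots> \<le> cos_majorant * norm ?y + 1 * norm ?y"
    unfolding norm_scaleR
    by (intro add_mono norm_op_cos_le csubspace_diff K op_cos_in x mx mult_right_mono) auto
  also have "\<dots> = (cos_majorant + 1) * norm ?y" by (simp add: algebra_simps)
  also have "\<dots> \<le> (cos_majorant + 1) * (cos_majorant * norm (T x - m *\<^sub>R x))"
    using cos_majorant_nonneg by (intro mult_left_mono op_cos_eigen x m) simp
  finally show ?thesis by (simp add: algebra_simps power2_eq_square)
qed

end

lemma op_spectrum_scalar:
  assumes K: "csubspace K" "K \<noteq> {0}" and T: "\<And>x. x \<in> K \<Longrightarrow> T x = c *\<^sub>R x"
  shows "op_spectrum K T = {complex_of_real c}"
proof (intro set_eqI iffI)
  fix z assume z: "z \<in> op_spectrum K T"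
  show "z \<in> {complex_of_real c}"
  proof (rule ccontr)
    assume "z \<notin> {complex_of_real c}"
    then have zc: "z - of_real c \<noteq> 0" by simp
    define S where "S = (\<lambda>x. inverse (z - of_real c) *\<^sub>C (x :: 'a))"
    have d: "z *\<^sub>C y - T y = (z - of_real c) *\<^sub>C y" if "y \<in> K" for y
      using that scaleC_add_left[of "z - of_real c" "of_real c" y] by (simp add: T scaleR_scaleC)
    have SK: "S x \<in> K" if "x \<in> K" for x using that K by (simp add: S_def csubspace_scaleC)
    have "bounded_op_on K S"
      using SK unfolding bounded_op_on_def S_def
      by (auto simp: scaleC_add_right scaleC_scaleC norm_scaleC mult.commute
          intro!: exI[of _ "cmod (inverse (z - of_real c))"])
    moreover have "\<forall>x\<in>K. S (z *\<^sub>C x - T x) = x \<and> z *\<^sub>C S x - T (S x) = x"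
      using zc by (auto simp: d SK) (simp_all add: S_def scaleC_scaleC scaleC_1)
    ultimately show False using z unfolding op_spectrum_def by blast
  qed
next
  fix z assume "z \<in> {complex_of_real c}"
  then have z: "z = of_real c" by simp
  obtain x where x: "x \<in> K" "x \<noteq> 0" using K csubspace_0[OF K(1)] by blast
  show "z \<in> op_spectrum K T"
    unfolding op_spectrum_def
  proof (intro CollectI notI, elim exE conjE)
    fix S assume S: "bounded_op_on K S" "\<forall>x\<in>K. S (z *\<^sub>C x - T x) = x \<and> z *\<^sub>C S x - T (S x) = x"
    have "S 0 = x" using S(2) x by (metis T z diff_self scaleR_scaleC)
    moreover have "S (0 + 0) = S 0 + S 0" using S(1) csubspace_0[OF K(1)] unfolding bounded_op_on_def by blast
    ultimately show False using x by simp
  qed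
qed


text \<open>Both ends of the numerical range of an angle operator are approximate eigenvalues, hence
  lie in \<open>{0..pi/2}\<close> and have cosine \<open>cos \<theta>\<close>. So both equal \<open>\<theta>\<close>,
  and the operator is the scalar \<open>\<theta>\<close>.\<close>

lemma angle_operator_scalar:
  fixes H :: "'h::complex_hilbert set" and p q :: "'h \<Rightarrow> 'h"
  defines "K \<equiv> p ` generic_part H p q"
  assumes K: "csubspace K" "closed K" "K \<noteq> {0}"
    and pqp: "\<And>x. x \<in> K \<Longrightarrow> p (q (p x)) = (cos \<theta>)\<^sup>2 *\<^sub>R x" and \<theta>: "0 \<le> \<theta>" "\<theta> \<le> pi / 2"
    and T: "is_angle_operator H p q T" and x: "x \<in> K"
  shows "T x = \<theta> *\<^sub>R x"
proof -
  have bT: "bounded_op_on K T" and pos: "\<And>x. x \<in> K \<Longrightarrow> cinner (T x) x \<in> \<real>\<^sub>\<ge>\<^sub>0"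
    and spec: "op_spectrum K T \<subseteq> complex_of_real ` {0..pi/2}"
    and cos2: "\<And>x. x \<in> K \<Longrightarrow> op_cos T (op_cos T x) = (cos \<theta>)\<^sup>2 *\<^sub>R x"
    using T pqp unfolding is_angle_operator_def Let_def K_def[symmetric] by auto
  obtain B0 where B0: "1 \<le> B0" "\<And>x. x \<in> K \<Longrightarrow> norm (T x) \<le> B0 * norm x"
    using bounded_op_on_bound[OF bT] by blast
  have eig: "m = \<theta>" if m: "\<And>e. 0 < e \<Longrightarrow> \<exists>x\<in>K. norm x = 1 \<and> norm (T x - m *\<^sub>R x) < e" for m
  proof -
    have "complex_of_real m \<in> complex_of_real ` {0..pi/2}"
      using approximate_eigenvalue_in_spectrum[OF K(1) bT m] spec by blast
    then have m01: "0 \<le> m" "m \<le> pi / 2" by auto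
    define B where "B = max B0 \<bar>m\<bar>"
    have "norm (T x) \<le> B * norm x" if "x \<in> K" for x
      using order_trans[OF B0(2)[OF that] mult_right_mono[of B0 B "norm x"]] by (simp add: B_def)
    moreover have "1 \<le> B" "\<bar>m\<bar> \<le> B" using B0(1) by (auto simp: B_def)
    ultimately have B: "1 \<le> B" "\<And>x. x \<in> K \<Longrightarrow> norm (T x) \<le> B * norm x" "\<bar>m\<bar> \<le> B" by auto
    define E where "E = (cos_majorant B)\<^sup>2 + cos_majorant B"
    have E0: "0 \<le> E" using cos_majorant_nonneg[OF K(1,2) bT B(1,2)] by (simp add: E_def)
    have bnd: "\<bar>(cos \<theta>)\<^sup>2 - (cos m)\<^sup>2\<bar> \<le> E * e" if e: "0 < e" for e
    proof -
      obtain x where x: "x \<in> K" "norm x = 1" "norm (T x - m *\<^sub>R x) < e" using m[OF e] by blast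
      have "norm (((cos \<theta>)\<^sup>2 - (cos m)\<^sup>2) *\<^sub>R x) \<le> E * norm (T x - m *\<^sub>R x)"
        using op_cos_twice_eigen[OF K(1,2) bT B(1,2) x(1) B(3)]
        by (simp add: cos2[OF x(1)] E_def scaleR_diff_left)
      also have "\<dots> \<le> E * e" using x(3) E0 by (intro mult_left_mono) auto
      finally show ?thesis using x(2) by simp
    qed
    have "\<bar>(cos \<theta>)\<^sup>2 - (cos m)\<^sup>2\<bar> \<le> 0"
    proof (rule field_le_epsilon)
      fix e :: real assume e: "0 < e"
      have "\<bar>(cos \<theta>)\<^sup>2 - (cos m)\<^sup>2\<bar> \<le> E * (e / (E + 1))"
        using e E0 by (intro bnd divide_pos_pos) auto
      also have "\<dots> \<le> e" using e E0 by (simp add: field_simps)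
      finally show "\<bar>(cos \<theta>)\<^sup>2 - (cos m)\<^sup>2\<bar> \<le> 0 + e" by simp
    qed
    then have "(cos \<theta>)\<^sup>2 = (cos m)\<^sup>2" by simp
    moreover have "0 \<le> cos \<theta>" "0 \<le> cos m" using \<theta> m01 by (auto intro!: cos_ge_zero)
    ultimately have "cos m = cos \<theta>" by simp
    then show "m = \<theta>" using cos_inj_pi[of m \<theta>] \<theta> m01 by simp
  qed
  have real: "cinner (T x) x \<in> \<real>" if "x \<in> K" for x
    using pos[OF that] nonneg_Reals_subset_Reals by blast
  have low: "\<theta> * (norm x)\<^sup>2 \<le> Re (cinner (T x) x)" if "x \<in> K" for x
    using approximate_eigenvalue_exists[OF K(1,3) bT real] eig that by metis
  have bN: "bounded_op_on K (\<lambda>x. - T x)"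
    using bT csubspace_minus[OF K(1)] unfolding bounded_op_on_def
    by (simp add: scaleC_m1[symmetric] scaleC_add_right scaleC_scaleC norm_scaleC)
  have rN: "cinner (- T x) x \<in> \<real>" if "x \<in> K" for x using real[OF that] by (simp add: cinner_minus_left)
  obtain m where mlow: "\<And>x. x \<in> K \<Longrightarrow> m * (norm x)\<^sup>2 \<le> Re (cinner (- T x) x)"
    and mapp: "\<And>e. 0 < e \<Longrightarrow> \<exists>x\<in>K. norm x = 1 \<and> norm (- T x - m *\<^sub>R x) < e"
    using approximate_eigenvalue_exists[OF K(1,3) bN rN] by metis
  have "norm (T x - (- m) *\<^sub>R x) = norm (- T x - m *\<^sub>R x)" for x
    using norm_minus_cancel[of "T x - (- m) *\<^sub>R x"] by simp
  then have m: "m = - \<theta>" using eig[of "- m"] mapp by (metis minus_minus)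
  have up: "Re (cinner (T x) x) \<le> \<theta> * (norm x)\<^sup>2" if "x \<in> K" for x
    using mlow[OF that] by (simp add: cinner_minus_left m)
  define A where "A = (\<lambda>x. T x - \<theta> *\<^sub>R x)"
  have A: "bounded_op_on K A" unfolding A_def by (rule bounded_op_on_shift[OF K(1) bT])
  obtain D where D: "1 \<le> D" "\<And>x. x \<in> K \<Longrightarrow> norm (A x) \<le> D * norm x" using bounded_op_on_bound[OF A] by blast
  have Aq: "cinner (A x) x = 0" if "x \<in> K" for x
  proof (rule complex_eqI)
    show "Re (cinner (A x) x) = Re 0" using low[OF that] up[OF that]
      by (simp add: A_def cinner_diff_left cinner.scaleR_left norm_cinner_self)
    show "Im (cinner (A x) x) = Im 0" using real[OF that]
      by (simp add: A_def cinner_diff_left cinner.scaleR_left norm_cinner_self complex_is_Real_iff)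
  qed
  have "(norm (A x))\<^sup>2 \<le> D * Re (cinner (A x) x)"
    using D(1) by (intro positive_operator_bound[OF K(1) A _ D(2) _ x]) (auto simp: Aq)
  then show ?thesis by (simp add: Aq[OF x]) (simp add: A_def)
qed

lemma is_angle_operator_scalar:
  fixes H :: "'h::complex_hilbert set" and p q :: "'h \<Rightarrow> 'h"
  defines "K \<equiv> p ` generic_part H p q"
  assumes K: "csubspace K" "K \<noteq> {0}"
    and pqp: "\<And>x. x \<in> K \<Longrightarrow> p (q (p x)) = (cos \<theta>)\<^sup>2 *\<^sub>R x" and \<theta>: "0 \<le> \<theta>" "\<theta> \<le> pi / 2"
  shows "is_angle_operator H p q (\<lambda>x. \<theta> *\<^sub>R x)"
proof -
  let ?T = "\<lambda>x :: 'h. \<theta> *\<^sub>R x"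
  have p: "(?T ^^ k) x = \<theta> ^ k *\<^sub>R x" for k x by (induction k) simp_all
  have c: "op_cos ?T x = cos \<theta> *\<^sub>R x" for x
  proof -
    have "(\<lambda>k. (cos_coeff k *\<^sub>R \<theta> ^ k) *\<^sub>R x) sums (cos \<theta> *\<^sub>R x)"
      by (rule bounded_linear.sums[OF bounded_linear_scaleR_left cos_converges])
    then show ?thesis unfolding op_cos_def p by (simp add: sums_iff)
  qed
  have "cinner (?T x) x \<in> \<real>\<^sub>\<ge>\<^sub>0" for x
    using \<theta> by (simp add: cinner.scaleR_left norm_cinner_self complex_nonneg_Reals_iff)
  moreover have "bounded_op_on K ?T"
    using csubspace_scaleR[OF K(1)] unfolding bounded_op_on_def
    by (auto simp: scaleC_add_right scaleR_scaleC scaleC_scaleC mult.commute norm_scaleC)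
  moreover have "op_spectrum K ?T \<subseteq> complex_of_real ` {0..pi/2}"
    using op_spectrum_scalar[OF K, of ?T \<theta>] \<theta> by auto
  moreover have "\<forall>x\<in>K. op_cos ?T (op_cos ?T x) = p (q (p x))"
    by (simp add: c pqp power2_eq_square)
  ultimately show ?thesis unfolding is_angle_operator_def Let_def K_def[symmetric] by blast
qed

text \<open>When the compression of \<open>q\<close> to the generic part is a scalar, the choice operator in the
  definition of the angle is harmless: the scalar \<open>\<theta>\<close> is an angle operator, and any
  other one agrees with it on the relevant subspace.\<close>

lemma projection_angle_scalar:
  fixes H :: "'h::complex_hilbert set" and p q :: "'h \<Rightarrow> 'h"
  defines "K \<equiv> p ` generic_part H p q"
  assumes K: "csubspace K" "closed K" "K \<noteq> {0}"
    and pqp: "\<And>x. x \<in> K \<Longrightarrow> p (q (p x)) = (cos \<theta>)\<^sup>2 *\<^sub>R x" and \<theta>: "0 \<le> \<theta>" "\<theta> \<le> pi / 2"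
    and noncommuting: "\<exists>x\<in>H. p (q x) \<noteq> q (p x)"
  shows "projection_angle H p q = {complex_of_real \<theta>}"
proof -
  define T where "T = (SOME T. is_angle_operator H p q T)"
  note K' = K[unfolded K_def] pqp[unfolded K_def]
  have "is_angle_operator H p q T"
    unfolding T_def
    by (rule someI[of "is_angle_operator H p q", OF is_angle_operator_scalar[OF K'(1,3,4) \<theta>]])
  then have "T x = \<theta> *\<^sub>R x" if "x \<in> K" for x
    using angle_operator_scalar[OF K' \<theta>] that[unfolded K_def] by blast
  then have "op_spectrum K T = {complex_of_real \<theta>}" by (rule op_spectrum_scalar[OF K(1,3)])
  then show ?thesis using noncommuting by (auto simp: projection_angle_def T_def K_def)
qed

section \<open>Two isometric extensions of a subspace\<close>

text \<open>The space \<open>C + U C\<close> is the sum of \<open>C\<close> and an orthogonal isometric copy of it. This is the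
  shape of the \<open>L\<^sup>2\<close> space of an algebra which is generated by a subalgebra and one further
  self-adjoint unitary that normalizes it and is orthogonal to it.\<close>

locale isometric_extension =
  fixes C :: "'h::complex_hilbert set" and U :: "'h \<Rightarrow> 'h"
  assumes csubspace_C: "csubspace C" and closed_C: "closed C"
    and bounded_op_U: "bounded_op_on UNIV U"
    and isometric: "c \<in> C \<Longrightarrow> d \<in> C \<Longrightarrow> cinner (U c) (U d) = cinner c d"
    and orthogonal: "c \<in> C \<Longrightarrow> d \<in> C \<Longrightarrow> cinner c (U d) = 0"
begin

definition space :: "'h set" where
  "space = {c + U d | c d. c \<in> C \<and> d \<in> C}"

lemma U_add: "U (x + y) = U x + U y"
  and U_scaleC: "U (a *\<^sub>C x) = a *\<^sub>C U x"
  and bounded_linear_U: "bounded_linear U"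
  using bounded_op_U bounded_op_on_UNIV_linear by (auto simp: bounded_op_on_def)

lemma U_0: "U 0 = 0"
  using U_add[of 0 0] by simp

lemma U_scaleR: "U (r *\<^sub>R x) = r *\<^sub>R U x"
  by (simp add: scaleR_scaleC U_scaleC)

lemma orthogonal': "c \<in> C \<Longrightarrow> d \<in> C \<Longrightarrow> cinner (U d) c = 0"
  using orthogonal cinner_eq_0_commute by blast

lemma spaceI: "c \<in> C \<Longrightarrow> d \<in> C \<Longrightarrow> c + U d \<in> space"
  by (auto simp: space_def)

lemma spaceE:
  assumes "x \<in> space" obtains c d where "x = c + U d" "c \<in> C" "d \<in> C"
  using assms by (auto simp: space_def)

lemma C_subset_space: "c \<in> C \<Longrightarrow> c \<in> space"
  using spaceI[of c 0] csubspace_0[OF csubspace_C] by (simp add: U_0)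

lemma U_in_space: "d \<in> C \<Longrightarrow> U d \<in> space"
  using spaceI[of 0 d] csubspace_0[OF csubspace_C] by simp

lemma norm_U: "c \<in> C \<Longrightarrow> norm (U c) = norm c"
  using isometric[of c c] unfolding norm_cinner_self of_real_eq_iff by simp

lemma csubspace_space: "csubspace space"
  unfolding csubspace_def
proof (intro conjI ballI allI)
  show "0 \<in> space" by (rule C_subset_space[OF csubspace_0[OF csubspace_C]])
  fix x a assume "x \<in> space"
  then obtain c d where x: "x = c + U d" "c \<in> C" "d \<in> C" by (rule spaceE)
  show "a *\<^sub>C x \<in> space"
    using spaceI[OF csubspace_scaleC[OF csubspace_C x(2), of a] csubspace_scaleC[OF csubspace_C x(3), of a]]
    by (simp add: x(1) U_scaleC scaleC_add_right)
next
  fix x y assume "x \<in> space" "y \<in> space"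
  then obtain c d c' d' where xy: "x = c + U d" "c \<in> C" "d \<in> C" "y = c' + U d'" "c' \<in> C" "d' \<in> C"
    by (metis spaceE)
  have "c + c' + U (d + d') \<in> space" using xy by (intro spaceI csubspace_add csubspace_C)
  then show "x + y \<in> space" by (simp add: xy U_add algebra_simps)
qed

text \<open>Both closedness statements hold because isometric images of complete spaces are complete;
  on \<open>C \<times> C\<close> the map \<open>(c, d) \<mapsto> c + U d\<close> is isometric by Pythagoras.\<close>

lemma closed_space: "closed space"
proof -
  let ?f = "\<lambda>(c, d). c + U d"
  have "complete (?f ` (C \<times> C))"
  proof (rule complete_isometric_image[of 1])
    show "subspace (C \<times> C)" by (intro subspace_Times csubspace_imp_subspace csubspace_C)
    show "bounded_linear ?f"
      unfolding case_prod_beta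
      by (intro bounded_linear_add bounded_linear_fst bounded_linear_compose[OF bounded_linear_U bounded_linear_snd])
    have "norm (c + U d) = norm (c, d)" if cd: "c \<in> C" "d \<in> C" for c d
    proof -
      have "cinner (c + U d) (c + U d) = cinner c c + cinner d d"
        using cd by (simp add: cinner_add_left cinner_add_right orthogonal orthogonal' isometric)
      then have "(norm (c + U d))\<^sup>2 = (norm c)\<^sup>2 + (norm d)\<^sup>2"
        unfolding norm_cinner_self of_real_add[symmetric] of_real_eq_iff .
      then show ?thesis by (simp add: norm_Pair real_sqrt_unique)
    qed
    then show "\<forall>x\<in>C \<times> C. 1 * norm x \<le> norm (?f x)" by auto
    show "complete (C \<times> C)" by (simp add: complete_eq_closed closed_Times closed_C)
  qed simp
  moreover have "?f ` (C \<times> C) = space" by (auto simp: space_def)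
  ultimately show ?thesis by (simp add: complete_eq_closed)
qed

lemma csubspace_image_U: "csubspace (U ` C)"
  unfolding csubspace_def
proof (intro conjI ballI allI)
  show "0 \<in> U ` C" using csubspace_0[OF csubspace_C] U_0 by force
  show "x + y \<in> U ` C" if "x \<in> U ` C" "y \<in> U ` C" for x y
    using that csubspace_add[OF csubspace_C] U_add by (metis (no_types, lifting) imageE imageI)
  show "a *\<^sub>C x \<in> U ` C" if "x \<in> U ` C" for a x
    using that csubspace_scaleC[OF csubspace_C] U_scaleC by (metis (no_types, lifting) imageE imageI)
qed

lemma closed_image_U: "closed (U ` C)"
proof -
  have "complete (U ` C)"
    by (rule complete_isometric_image[of 1])
      (auto simp: csubspace_imp_subspace csubspace_C bounded_linear_U norm_U complete_eq_closed closed_C)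
  then show ?thesis by (simp add: complete_eq_closed)
qed

text \<open>The projection onto \<open>C\<close> factors through the one onto \<open>space\<close>, since \<open>U C\<close> is orthogonal
  to \<open>C\<close>.\<close>

lemma orth_proj_C:
  assumes x: "orth_proj space x = c + U d" and cd: "c \<in> C" "d \<in> C"
  shows "orth_proj C x = c"
proof (rule orth_projI[OF csubspace_C cd(1)])
  have "cinner (x - (c + U d)) k = 0" if "k \<in> C" for k
    using orth_proj_diff[OF csubspace_space closed_space, of x] C_subset_space[OF that]
    unfolding x orth_complement_def by blast
  then have "cinner (x - c) k = 0" if "k \<in> C" for k
    using orthogonal'[OF that cd(2)] that by (simp add: cinner_diff_left cinner_add_left)
  then show "x - c \<in> orth_complement C" by (simp add: orth_complement_def)
qed

end

text \<open>Two such copies of \<open>C\<close> that enclose the same angle in every direction: \<open>U C\<close> and \<open>V C\<close> look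
  like two lines in the plane with cosine \<open>\<gamma>\<close>, tensored with \<open>C\<close>.\<close>

locale isometric_extension_pair =
  u: isometric_extension C U + v: isometric_extension C V
  for C :: "'h::complex_hilbert set" and U V :: "'h \<Rightarrow> 'h" +
  fixes \<gamma> :: real
  assumes angle: "c \<in> C \<Longrightarrow> d \<in> C \<Longrightarrow> cinner (U c) (V d) = of_real \<gamma> * cinner c d"
begin

lemma angle': "c \<in> C \<Longrightarrow> d \<in> C \<Longrightarrow> cinner (V c) (U d) = of_real \<gamma> * cinner c d"
  using angle[of d c] by (metis cinner_commute complex_cnj_complex_of_real complex_cnj_mult)

lemma swapped: "isometric_extension_pair C V U \<gamma>"
  by unfold_locales (rule angle')

lemma orth_proj_left:
  assumes cd: "c \<in> C" "d \<in> C"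
  shows "orth_proj u.space (c + V d) = c + \<gamma> *\<^sub>R U d"
proof (rule orth_projI[OF u.csubspace_space])
  show "c + \<gamma> *\<^sub>R U d \<in> u.space"
    using u.spaceI[OF cd(1) csubspace_scaleR[OF u.csubspace_C cd(2), of \<gamma>]] by (simp add: u.U_scaleR)
  show "c + V d - (c + \<gamma> *\<^sub>R U d) \<in> orth_complement u.space"
    unfolding orth_complement_def
  proof (intro CollectI ballI)
    fix k assume "k \<in> u.space"
    then obtain c' d' where k: "k = c' + U d'" "c' \<in> C" "d' \<in> C" by (rule u.spaceE)
    show "cinner (c + V d - (c + \<gamma> *\<^sub>R U d)) k = 0"
      using cd k by (simp add: cinner_diff_left cinner_add_left cinner_add_right cinner.scaleR_left
          u.orthogonal v.orthogonal' u.orthogonal' u.isometric angle' scaleR_conv_of_real)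
  qed
qed

lemma orth_proj_right: "c \<in> C \<Longrightarrow> d \<in> C \<Longrightarrow> orth_proj v.space (c + U d) = c + \<gamma> *\<^sub>R V d"
  by (rule isometric_extension_pair.orth_proj_left[OF swapped])

lemma orth_proj_left_in: "orth_proj u.space x \<in> u.space"
  by (rule orth_proj_in[OF u.csubspace_space u.closed_space])

lemma orth_proj_right_in: "orth_proj v.space x \<in> v.space"
  by (rule orth_proj_in[OF v.csubspace_space v.closed_space])

lemma orth_proj_left_id: "x \<in> u.space \<Longrightarrow> orth_proj u.space x = x"
  by (rule orth_projI[OF u.csubspace_space]) (simp_all add: csubspace_0[OF csubspace_orth_complement])

lemma orth_proj_right_id: "x \<in> v.space \<Longrightarrow> orth_proj v.space x = x"
  by (rule isometric_extension_pair.orth_proj_left_id[OF swapped])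

lemma orth_proj_left_0: "orth_proj u.space (x - orth_proj u.space x) = 0"
  by (rule orth_projI[OF u.csubspace_space])
    (simp_all add: csubspace_0[OF u.csubspace_space] orth_proj_diff[OF u.csubspace_space u.closed_space])

lemma orth_proj_right_0: "orth_proj v.space (x - orth_proj v.space x) = 0"
  by (rule isometric_extension_pair.orth_proj_left_0[OF swapped])

lemma orth_proj_left_diff: "k \<in> u.space \<Longrightarrow> cinner k (x - orth_proj u.space x) = 0"
  using orth_proj_diff[OF u.csubspace_space u.closed_space, of x]
  unfolding orth_complement_def by (simp add: cinner_eq_0_commute[of k])

text \<open>If \<open>\<gamma> = 0\<close>, both composites are the projection onto \<open>C\<close>.\<close>

lemma orth_proj_commute:
  assumes "\<gamma> = 0"
  shows "orth_proj u.space (orth_proj v.space x) = orth_proj v.space (orth_proj u.space x)"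
proof -
  obtain c d where 1: "orth_proj v.space x = c + V d" "c \<in> C" "d \<in> C"
    using orth_proj_right_in v.spaceE by blast
  obtain c' d' where 2: "orth_proj u.space x = c' + U d'" "c' \<in> C" "d' \<in> C"
    using orth_proj_left_in u.spaceE by blast
  have "c = c'" using v.orth_proj_C[OF 1] u.orth_proj_C[OF 2] by simp
  then show ?thesis using 1 2 assms by (simp add: orth_proj_left orth_proj_right)
qed

text \<open>\<open>C\<close> is the meet of the two ranges, and neither range meets the orthogonal complement of the
  other one nontrivially. What remains of the first range in the generic part is \<open>U ` C\<close>.\<close>

lemma generic_part_image:
  assumes \<gamma>: "\<gamma> \<noteq> 0" "\<bar>\<gamma>\<bar> < 1"
  shows "orth_proj u.space ` generic_part UNIV (orth_proj u.space) (orth_proj v.space) = U ` C"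
    (is "?p ` ?G = _")
proof (intro equalityI subsetI)
  let ?q = "orth_proj v.space"
  note C0 = csubspace_0[OF u.csubspace_C]
  fix y assume "y \<in> ?p ` ?G"
  then obtain x where x: "x \<in> ?G" "y = ?p x" by blast
  obtain c d where y: "?p x = c + U d" "c \<in> C" "d \<in> C" using orth_proj_left_in u.spaceE by blast
  have 0: "0 = ?p 0" "0 = ?q 0" "0 = 0 - ?p 0" "0 = 0 - ?q 0"
    using orth_proj_left_id[OF u.C_subset_space[OF C0]] orth_proj_right_id[OF v.C_subset_space[OF C0]]
    by simp_all
  have r0: "0 \<in> range ?p" "0 \<in> range ?q" "0 \<in> range (\<lambda>x. x - ?p x)" "0 \<in> range (\<lambda>x. x - ?q x)"
    using 0 by (auto intro: range_eqI[where x=0])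
  have rc: "c \<in> range ?p" "c \<in> range ?q"
    using orth_proj_left_id[OF u.C_subset_space[OF y(2)]] orth_proj_right_id[OF v.C_subset_space[OF y(2)]]
    by (metis rangeI)+
  have "cinner x (c + 0 + 0 + 0) = 0"
    using x(1) r0 rc unfolding generic_part_def Let_def by blast
  then have xc: "cinner x c = 0" by simp
  have "cinner (x - ?p x) c = 0"
    using orth_proj_left_diff[OF u.C_subset_space[OF y(2)]] cinner_eq_0_commute by blast
  then have "cinner c c = 0"
    using y xc by (simp add: cinner_diff_left cinner_add_left u.orthogonal')
  then show "y \<in> U ` C" using x(2) y by (simp add: cinner_self_eq_0)
next
  let ?q = "orth_proj v.space"
  note C0 = csubspace_0[OF u.csubspace_C]
  fix y assume "y \<in> U ` C"
  then obtain e where e: "y = U e" "e \<in> C" by blast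
  have pUe: "?p (U e) = U e" by (rule orth_proj_left_id[OF u.U_in_space[OF e(2)]])
  have "U e \<in> ?G"
    unfolding generic_part_def Let_def
  proof (intro CollectI conjI ballI UNIV_I)
    fix a b c d
    assume a: "a \<in> range ?p \<inter> range ?q" and b: "b \<in> range ?p \<inter> range (\<lambda>x. x - ?q x)"
      and c: "c \<in> range (\<lambda>x. x - ?p x) \<inter> range ?q"
      and d: "d \<in> range (\<lambda>x. x - ?p x) \<inter> range (\<lambda>x. x - ?q x)"
    have "cinner (U e) c = 0" "cinner (U e) d = 0"
      using c d orth_proj_left_diff[OF u.U_in_space[OF e(2)]] by auto
    moreover have "cinner (U e) a = 0"
    proof -
      obtain z z' where "a = ?p z" "a = ?q z'" using a by blast
      then have "a \<in> u.space" "a \<in> v.space" by (metis orth_proj_left_in, metis orth_proj_right_in)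
      then obtain a1 a2 b1 b2 where A: "a = a1 + U a2" "a1 \<in> C" "a2 \<in> C" "a = b1 + V b2" "b1 \<in> C" "b2 \<in> C"
        by (metis u.spaceE v.spaceE)
      have "a1 = b1"
        using u.orth_proj_C[of a a1 a2] v.orth_proj_C[of a b1 b2] A
          orth_proj_left_id[OF \<open>a \<in> u.space\<close>] orth_proj_right_id[OF \<open>a \<in> v.space\<close>] by metis
      then have eq: "U a2 = V b2" using A by simp
      \<comment> \<open>The projection onto the first range fixes this vector, but shrinks the norm of every
        vector of \<open>V ` C\<close> by the factor \<open>\<bar>\<gamma>\<bar>\<close>.\<close>
      have "U a2 = \<gamma> *\<^sub>R U b2"
        using orth_proj_left[OF C0 A(6)] orth_proj_left_id[OF u.U_in_space[OF A(3)]] eq by simp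
      then have "norm a2 = \<bar>\<gamma>\<bar> * norm b2" using u.norm_U[OF A(3)] u.norm_U[OF A(6)] by simp
      moreover have "norm a2 = norm b2" using u.norm_U[OF A(3)] v.norm_U[OF A(6)] eq by simp
      ultimately have "a2 = 0" using \<gamma>(2) by (simp add: mult_cancel_right1)
      then show ?thesis using A e by (simp add: u.U_0 u.orthogonal')
    qed
    moreover have "b = 0"
    proof -
      have "b \<in> u.space" using b orth_proj_left_in by blast
      then obtain c' d' where B: "b = c' + U d'" "c' \<in> C" "d' \<in> C" by (rule u.spaceE)
      obtain z where "b = z - ?q z" using b by blast
      then have "?q b = 0" by (simp add: orth_proj_right_0)
      then have q0: "c' + \<gamma> *\<^sub>R V d' = 0" using orth_proj_right B by simp
      have "cinner (c' + \<gamma> *\<^sub>R V d') c' = 0" unfolding q0 by (rule cinner.zero_left)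
      then have "c' = 0" using B v.orthogonal'
        by (simp add: cinner_add_left cinner.scaleR_left cinner_self_eq_0)
      moreover from this q0 have "norm d' = 0" using \<gamma>(1) v.norm_U[OF B(3)] by simp
      ultimately show "b = 0" using B by (simp add: u.U_0)
    qed
    ultimately show "cinner (U e) (a + b + c + d) = 0" by (simp add: cinner_add_right)
  qed
  then show "y \<in> ?p ` ?G" using pUe e(1) by (metis imageI)
qed

text \<open>On the image \<open>U C\<close> of the generic part the compression is multiplication by \<open>\<gamma>\<^sup>2\<close>,
  because \<open>U d\<close> is sent to \<open>\<gamma> V d\<close> and back to \<open>\<gamma>\<^sup>2 U d\<close>. For \<open>\<gamma> = 0\<close> the
  projections commute and the convention for commuting projections gives the same value.\<close>

theorem projection_angle:
  assumes ne: "C \<noteq> {0}" and \<gamma>: "\<bar>\<gamma>\<bar> < 1"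
  shows "projection_angle UNIV (orth_proj u.space) (orth_proj v.space) = {complex_of_real (arccos \<bar>\<gamma>\<bar>)}"
proof (cases "\<gamma> = 0")
  case True
  then show ?thesis by (simp add: projection_angle_def orth_proj_commute)
next
  case False
  note C0 = csubspace_0[OF u.csubspace_C]
  obtain d where d: "d \<in> C" "d \<noteq> 0" using ne C0 by blast
  note G = generic_part_image[OF False \<gamma>]
  have nU: "U ` C \<noteq> {0}"
  proof
    assume "U ` C = {0}"
    then have "U d = 0" using d(1) by blast
    then show False using u.norm_U[OF d(1)] d(2) by simp
  qed
  have pq: "orth_proj u.space (V e) = \<gamma> *\<^sub>R U e" "orth_proj v.space (U e) = \<gamma> *\<^sub>R V e"
    "orth_proj u.space (\<gamma> *\<^sub>R V e) = \<gamma>\<^sup>2 *\<^sub>R U e" "orth_proj v.space (\<gamma> *\<^sub>R U e) = \<gamma>\<^sup>2 *\<^sub>R V e"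
    if e: "e \<in> C" for e
    using orth_proj_left[OF C0 e] orth_proj_right[OF C0 e]
      orth_proj_left[OF C0 csubspace_scaleR[OF u.csubspace_C e, of \<gamma>]]
      orth_proj_right[OF C0 csubspace_scaleR[OF u.csubspace_C e, of \<gamma>]]
    by (simp_all add: u.U_scaleR v.U_scaleR power2_eq_square)
  have cos: "(cos (arccos \<bar>\<gamma>\<bar>))\<^sup>2 = \<gamma>\<^sup>2" using \<gamma> by simp
  show ?thesis
  proof (rule projection_angle_scalar; (unfold G)?)
    show "csubspace (U ` C)" "closed (U ` C)" "U ` C \<noteq> {0}"
      by (rule u.csubspace_image_U u.closed_image_U nU)+
    show "orth_proj u.space (orth_proj v.space (orth_proj u.space x)) = (cos (arccos \<bar>\<gamma>\<bar>))\<^sup>2 *\<^sub>R x"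
      if "x \<in> U ` C" for x
      using that by (auto simp: cos pq orth_proj_left_id[OF u.U_in_space])
    show "0 \<le> arccos \<bar>\<gamma>\<bar>" using \<gamma> by (intro arccos_lbound) auto
    show "arccos \<bar>\<gamma>\<bar> \<le> pi / 2" using \<gamma> by (intro arccos_le_pi2) auto
    show "\<exists>x\<in>UNIV. orth_proj u.space (orth_proj v.space x) \<noteq> orth_proj v.space (orth_proj u.space x)"
    proof (rule bexI[of _ "V d"], rule notI)
      assume eq: "orth_proj u.space (orth_proj v.space (V d)) = orth_proj v.space (orth_proj u.space (V d))"
      have "\<gamma> *\<^sub>R U d = \<gamma>\<^sup>2 *\<^sub>R V d"
        using eq by (simp add: orth_proj_right_id[OF v.U_in_space[OF d(1)]] pq[OF d(1)])
      then have "norm (\<gamma> *\<^sub>R U d) = norm (\<gamma>\<^sup>2 *\<^sub>R V d)" by simp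
      then have "\<bar>\<gamma>\<bar> = \<gamma>\<^sup>2" using d by (simp add: u.norm_U v.norm_U)
      moreover have "\<bar>\<gamma>\<bar> * \<bar>\<gamma>\<bar> < \<bar>\<gamma>\<bar> * 1" using False \<gamma> by (intro mult_strict_left_mono) auto
      ultimately show False using abs_mult_self_eq[of \<gamma>] unfolding power2_eq_square by linarith
    qed simp
  qed
qed

end

section \<open>Entries of the generators\<close>

lemma entry_times: "entry (x * y) s t = (\<Sum>r | entry x s r \<noteq> 0. entry x s r * entry y r t)"
  by (simp add: times_tower_alg.rep_eq kernel_mult_def)

lemma entry_sum: "entry (\<Sum>i\<in>A. f i) s t = (\<Sum>i\<in>A. entry (f i) s t)"
  by (induction A rule: infinite_finite_induct)
    (simp_all add: zero_tower_alg.rep_eq plus_tower_alg.rep_eq)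

text \<open>Left multiplication by the generators is described completely by its action on the row index.
  All relations between them below are read off from this formula and the two for the Jones
  projections.\<close>

lemma entry_site_times:
  "entry (site p a * x) s t = (\<Sum>i\<in>UNIV. a $ s p $ i * entry x (s(p := i)) t)"
proof -
  let ?R = "range (\<lambda>i. s(p := i))"
  have "{r. entry (site p a) s r \<noteq> 0} \<subseteq> ?R"
  proof
    fix r assume "r \<in> {r. entry (site p a) s r \<noteq> 0}"
    then have "\<forall>j. j \<noteq> p \<longrightarrow> s j = r j" by (auto simp: site.rep_eq split: if_splits)
    then have "r = s(p := r p)" by auto
    then show "r \<in> ?R" by blast
  qed
  then have "entry (site p a * x) s t = (\<Sum>r\<in>?R. entry (site p a) s r * entry x r t)"
    unfolding entry_times by (intro sum.mono_neutral_left) auto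
  also have "\<dots> = (\<Sum>i\<in>UNIV. entry (site p a) s (s(p := i)) * entry x (s(p := i)) t)"
    by (rule sum.reindex_cong[OF _ refl refl]) (metis fun_upd_same injI)
  finally show ?thesis by (simp add: site.rep_eq)
qed

lemma J_matrix_component: "J_matrix $ i $ j = 1 / of_nat CARD('n)" for i j :: "'n::finite"
proof -
  have "(\<Sum>a\<in>UNIV. \<Sum>b\<in>UNIV. matrix_unit a b $ i $ j) = (\<Sum>a\<in>UNIV. if a = i then 1 else (0::complex))"
    by (rule sum.cong[OF refl]) (auto simp: matrix_unit_def)
  then show ?thesis by (simp add: J_matrix_def) (simp add: scaleR_conv_of_real)
qed

lemma jones_proj_even: "jones_proj (2 * k) = site k J_matrix"
  by (simp add: jones_proj_def)

lemma entry_jones_even_times: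
  fixes x :: "'n::finite tower_alg"
  shows "entry (jones_proj (2 * k) * x) s t = (\<Sum>i\<in>UNIV. entry x (s(k := i)) t) / of_nat CARD('n)"
  by (simp add: jones_proj_even entry_site_times J_matrix_component sum_divide_distrib)

lemma entry_jones_odd:
  fixes s t :: "nat \<Rightarrow> 'n::finite"
  shows "entry (jones_proj (2 * k + 1)) s t = (if s = t \<and> s (Suc k) = s k then 1 else 0)"
proof -
  have "entry (jones_proj (2 * k + 1)) s t =
      (\<Sum>i\<in>UNIV. \<Sum>l\<in>UNIV. matrix_unit i i $ s (Suc k) $ l * entry (site k (matrix_unit i i)) (s(Suc k := l)) t)"
    by (simp add: jones_proj_def Let_def entry_sum entry_site_times)
  also have "\<dots> = (\<Sum>i\<in>UNIV. if s (Suc k) = i then entry (site k (matrix_unit i i)) s t else 0)"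
  proof (rule sum.cong[OF refl])
    fix i :: 'n
    have "(\<Sum>l\<in>UNIV. matrix_unit i i $ s (Suc k) $ l * entry (site k (matrix_unit i i)) (s(Suc k := l)) t) =
        (\<Sum>l\<in>UNIV. if l = i then (if s (Suc k) = i
          then entry (site k (matrix_unit i i)) (s(Suc k := i)) t else 0) else 0)"
      by (rule sum.cong) (auto simp: matrix_unit_def)
    then show "(\<Sum>l\<in>UNIV. matrix_unit i i $ s (Suc k) $ l * entry (site k (matrix_unit i i)) (s(Suc k := l)) t) =
        (if s (Suc k) = i then entry (site k (matrix_unit i i)) s t else 0)"
      by auto
  qed
  also have "\<dots> = entry (site k (matrix_unit (s (Suc k)) (s (Suc k)))) s t" by simp
  also have "\<dots> = (if s = t \<and> s (Suc k) = s k then 1 else 0)"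
    by (auto simp: site.rep_eq matrix_unit_def fun_eq_iff) metis+
  finally show ?thesis .
qed

lemma entry_jones_odd_times:
  "entry (jones_proj (2 * k + 1) * x) s t = (if s (Suc k) = s k then entry x s t else 0)"
proof -
  have "{r. entry (jones_proj (2 * k + 1)) s r \<noteq> 0} = (if s (Suc k) = s k then {s} else {})"
    unfolding entry_jones_odd by auto
  then show ?thesis unfolding entry_times by (simp add: entry_jones_odd[simplified])
qed

lemma nat_even_odd_cases:
  fixes j :: nat
  obtains k where "j = 2 * k" | k where "j = 2 * k + 1"
  by (metis evenE oddE)

lemma star_site: "star (site p a) = site p (conj_transpose a)"
  by (auto simp: entry_eq_iff star.rep_eq site.rep_eq conj_transpose_def)

lemma star_jones_proj: "star (jones_proj j) = (jones_proj j :: 'n::finite tower_alg)"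
proof (cases j rule: nat_even_odd_cases)
  case (1 k)
  have "conj_transpose J_matrix = (J_matrix :: complex^'n^'n)"
    by (simp add: conj_transpose_def J_matrix_component vec_eq_iff)
  then show ?thesis unfolding 1 by (simp add: jones_proj_even star_site)
next
  case (2 k)
  show ?thesis unfolding 2 entry_eq_iff star.rep_eq entry_jones_odd by auto
qed

lemma star_tensor_mats: assumes x: "entry x \<in> tensor_mats m" shows "entry (star x) \<in> tensor_mats m"
proof (rule tensor_matsI)
  fix s t :: "nat \<Rightarrow> 'a"
  show "entry (star x) s t = 0" if "\<not> (\<forall>j\<ge>m. s j = t j)"
  proof -
    have "\<not> (\<forall>j\<ge>m. t j = s j)" using that by metis
    then show ?thesis using tensor_mats_zero[OF x] by (simp add: star.rep_eq)
  qed
  show "entry (star x) s t = entry (star x) (restrict s {..<m}) (restrict t {..<m})" if "\<forall>j\<ge>m. s j = t j"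
    using that tensor_mats_eq[OF x, of t s] by (simp add: star.rep_eq)
qed

text \<open>Both sides are the trace of \<open>star z * x * y\<close>. Hence \<open>star\<close> becomes the adjoint on the
  GNS space.\<close>

lemma cinner_times_left: "cinner (x * y) z = cinner y (star x * (z :: 'n::finite tower_alg))"
proof -
  obtain m1 where m1: "entry x \<in> tensor_mats m1" "0 \<le> m1" by (rule entry_tensor_mats)
  obtain m2 where m2: "entry y \<in> tensor_mats m2" "m1 \<le> m2" by (rule entry_tensor_mats)
  obtain m where z: "entry z \<in> tensor_mats m" "m2 \<le> m" by (rule entry_tensor_mats)
  have x: "entry x \<in> tensor_mats m" and y: "entry y \<in> tensor_mats m"
    using tensor_mats_mono m1 m2 z order_trans by metis+
  have E: "entry (a * b) s t = (\<Sum>r\<in>words m. entry a s r * entry b r t)"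
    if "entry a \<in> tensor_mats m" "entry b \<in> tensor_mats m" "s \<in> words m" "t \<in> words m" for a b :: "'n tower_alg" and s t
    unfolding times_tower_alg.rep_eq kernel_mult_words[OF that(1,2)]
    using that words_agree[OF that(3,4)] by (simp add: restrict_words)
  have T: "entry (a * b) \<in> tensor_mats m" if "entry a \<in> tensor_mats m" "entry b \<in> tensor_mats m" for a b :: "'n tower_alg"
    unfolding times_tower_alg.rep_eq by (rule kernel_mult_tensor_mats[OF that])
  note x' = star_tensor_mats[OF x]
  have "(\<Sum>s\<in>words m. \<Sum>t\<in>words m. entry (x * y) s t * cnj (entry z s t)) =
      (\<Sum>s\<in>words m. \<Sum>t\<in>words m. \<Sum>r\<in>words m. entry x s r * entry y r t * cnj (entry z s t))"
    by (simp add: E[OF x y] sum_distrib_right)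
  also have "\<dots> = (\<Sum>s\<in>words m. \<Sum>r\<in>words m. \<Sum>t\<in>words m. entry x s r * entry y r t * cnj (entry z s t))"
    by (intro sum.cong refl sum.swap)
  also have "\<dots> = (\<Sum>r\<in>words m. \<Sum>s\<in>words m. \<Sum>t\<in>words m. entry x s r * entry y r t * cnj (entry z s t))"
    by (rule sum.swap)
  also have "\<dots> = (\<Sum>r\<in>words m. \<Sum>t\<in>words m. \<Sum>s\<in>words m. entry x s r * entry y r t * cnj (entry z s t))"
    by (intro sum.cong refl sum.swap)
  also have "\<dots> = (\<Sum>r\<in>words m. \<Sum>t\<in>words m. entry y r t * cnj (entry (star x * z) r t))"
    by (simp add: E[OF x' z(1)] star.rep_eq sum_distrib_left mult.left_commute mult.assoc)
  finally show ?thesis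
    by (simp add: cinner_tower_words[OF T[OF x y] z(1)] cinner_tower_words[OF y T[OF x' z(1)]])
qed

section \<open>The algebra generated by the Jones projections\<close>

text \<open>Closure under left multiplication by the generators is enough to reach all words in them, and it
  makes inductions use only the row formulas above.\<close>

inductive_set jones_algebra :: "'n::finite tower_alg set" where
  one: "1 \<in> jones_algebra"
| add: "x \<in> jones_algebra \<Longrightarrow> y \<in> jones_algebra \<Longrightarrow> x + y \<in> jones_algebra"
| scaleC: "x \<in> jones_algebra \<Longrightarrow> a *\<^sub>C x \<in> jones_algebra"
| jones: "x \<in> jones_algebra \<Longrightarrow> 1 \<le> j \<Longrightarrow> jones_proj j * x \<in> jones_algebra"

lemma csubspace_jones_algebra: "csubspace (jones_algebra :: 'n::finite tower_alg set)"
proof -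
  have "0 *\<^sub>C 1 \<in> (jones_algebra :: 'n tower_alg set)"
    by (intro jones_algebra.one jones_algebra.scaleC)
  moreover have "0 *\<^sub>C 1 = (0 :: 'n tower_alg)"
    by (metis of_real_0 scaleR_scaleC scaleR_zero_left)
  ultimately have "0 \<in> (jones_algebra :: 'n tower_alg set)" by metis
  then show "csubspace (jones_algebra :: 'n tower_alg set)"
    unfolding csubspace_def by (auto intro: jones_algebra.add jones_algebra.scaleC)
qed

text \<open>At site \<open>0\<close> only the projection \<open>\<Sum>i. E i i \<otimes> E i i\<close> with \<open>j = 1\<close> acts, and it is
  diagonal. The averaging projections start at site \<open>1\<close>.\<close>

lemma jones_algebra_diagonal:
  assumes "x \<in> jones_algebra" "s 0 \<noteq> t 0" shows "entry x s t = 0"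
  using assms
proof (induction arbitrary: s t)
  case (jones x j)
  show ?case
  proof (cases j rule: nat_even_odd_cases)
    case (1 k)
    then have "k \<noteq> 0" using jones.hyps by auto
    then show ?thesis using jones by (simp add: 1 entry_jones_even_times)
  next
    case (2 k)
    show ?thesis unfolding 2 entry_jones_odd_times using jones by simp
  qed
qed (auto simp: one_tower_alg.rep_eq plus_tower_alg.rep_eq scaleC_tower_alg.rep_eq)

text \<open>The Jones projections only compare or average letters, hence are insensitive to a
  simultaneous permutation of the alphabet at all sites.\<close>

lemma jones_algebra_permute:
  assumes "x \<in> jones_algebra" and f: "bij f"
  shows "entry x (f \<circ> s) (f \<circ> t) = entry x s t"
  using assms(1)
proof (induction arbitrary: s t)
  case one
  have "f \<circ> s = f \<circ> t \<longleftrightarrow> s = t" using bij_is_inj[OF f] by (auto simp: fun_eq_iff inj_eq)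
  then show ?case by (simp add: one_tower_alg.rep_eq comp_def)
next
  case (jones x j)
  show ?case
  proof (cases j rule: nat_even_odd_cases)
    case (1 k)
    have upd: "(f \<circ> s)(k := f i) = f \<circ> s(k := i)" for i by auto
    have "(\<Sum>i\<in>UNIV. entry x ((f \<circ> s)(k := i)) (f \<circ> t)) = (\<Sum>i\<in>UNIV. entry x ((f \<circ> s)(k := f i)) (f \<circ> t))"
      by (rule sum.reindex_bij_betw[OF f, symmetric])
    also have "\<dots> = (\<Sum>i\<in>UNIV. entry x (s(k := i)) t)" by (simp only: upd jones.IH)
    finally show ?thesis unfolding 1 entry_jones_even_times by (simp only:)
  next
    case (2 k)
    show ?thesis unfolding 2 entry_jones_odd_times jones.IH
      by (simp add: inj_eq[OF bij_is_inj[OF f]])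
  qed
qed (auto simp: plus_tower_alg.rep_eq scaleC_tower_alg.rep_eq)

section \<open>The generator at the first site\<close>

text \<open>The spin component along the direction with azimuth \<open>\<alpha>\<close> in the equatorial plane,
  \<open>cos \<alpha> X + sin \<alpha> Y\<close> in terms of the Pauli matrices. With the unit it spans the conjugated
  diagonal algebra.\<close>

definition equatorial :: "real \<Rightarrow> complex^2^2" where
  "equatorial \<alpha> = vector [vector [0, cis (- \<alpha>)], vector [cis \<alpha>, 0]]"

definition flip :: "2 \<Rightarrow> 2" where
  "flip i = (if i = 1 then 2 else 1)"

lemma flip_simps: "flip 1 = 2" "flip 2 = 1" "flip (flip i) = i" "flip i \<noteq> i" "i = flip j \<longleftrightarrow> i \<noteq> j"
  using exhaust_2[of i] exhaust_2[of j] by (auto simp: flip_def)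

lemma bij_flip: "bij flip"
  by (rule involuntory_imp_bij) (rule flip_simps)

abbreviation spin :: "real \<Rightarrow> 2 tower_alg" where
  "spin \<alpha> \<equiv> site 0 (equatorial \<alpha>)"

text \<open>The nonzero entry of the equatorial matrix in row \<open>i\<close>.\<close>

definition phase :: "real \<Rightarrow> 2 \<Rightarrow> complex" where
  "phase \<alpha> i = (if i = 1 then cis (- \<alpha>) else cis \<alpha>)"

lemma phase_flip: "phase \<alpha> (flip i) = cnj (phase \<alpha> i)"
  using exhaust_2[of i] by (auto simp: phase_def flip_simps cis_cnj)

lemma phase_cnj: "phase \<alpha> i * cnj (phase \<alpha> i) = 1"
  by (auto simp: phase_def cis_cnj cis_mult)

lemma entry_spin_times:
  "entry (spin \<alpha> * x) s t = phase \<alpha> (s 0) * entry x (s(0 := flip (s 0))) t"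
  unfolding entry_site_times sum_2 using exhaust_2[of "s 0"]
  by (auto simp: equatorial_def phase_def flip_simps)

lemma spin_spin: "spin \<alpha> * (spin \<alpha> * x) = x"
  unfolding entry_eq_iff entry_spin_times
  by (simp add: phase_flip phase_cnj flip_simps mult.assoc[symmetric])

lemma jones_spin_commute:
  assumes "2 \<le> j" shows "jones_proj j * (spin \<alpha> * x) = spin \<alpha> * (jones_proj j * x)"
proof (cases j rule: nat_even_odd_cases)
  case (1 k)
  then have k: "k \<noteq> 0" using assms by auto
  show ?thesis
    unfolding 1 entry_eq_iff entry_jones_even_times entry_spin_times
    using k by (simp add: fun_upd_twist sum_distrib_left)
next
  case (2 k)
  then have k: "k \<noteq> 0" using assms by auto
  show ?thesis
    unfolding 2 entry_eq_iff entry_jones_odd_times entry_spin_times using k by simp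
qed

text \<open>The projection \<open>jones_proj 1\<close> tests whether the letters at sites \<open>0\<close> and \<open>1\<close> agree, and
  the spin at site \<open>0\<close> flips the answer.\<close>

lemma jones_spin_anticommute:
  "jones_proj 1 * (spin \<alpha> * x) = spin \<alpha> * (x - jones_proj 1 * x)"
proof -
  note E = entry_jones_odd_times[of 0, unfolded mult_0_right add_0]
  show ?thesis
    unfolding entry_eq_iff E entry_spin_times minus_tower_alg.rep_eq
    by (auto simp: flip_simps)
qed

text \<open>The entries of \<open>x\<close> are diagonal at site \<open>0\<close>, those of \<open>spin \<beta> * y\<close> off-diagonal.\<close>

lemma cinner_spin_right:
  assumes "x \<in> jones_algebra" "y \<in> jones_algebra"
  shows "cinner x (spin \<beta> * y) = 0"
proof -
  obtain m1 where m1: "entry x \<in> tensor_mats m1" "0 \<le> m1" by (rule entry_tensor_mats)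
  obtain m where m: "entry (spin \<beta> * y) \<in> tensor_mats m" "m1 \<le> m" by (rule entry_tensor_mats)
  have x: "entry x \<in> tensor_mats m" using tensor_mats_mono[OF m1(1) m(2)] .
  have 0: "entry x s t * cnj (entry (spin \<beta> * y) s t) = 0" for s t
    using jones_algebra_diagonal[OF assms(1), of s t] jones_algebra_diagonal[OF assms(2), of "s(0 := flip (s 0))" t]
    unfolding entry_spin_times by (cases "s 0 = t 0") (auto simp: flip_simps)
  show ?thesis unfolding cinner_tower_words[OF x m(1)] 0 by simp
qed

text \<open>Multiplying entrywise, the two spins contribute the phase \<open>cis (\<beta> - \<alpha>)\<close> or its conjugate,
  according to the first letter. The flip symmetry exchanges the two cases, so that only the
  mean \<open>cos (\<alpha> - \<beta>)\<close> of both phases survives.\<close>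

lemma cinner_spin_spin:
  assumes xy: "x \<in> jones_algebra" "y \<in> jones_algebra"
  shows "cinner (spin \<alpha> * x) (spin \<beta> * y) = complex_of_real (cos (\<alpha> - \<beta>)) * cinner x y"
proof -
  obtain m1 where m1: "entry x \<in> tensor_mats m1" "1 \<le> m1" by (rule entry_tensor_mats)
  obtain m2 where m2: "entry y \<in> tensor_mats m2" "m1 \<le> m2" by (rule entry_tensor_mats)
  obtain m3 where m3: "entry (spin \<alpha> * x) \<in> tensor_mats m3" "m2 \<le> m3" by (rule entry_tensor_mats)
  obtain m where m: "entry (spin \<beta> * y) \<in> tensor_mats m" "m3 \<le> m" by (rule entry_tensor_mats)
  have "m1 \<le> m" "m2 \<le> m" "1 \<le> m" using m1(2) m2(2) m3(2) m(2) by auto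
  then have x: "entry x \<in> tensor_mats m" and y: "entry y \<in> tensor_mats m"
    and sx: "entry (spin \<alpha> * x) \<in> tensor_mats m" and m0: "0 < m"
    using tensor_mats_mono m1(1) m2(1) m3(1) m(2) by (metis, metis, metis, simp)
  define g where "g = (\<lambda>s. \<Sum>t\<in>words m. entry x s t * cnj (entry y s t))"
  define c where "c = (\<lambda>i. phase \<alpha> i * cnj (phase \<beta> i))"
  \<comment> \<open>the global flip; restricted, because words are extensional outside the first \<open>m\<close> sites\<close>
  define h where "h = (\<lambda>s :: nat \<Rightarrow> 2. restrict (flip \<circ> s) {..<m})"
  define k where "k = (\<lambda>s :: nat \<Rightarrow> 2. s(0 := flip (s 0)))"
  have hw: "h s \<in> words m" for s by (simp add: h_def restrict_in_words)
  have hh: "h (h s) = s" if "s \<in> words m" for s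
  proof -
    have "h (h s) = restrict s {..<m}" by (auto simp: h_def flip_simps restrict_def)
    then show ?thesis by (simp add: restrict_words[OF that])
  qed
  have bh: "bij_betw h (words m) (words m)"
    by (rule bij_betw_byWitness[of _ h]) (auto simp: hh hw)
  have kw: "k s \<in> words m" if "s \<in> words m" for s
    using that m0 by (auto simp: k_def words_def PiE_def extensional_def)
  have kk: "k (k s) = s" for s by (simp add: k_def flip_simps)
  have bk: "bij_betw k (words m) (words m)"
    by (rule bij_betw_byWitness[of _ k]) (auto simp: kw kk)
  have gh: "g (h s) = g s" if s: "s \<in> words m" for s
  proof -
    have inv: "entry z (h s) (h t) = entry z s t"
      if "z \<in> jones_algebra" "entry z \<in> tensor_mats m" "t \<in> words m" for z t
    proof -
      have "\<forall>j\<ge>m. (flip \<circ> s) j = (flip \<circ> t) j" using words_agree[OF s that(3)] by simp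
      from tensor_mats_eq[OF that(2) this] show ?thesis
        unfolding h_def jones_algebra_permute[OF that(1) bij_flip] by (rule sym)
    qed
    have "g (h s) = (\<Sum>t\<in>words m. entry x (h s) (h t) * cnj (entry y (h s) (h t)))"
      unfolding g_def by (rule sum.reindex_bij_betw[OF bh, symmetric])
    also have "\<dots> = g s" unfolding g_def by (rule sum.cong) (simp_all add: inv xy x y)
    finally show ?thesis .
  qed
  define S where "S = (\<Sum>s\<in>words m. c (s 0) * g (k s))"
  \<comment> \<open>the two phases are complex conjugates of each other\<close>
  have cf: "c (flip i) + c i = 2 * complex_of_real (cos (\<alpha> - \<beta>))" for i
    by (rule complex_eqI; use exhaust_2[of i] in
        \<open>auto simp: c_def phase_def flip_simps cos_diff sin_diff\<close>)
  have S1: "S = (\<Sum>s\<in>words m. c (flip (s 0)) * g s)"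
  proof -
    have "S = (\<Sum>s\<in>words m. (\<lambda>s. c (flip (s 0)) * g s) (k s))"
      unfolding S_def by (simp add: k_def flip_simps)
    then show ?thesis using sum.reindex_bij_betw[OF bk, of "\<lambda>s. c (flip (s 0)) * g s"] by simp
  qed
  also have "\<dots> = (\<Sum>s\<in>words m. (\<lambda>s. c (flip (s 0)) * g s) (h s))"
    by (rule sum.reindex_bij_betw[OF bh, symmetric])
  also have "\<dots> = (\<Sum>s\<in>words m. c (s 0) * g s)"
    using m0 by (intro sum.cong refl) (simp add: gh, simp add: h_def flip_simps)
  finally have "2 * S = (\<Sum>s\<in>words m. (c (flip (s 0)) + c (s 0)) * g s)"
    using S1 by (simp add: distrib_right sum.distrib)
  then have "S = complex_of_real (cos (\<alpha> - \<beta>)) * (\<Sum>s\<in>words m. g s)"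
    unfolding cf by (simp add: sum_distrib_left[symmetric] mult.assoc)
  moreover have "(\<Sum>s\<in>words m. \<Sum>t\<in>words m. entry (spin \<alpha> * x) s t * cnj (entry (spin \<beta> * y) s t)) = S"
    unfolding S_def g_def k_def c_def entry_spin_times by (simp add: sum_distrib_left mult_ac)
  ultimately show ?thesis
    unfolding cinner_tower_words[OF sx m(1)] cinner_tower_words[OF x y] by (simp add: g_def)
qed

section \<open>The subfactors and their angle\<close>

lemma bounded_linear_lmult: "bounded_linear (lmult x)"
  by (rule bounded_op_on_UNIV_linear[OF bounded_op_lmult])

lemma lmult_add: "lmult x (\<phi> + \<psi>) = lmult x \<phi> + lmult x \<psi>"
  using bounded_op_lmult[of x] by (simp add: bounded_op_on_def)

text \<open>Bounded operators on the GNS space that agree on the tower algebra are equal, because the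
  tower algebra is dense. The next lemma does the same for inner products.\<close>

lemma eq_if_eq_on_emb:
  fixes F G :: "'n::finite gns \<Rightarrow> 'n gns"
  assumes "bounded_linear F" "bounded_linear G" and eq: "\<And>x. F (emb x) = G (emb x)"
  shows "F \<phi> = G \<phi>"
proof -
  have "closed {\<phi>. F \<phi> = G \<phi>}" by (intro closed_Collect_eq linear_continuous_on assms)
  then have "closure (range emb) \<subseteq> {\<phi>. F \<phi> = G \<phi>}" by (rule closure_minimal[rotated]) (auto simp: eq)
  then show ?thesis unfolding closure_range_emb by blast
qed

lemma cinner_identity_closure:
  fixes F F' G G' :: "'h::complex_inner \<Rightarrow> 'h"
  assumes lin: "bounded_linear F" "bounded_linear F'" "bounded_linear G" "bounded_linear G'"
    and eq: "\<And>x y. x \<in> S \<Longrightarrow> y \<in> S \<Longrightarrow> cinner (F x) (G y) = c * cinner (F' x) (G' y)"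
    and xy: "x \<in> closure S" "y \<in> closure S"
  shows "cinner (F x) (G y) = c * cinner (F' x) (G' y)"
proof -
  let ?P = "{p. cinner (F (fst p)) (G (snd p)) = c * cinner (F' (fst p)) (G' (snd p))}"
  have "closed ?P"
    by (intro closed_Collect_eq continuous_on_mult continuous_on_const cinner.continuous_on
        bounded_linear.continuous_on[OF lin(1)] bounded_linear.continuous_on[OF lin(2)]
        bounded_linear.continuous_on[OF lin(3)] bounded_linear.continuous_on[OF lin(4)]
        continuous_on_fst continuous_on_snd continuous_on_id)
  then have "closure (S \<times> S) \<subseteq> ?P" by (rule closure_minimal[rotated]) (use eq in auto)
  then show ?thesis using xy by (auto simp: closure_Times)
qed

lemma cinner_lmult_left: "cinner (lmult x \<phi>) \<psi> = cinner \<phi> (lmult (star x) \<psi>)"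
proof -
  have "cinner (lmult x \<phi>) (id \<psi>) = 1 * cinner (id \<phi>) (lmult (star x) \<psi>)"
    by (rule cinner_identity_closure[of _ _ _ _ "range emb"])
      (auto simp: bounded_linear_lmult id_def bounded_linear_ident closure_range_emb lmult_emb
        cinner_emb cinner_times_left)
  then show ?thesis by simp
qed

lemma lmult_reducing:
  assumes inv: "\<And>\<phi>. \<phi> \<in> K \<Longrightarrow> lmult x \<phi> \<in> K" and inv': "\<And>\<phi>. \<phi> \<in> K \<Longrightarrow> lmult (star x) \<phi> \<in> K"
  shows "lmult x \<in> reducing_operators K"
  using bounded_op_lmult inv inv'
  by (auto simp: reducing_operators_def orth_complement_def cinner_lmult_left)

lemma lmult_closure_emb:
  assumes "\<And>x. x \<in> S \<Longrightarrow> emb (a * x) \<in> T" and \<phi>: "\<phi> \<in> closure (emb ` S)" and T: "closed T"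
  shows "lmult a \<phi> \<in> T"
proof -
  have "lmult a ` closure (emb ` S) \<subseteq> T"
    using assms by (intro image_closure_subset linear_continuous_on bounded_linear_lmult T)
      (auto simp: lmult_emb)
  then show ?thesis using \<phi> by blast
qed

text \<open>The \<open>L\<^sup>2\<close> space of the subalgebra which all spin model subfactors have in common.\<close>

definition jones_space :: "'n::finite gns set" where
  "jones_space = closure (emb ` jones_algebra)"

lemma csubspace_jones_space: "csubspace (jones_space :: 'n::finite gns set)"
proof -
  have "emb 0 = (0 :: 'n gns)" using emb_add[of 0 "0 :: 'n tower_alg"] by simp
  then have "csubspace (emb ` (jones_algebra :: 'n tower_alg set))"
    using csubspace_jones_algebra[where 'n='n]
    unfolding csubspace_def by (auto simp: emb_add[symmetric] emb_scaleC[symmetric] intro!: imageI)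
  then show ?thesis unfolding jones_space_def by (rule csubspace_closure)
qed

lemma emb_in_jones_space: "x \<in> jones_algebra \<Longrightarrow> emb x \<in> jones_space"
  unfolding jones_space_def by (intro subsetD[OF closure_subset] imageI)

lemma closed_jones_space: "closed jones_space"
  by (simp add: jones_space_def)

lemma lmult_jones_space: "\<phi> \<in> jones_space \<Longrightarrow> 1 \<le> j \<Longrightarrow> lmult (jones_proj j) \<phi> \<in> jones_space"
  by (rule lmult_closure_emb[of jones_algebra])
    (simp_all add: emb_in_jones_space jones_algebra.jones closed_jones_space jones_space_def[symmetric])

text \<open>The inner product formulas for the Jones algebra pass to its closure, and the abstract two-line
  picture applies with cosine \<open>cos (\<alpha> - \<beta>)\<close>.\<close>

lemma isometric_extension_pair_spin:
  "isometric_extension_pair jones_space (lmult (spin \<alpha>)) (lmult (spin \<beta>)) (cos (\<alpha> - \<beta>))"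
proof -
  note L = bounded_linear_lmult and I = bounded_linear_ident
  have angle: "cinner (lmult (spin \<alpha>) c) (lmult (spin \<beta>) d) = of_real (cos (\<alpha> - \<beta>)) * cinner c d"
    if "c \<in> jones_space" "d \<in> jones_space" for c d and \<alpha> \<beta> :: real
    by (rule cinner_identity_closure[OF L I L I _ that[unfolded jones_space_def]])
      (auto simp: lmult_emb cinner_emb cinner_spin_spin)
  have orth: "cinner c (lmult (spin \<alpha>) d) = 0" if "c \<in> jones_space" "d \<in> jones_space" for c d and \<alpha> :: real
  proof -
    have "cinner c (lmult (spin \<alpha>) d) = 0 * cinner c d"
      by (rule cinner_identity_closure[OF I I L I _ that[unfolded jones_space_def]])
        (auto simp: lmult_emb cinner_emb cinner_spin_right)
    then show ?thesis by simp
  qed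
  have ext: "isometric_extension jones_space (lmult (spin \<alpha>))" for \<alpha>
    by unfold_locales
      (simp_all add: csubspace_jones_space closed_jones_space bounded_op_lmult angle orth)
  show ?thesis
    by (intro isometric_extension_pair.intro isometric_extension_pair_axioms.intro ext angle)
qed

interpretation spin: isometric_extension jones_space "lmult (spin \<alpha>)" for \<alpha>
  using isometric_extension_pair_spin[of \<alpha> \<alpha>] by (rule isometric_extension_pair.axioms(1))

abbreviation spin_space :: "real \<Rightarrow> 2 gns set" where
  "spin_space \<alpha> \<equiv> isometric_extension.space jones_space (lmult (spin \<alpha>))"

lemma lmult_spin_spin: "lmult (spin \<alpha>) (lmult (spin \<alpha>) \<phi>) = \<phi>"
  by (rule eq_if_eq_on_emb[OF bounded_linear_compose[OF bounded_linear_lmult bounded_linear_lmult]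
        bounded_linear_ident]) (simp add: lmult_emb spin_spin)

lemma lmult_spin_space:
  assumes "\<phi> \<in> spin_space \<alpha>" shows "lmult (spin \<alpha>) \<phi> \<in> spin_space \<alpha>"
proof -
  obtain c d where "\<phi> = c + lmult (spin \<alpha>) d" "c \<in> jones_space" "d \<in> jones_space"
    using assms by (rule spin.spaceE)
  then show ?thesis
    using spin.spaceI[of d c \<alpha>] by (simp add: lmult_add lmult_spin_spin add.commute)
qed

text \<open>The Jones projections either commute with the spin or anticommute with it up to the unit, so they
  map \<open>U C\<close> into itself.\<close>

lemma lmult_jones_spin_space:
  assumes \<phi>: "\<phi> \<in> spin_space \<alpha>" and j: "1 \<le> j"
  shows "lmult (jones_proj j) \<phi> \<in> spin_space \<alpha>"
proof -
  let ?e = "jones_proj j :: 2 tower_alg"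
  obtain c d where cd: "\<phi> = c + lmult (spin \<alpha>) d" "c \<in> jones_space" "d \<in> jones_space"
    using \<phi> by (rule spin.spaceE)
  note L = bounded_linear_lmult and LL = bounded_linear_compose[OF bounded_linear_lmult bounded_linear_lmult]
  have "\<exists>d'\<in>jones_space. lmult ?e (lmult (spin \<alpha>) d) = lmult (spin \<alpha>) d'"
  proof (cases "j = 1")
    case True
    have "lmult ?e (lmult (spin \<alpha>) d) = lmult (spin \<alpha>) (d - lmult ?e d)"
      by (rule eq_if_eq_on_emb[OF LL bounded_linear_compose[OF L bounded_linear_sub[OF bounded_linear_ident L]]])
        (simp add: lmult_emb True jones_spin_anticommute[simplified] emb_diff[symmetric])
    then show ?thesis
      using csubspace_diff[OF csubspace_jones_space cd(3) lmult_jones_space[OF cd(3) j]] by blast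
  next
    case False
    have "lmult ?e (lmult (spin \<alpha>) d) = lmult (spin \<alpha>) (lmult ?e d)"
      by (rule eq_if_eq_on_emb[OF LL LL]) (use False j in \<open>simp add: lmult_emb jones_spin_commute\<close>)
    then show ?thesis using lmult_jones_space[OF cd(3) j] by blast
  qed
  then show ?thesis
    using spin.spaceI[OF lmult_jones_space[OF cd(2) j]] cd(1) by (auto simp: lmult_add)
qed

definition hadamard :: "real \<Rightarrow> complex^2^2" where
  "hadamard \<alpha> = (1 / sqrt 2) *\<^sub>R
      vector [vector [1, 1], vector [exp (\<i> * of_real \<alpha>), - exp (\<i> * of_real \<alpha>)]]"

text \<open>The conjugated diagonal algebra is spanned by the unit and the equatorial spin matrix.\<close>

lemma hadamard_conj_component:
  assumes "d \<in> diagonal_matrices"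
  shows "(hadamard \<alpha> ** d ** conj_transpose (hadamard \<alpha>)) $ i $ j =
    (if i = j then (d $ 1 $ 1 + d $ 2 $ 2) / 2 else (d $ 1 $ 1 - d $ 2 $ 2) / 2 * phase \<alpha> i)"
proof -
  have d: "d $ 1 $ 2 = 0" "d $ 2 $ 1 = 0" using assms by (auto simp: diagonal_matrices_def)
  have e: "exp (\<i> * of_real \<alpha>) = cis \<alpha>" by (simp add: cis_conv_exp)
  have p: "cis \<alpha> * cis (- \<alpha>) = 1" by (simp add: cis_mult)
  define c where "c = complex_of_real (1 / sqrt 2)"
  have c: "c * c = 1 / 2" "cnj c = c"
    by (simp_all add: c_def of_real_mult[symmetric] del: of_real_mult of_real_divide) simp
  have r: "(1 / sqrt 2) *\<^sub>R z = c * z" for z by (simp add: c_def scaleR_conv_of_real)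
  have h: "hadamard \<alpha> $ 1 $ 1 = c" "hadamard \<alpha> $ 1 $ 2 = c"
    "hadamard \<alpha> $ 2 $ 1 = c * cis \<alpha>" "hadamard \<alpha> $ 2 $ 2 = - (c * cis \<alpha>)"
    unfolding hadamard_def e vector_scaleR_component r vector_2 by simp_all
  have cc: "c * (c * z) = z / 2" for z using c(1) by (simp add: mult.assoc[symmetric])
  have pp: "cis \<alpha> * (cis (- \<alpha>) * z) = z" for z using p by (simp add: mult.assoc[symmetric])
  have comp: "(hadamard \<alpha> ** d ** conj_transpose (hadamard \<alpha>)) $ i $ j =
      hadamard \<alpha> $ i $ 1 * d $ 1 $ 1 * cnj (hadamard \<alpha> $ j $ 1) +
      hadamard \<alpha> $ i $ 2 * d $ 2 $ 2 * cnj (hadamard \<alpha> $ j $ 2)"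
    by (simp add: matrix_matrix_mult_def sum_2 conj_transpose_def d)
  show ?thesis
    unfolding comp using exhaust_2[of i] exhaust_2[of j]
    by (auto simp: h c(2) cis_cnj cc pp phase_def diff_divide_distrib add_divide_distrib algebra_simps)
qed

lemma hadamard_conj_times:
  assumes "d \<in> diagonal_matrices"
  shows "site 0 (hadamard \<alpha> ** d ** conj_transpose (hadamard \<alpha>)) * x =
    ((d $ 1 $ 1 + d $ 2 $ 2) / 2) *\<^sub>C x + ((d $ 1 $ 1 - d $ 2 $ 2) / 2) *\<^sub>C (spin \<alpha> * x)"
  unfolding entry_eq_iff
proof (intro allI)
  fix s t :: "nat \<Rightarrow> 2"
  consider "s 0 = 1" | "s 0 = 2" using exhaust_2 by blast
  then show "entry (site 0 (hadamard \<alpha> ** d ** conj_transpose (hadamard \<alpha>)) * x) s t =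
      entry (((d $ 1 $ 1 + d $ 2 $ 2) / 2) *\<^sub>C x + ((d $ 1 $ 1 - d $ 2 $ 2) / 2) *\<^sub>C (spin \<alpha> * x)) s t"
    unfolding entry_site_times[of _ "hadamard \<alpha> ** d ** conj_transpose (hadamard \<alpha>)"] sum_2
      plus_tower_alg.rep_eq scaleC_tower_alg.rep_eq hadamard_conj_component[OF assms] entry_spin_times
    by cases (simp_all add: fun_upd_idem flip_simps)
qed

lemma lmult_hadamard_conj:
  assumes "d \<in> diagonal_matrices"
  shows "lmult (site 0 (hadamard \<alpha> ** d ** conj_transpose (hadamard \<alpha>))) \<phi> =
    ((d $ 1 $ 1 + d $ 2 $ 2) / 2) *\<^sub>C \<phi> + ((d $ 1 $ 1 - d $ 2 $ 2) / 2) *\<^sub>C lmult (spin \<alpha>) \<phi>"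
  by (rule eq_if_eq_on_emb[OF bounded_linear_lmult bounded_linear_add[OF bounded_linear_scaleC
          bounded_linear_compose[OF bounded_linear_scaleC bounded_linear_lmult]]])
    (simp add: lmult_emb hadamard_conj_times[OF assms] emb_add emb_scaleC)

lemma conj_transpose_conjugate:
  fixes d :: "complex^'n^'n"
  shows "conj_transpose (u ** d ** conj_transpose u) = u ** conj_transpose d ** conj_transpose u"
proof -
  have "(\<Sum>x\<in>UNIV. \<Sum>y\<in>UNIV. u $ i $ x * cnj (d $ y $ x) * cnj (u $ j $ y)) =
      (\<Sum>y\<in>UNIV. \<Sum>x\<in>UNIV. u $ i $ x * cnj (d $ y $ x) * cnj (u $ j $ y))" for i j
    by (rule sum.swap)
  then show ?thesis
    by (simp add: conj_transpose_def matrix_matrix_mult_def vec_eq_iff sum_distrib_left sum_distrib_right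
        mult_ac)
qed

lemma conj_transpose_diagonal: "d \<in> diagonal_matrices \<Longrightarrow> conj_transpose d \<in> diagonal_matrices"
  by (auto simp: diagonal_matrices_def conj_transpose_def)

lemma vn_generated_minimal: "von_neumann_algebra M \<Longrightarrow> S \<subseteq> M \<Longrightarrow> vn_generated S \<subseteq> M"
  by (auto simp: vn_generated_def)

lemma vn_generated_base: "T \<in> S \<Longrightarrow> T \<in> vn_generated S"
  by (auto simp: vn_generated_def)

lemma
  shows vn_generated_id: "id \<in> vn_generated S"
    and vn_generated_add: "T \<in> vn_generated S \<Longrightarrow> T' \<in> vn_generated S \<Longrightarrow> (\<lambda>x. T x + T' x) \<in> vn_generated S"
    and vn_generated_comp: "T \<in> vn_generated S \<Longrightarrow> T' \<in> vn_generated S \<Longrightarrow> T \<circ> T' \<in> vn_generated S"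
    and vn_generated_scaleC: "T \<in> vn_generated S \<Longrightarrow> (\<lambda>x. a *\<^sub>C T x) \<in> vn_generated S"
  by (simp_all add: vn_generated_def von_neumann_algebra_def)

lemma csubspace_orbit: "csubspace ((\<lambda>T. T \<Omega>) ` vn_generated S)"
  unfolding csubspace_def
proof (intro conjI ballI allI)
  let ?V = "(\<lambda>T. T \<Omega>) ` vn_generated S"
  show sc: "a *\<^sub>C \<phi> \<in> ?V" if \<phi>: "\<phi> \<in> ?V" for a \<phi>
  proof -
    obtain T where "T \<in> vn_generated S" "\<phi> = T \<Omega>" using \<phi> by blast
    then show ?thesis
      by (intro image_eqI[of _ _ "\<lambda>x. a *\<^sub>C T x"] vn_generated_scaleC) auto
  qed
  have "id \<Omega> \<in> ?V" by (rule imageI[OF vn_generated_id])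
  then have "0 *\<^sub>C id \<Omega> \<in> ?V" by (rule sc)
  moreover have "0 *\<^sub>C id \<Omega> = 0" by (metis of_real_0 scaleR_scaleC scaleR_zero_left)
  ultimately show "0 \<in> ?V" by simp
  show "\<phi> + \<psi> \<in> ?V" if "\<phi> \<in> ?V" "\<psi> \<in> ?V" for \<phi> \<psi>
  proof -
    obtain T T' where "T \<in> vn_generated S" "\<phi> = T \<Omega>" "T' \<in> vn_generated S" "\<psi> = T' \<Omega>"
      using \<open>\<phi> \<in> ?V\<close> \<open>\<psi> \<in> ?V\<close> by blast
    then show ?thesis
      by (intro image_eqI[of _ _ "\<lambda>x. T x + T' x"] vn_generated_add) auto
  qed
qed

lemma spin_eq_hadamard_conj:
  "\<exists>d\<in>diagonal_matrices. equatorial \<alpha> = hadamard \<alpha> ** d ** conj_transpose (hadamard \<alpha>)"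
proof (rule bexI)
  let ?d = "vector [vector [1, 0], vector [0, - 1]] :: complex^2^2"
  show d: "?d \<in> diagonal_matrices" by (simp add: diagonal_matrices_def forall_2)
  show "equatorial \<alpha> = hadamard \<alpha> ** ?d ** conj_transpose (hadamard \<alpha>)"
    by (simp add: vec_eq_iff hadamard_conj_component[OF d] forall_2 equatorial_def phase_def)
qed

lemma spin_subfactor_subset_reducing: "spin_subfactor (hadamard \<alpha>) \<subseteq> reducing_operators (spin_space \<alpha>)"
  unfolding spin_subfactor_def
proof (rule vn_generated_minimal)
  show "von_neumann_algebra (reducing_operators (spin_space \<alpha>))"
    by (rule von_neumann_algebra_reducing_operators[OF spin.csubspace_space spin.closed_space])
  have "lmult (jones_proj j) \<in> reducing_operators (spin_space \<alpha>)" if "1 \<le> j" for j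
    using that by (intro lmult_reducing) (simp_all add: star_jones_proj lmult_jones_spin_space)
  moreover have "lmult (site 0 (hadamard \<alpha> ** d ** conj_transpose (hadamard \<alpha>))) \<in> reducing_operators (spin_space \<alpha>)"
    if d: "d \<in> diagonal_matrices" for d
  proof -
    have "lmult (site 0 (hadamard \<alpha> ** d ** conj_transpose (hadamard \<alpha>))) \<phi> \<in> spin_space \<alpha>"
      if "d \<in> diagonal_matrices" "\<phi> \<in> spin_space \<alpha>" for d \<phi>
      unfolding lmult_hadamard_conj[OF that(1)] using that(2)
      by (intro csubspace_add csubspace_scaleC spin.csubspace_space lmult_spin_space)
    then show ?thesis
      using d by (intro lmult_reducing) (simp_all add: star_site conj_transpose_conjugate conj_transpose_diagonal)
  qed
  ultimately show "lmult ` ({site 0 (hadamard \<alpha> ** d ** conj_transpose (hadamard \<alpha>)) |d. d \<in> diagonal_matrices} \<union>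
      {jones_proj j |j. 1 \<le> j}) \<subseteq> reducing_operators (spin_space \<alpha>)"
    by blast
qed

text \<open>The space \<open>C + U C\<close> contains the vacuum and reduces the generators, hence the whole subfactor;
  conversely products of generators applied to the vacuum are dense in it.\<close>

lemma L2_space_spin_subfactor: "L2_space vacuum (spin_subfactor (hadamard \<alpha>)) = spin_space \<alpha>"
proof
  have vac: "vacuum \<in> spin_space \<alpha>"
    unfolding vacuum_def by (intro spin.C_subset_space emb_in_jones_space jones_algebra.one)
  have "(\<lambda>T. T vacuum) ` spin_subfactor (hadamard \<alpha>) \<subseteq> spin_space \<alpha>"
    using spin_subfactor_subset_reducing[of \<alpha>] vac by (auto simp: reducing_operators_def)
  then show "L2_space vacuum (spin_subfactor (hadamard \<alpha>)) \<subseteq> spin_space \<alpha>"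
    unfolding L2_space_def by (rule closure_minimal[OF _ spin.closed_space])
next
  define M where "M = spin_subfactor (hadamard \<alpha>)"
  define orbit where "orbit = (\<lambda>T. T vacuum) ` M"
  note M = M_def[unfolded spin_subfactor_def]
  have step: "lmult a \<phi> \<in> orbit" if a: "lmult a \<in> M" and \<phi>: "\<phi> \<in> orbit" for a \<phi>
  proof -
    obtain T where T: "T \<in> M" "\<phi> = T vacuum" using \<phi> by (auto simp: orbit_def)
    have "lmult a \<circ> T \<in> M" using a T(1) unfolding M by (rule vn_generated_comp)
    then show ?thesis unfolding orbit_def T(2) by (rule rev_image_eqI) simp
  qed
  have orbit: "csubspace orbit"
    unfolding orbit_def M by (rule csubspace_orbit)
  have e: "lmult (jones_proj j) \<in> M" if "1 \<le> j" for j
    unfolding M using that by (intro vn_generated_base) blast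
  have s: "lmult (spin \<alpha>) \<in> M"
    unfolding M using spin_eq_hadamard_conj[of \<alpha>] by (intro vn_generated_base imageI UnI1) auto
  have emb: "emb x \<in> orbit" if "x \<in> jones_algebra" for x
    using that
  proof induction
    case one
    have "id \<in> M" unfolding M by (rule vn_generated_id)
    then show ?case unfolding orbit_def vacuum_def by (rule rev_image_eqI) simp
  next
    case (jones x j)
    then show ?case using step[OF e] by (metis lmult_emb)
  qed (simp_all add: emb_add emb_scaleC csubspace_add[OF orbit] csubspace_scaleC[OF orbit])
  note closed_orbit = csubspace_closure[OF orbit]
  have "jones_space \<subseteq> closure orbit"
    unfolding jones_space_def using emb by (intro closure_mono) blast
  moreover have "lmult (spin \<alpha>) d \<in> closure orbit" if "d \<in> jones_space" for d
  proof (rule lmult_closure_emb[OF _ that[unfolded jones_space_def]])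
    fix x assume "x \<in> (jones_algebra :: 2 tower_alg set)"
    then have "emb (spin \<alpha> * x) \<in> orbit" using step[OF s emb] by (simp add: lmult_emb)
    then show "emb (spin \<alpha> * x) \<in> closure orbit" using closure_subset by blast
  qed simp
  ultimately show "spin_space \<alpha> \<subseteq> L2_space vacuum (spin_subfactor (hadamard \<alpha>))"
    unfolding L2_space_def M_def[symmetric] orbit_def[symmetric]
    using csubspace_add[OF closed_orbit] by (auto elim!: spin.spaceE)
qed

theorem theorem1p9:
  fixes \<alpha> \<beta> :: real and u v :: "complex^2^2"
  assumes "\<alpha> \<in> {0..<2 * pi}" and "\<beta> \<in> {0..<2 * pi}"
    and "\<beta> \<notin> {\<alpha>, \<alpha> + pi, \<alpha> - pi}"
    and "u = (1 / sqrt 2) *\<^sub>R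
      vector [vector [1, 1], vector [exp (\<i> * of_real \<alpha>), - exp (\<i> * of_real \<alpha>)]]"
    and "v = (1 / sqrt 2) *\<^sub>R
      vector [vector [1, 1], vector [exp (\<i> * of_real \<beta>), - exp (\<i> * of_real \<beta>)]]"
  shows "vn_angle vacuum hyperfinite_factor (spin_subfactor u) (spin_subfactor v) =
    {complex_of_real (arccos \<bar>cos (\<alpha> - \<beta>)\<bar>)}"
proof -
  have uv: "u = hadamard \<alpha>" "v = hadamard \<beta>" using assms(4,5) by (simp_all add: hadamard_def)
  have "sin (\<alpha> - \<beta>) \<noteq> 0"
  proof
    assume "sin (\<alpha> - \<beta>) = 0"
    then obtain i :: int where i: "\<alpha> - \<beta> = of_int i * pi" unfolding sin_zero_iff_int2 by blast
    have "\<bar>\<alpha> - \<beta>\<bar> < 2 * pi" using assms(1,2) by auto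
    then have "\<bar>real_of_int i\<bar> < 2" unfolding i by (simp add: abs_mult)
    then have "\<bar>i\<bar> < 2" by linarith
    then have "i = 0 \<or> i = 1 \<or> i = - 1" by linarith
    then show False using i assms(3) by auto
  qed
  then have "0 < (sin (\<alpha> - \<beta>))\<^sup>2" by (rule zero_less_power2[THEN iffD2])
  then have "(cos (\<alpha> - \<beta>))\<^sup>2 < 1" using sin_cos_squared_add[of "\<alpha> - \<beta>"] by linarith
  then have c: "\<bar>cos (\<alpha> - \<beta>)\<bar> < 1" by (simp add: abs_square_less_1)
  have "emb 1 \<in> jones_space" by (intro emb_in_jones_space jones_algebra.one)
  moreover have "emb (1 :: 2 tower_alg) \<noteq> 0"
  proof
    assume "emb (1 :: 2 tower_alg) = 0"
    then have "norm (1 :: 2 tower_alg) = 0" by (metis norm_emb norm_zero)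
    then have "entry (1 :: 2 tower_alg) (\<lambda>_. 1) (\<lambda>_. 1) = 0" by (simp add: zero_tower_alg.rep_eq)
    then show False by (simp add: one_tower_alg.rep_eq)
  qed
  ultimately have ne: "(jones_space :: 2 gns set) \<noteq> {0}" by blast
  show ?thesis
    unfolding vn_angle_def L2_space_hyperfinite_factor uv L2_space_spin_subfactor
    by (rule isometric_extension_pair.projection_angle[OF isometric_extension_pair_spin ne c])
qed

end
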